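(* Let $T\in(0,\infty)$, $\alpha>0$, $\nu:=\alpha-1/2$, and let $0<z^{(\nu)}_1<z^{(\nu)}_2<\cdots$ be the positive zeros of the Bessel function $J_\nu$ of the first kind. Let $(X^{(\alpha)}_t)_{t\in[0,T]}$ be the $\alpha$-Wiener bridge on $[0,T]$. Then in the Karhunen--Loève expansion $$X_t^{(\alpha)}=\sum_{k=1}^\infty\sqrt{\lambda^{(\alpha)}_k}\,\xi_k\,e^{(\alpha)}_k(t),\qquad t\in[0,T],$$ of $(X^{(\alpha)}_t)_{t\in[0,T]}$, the (non-zero) eigenvalues and the corresponding normed eigenfunctions (unique up to sign) are $$\lambda^{(\alpha)}_k=\frac{T^2}{(z_k^{(\nu)})^2},\qquad k\in\mathbb{N},$$ $$e^{(\alpha)}_k(t)=\sqrt{\frac{2}{T}\Big(1-\frac{t}{T}\Big)}\,\frac{J_\nu\big(z_k^{(\nu)}(1-t/T)\big)}{\big|J_{\nu+1}\big(z_k^{(\nu)}\big)\big|}=\sqrt{\frac{2}{T}\Big(1-\frac{t}{T}\Big)}\,\frac{J_\nu\big(z_k^{(\nu)}(1-t/T)\big)}{\big|J_{\nu-1}\big(z_k^{(\nu)}\big)\big|},\qquad t\in[0,T],\ k\in\mathbb{N},$$ where for $-1/2<\nu<0$ the continuous extension of $e_k^{(\alpha)}$ at $t=T$ is taken, i.e., $e_k^{(\alpha)}(T)=0$ for $\alpha<1/2$.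
   Context: Let $(B_t)_{t\ge 0}$ be a standard Wiener process. For $\alpha>0$ and $T\in(0,\infty)$ the $\alpha$-Wiener bridge on $[0,T]$ is the process $X_t^{(\alpha)}=\int_0^t\big(\frac{T-t}{T-s}\big)^\alpha\,dB_s$, $t\in[0,T)$, i.e. the unique strong solution of $dX_t^{(\alpha)}=-\frac{\alpha}{T-t}X_t^{(\alpha)}\,dt+dB_t$, $X_0^{(\alpha)}=0$, extended by $X_T^{(\alpha)}=0$ (the extension is almost surely continuous on $[0,T]$). It is a centered Gaussian process with covariance function, for $s,t\in[0,T)$, $$R^{(\alpha)}(s,t)=\begin{cases}\frac{(T-s)^\alpha(T-t)^\alpha}{1-2\alpha}\big(T^{1-2\alpha}-(T-(s\wedge t))^{1-2\alpha}\big)&\text{if }\alpha\ne\frac12,\\ \sqrt{(T-s)(T-t)}\,\ln\big(\frac{T}{T-(s\wedge t)}\big)&\text{if }\alpha=\frac12,\end{cases}$$ and $R^{(\alpha)}(s,t)=0$ if $s=T$ or $t=T$; $R^{(\alpha)}$ is continuous on $[0,T]^2$. Karhunen--Loève expansion of $X^{(\alpha)}$ based on $[0,T]$: let $A:L^2[0,T]\to L^2[0,T]$, $(A\phi)(t)=\int_0^T R^{(\alpha)}(t,s)\phi(s)\,ds$. The $\lambda^{(\alpha)}_k$, $k\in\mathbb{N}$, are the non-zero eigenvalues of $A$ and $e^{(\alpha)}_k$ the corresponding (continuous) eigenfunctions normed in $L^2[0,T]$ and pairwise orthogonal in $L^2[0,T]$; $\xi_k$, $k\in\mathbb{N}$,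 are independent standard normal random variables, and the series converges to $X_t^{(\alpha)}$ in $L^2(\Omega,\mathcal{A},\mathsf{P})$ uniformly in $t\in[0,T]$. The Bessel function of the first kind of order $\nu\in\mathbb{R}$ is $J_\nu(x)=\sum_{k=0}^\infty\frac{(-1)^k}{k!\,\Gamma(k+\nu+1)}\big(\frac{x}{2}\big)^{2k+\nu}$, $x>0$, with the convention $1/\Gamma(-k):=0$ for $k=0,1,2,\ldots$; for $\nu\ge 0$ it is continuously extended to $x=0$ by $J_0(0)=1$ and $J_\nu(0)=0$ for $\nu>0$. For $\nu>-1$, $J_\nu$ has infinitely many positive zeros, all simple, listed increasingly as $z^{(\nu)}_k$, $k\in\mathbb{N}=\{1,2,\dots\}$. *)

theory Defs
  imports "HOL-Probability.Probability"
begin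

section \<open>Bessel functions of the first kind, of real order\<close>

text \<open>
  \<^const>\<open>rGamma\<close> is the reciprocal Gamma function, so it is \<open>0\<close> at \<open>0, -1, -2, \<dots>\<close>. The case
  \<open>x = 0\<close> has to be separated because \<open>0 powr 0 = 0\<close>; the value at \<open>x = 0\<close> is only meaningful
  for \<open>\<nu> \<ge> 0\<close> (for \<open>\<nu> < 0\<close> it is a dummy), and negative \<open>x\<close> is not considered.
\<close>

definition bessel_J :: "real \<Rightarrow> real \<Rightarrow> real" where
  "bessel_J \<nu> x =
     (if x = 0 then (if \<nu> = 0 then 1 else 0)
      else (\<Sum>k. (-1) ^ k / fact k * rGamma (real k + \<nu> + 1) * (x / 2) powr (2 * real k + \<nu>)))"


section \<open>Wiener process and \<open>\<alpha>\<close>-Wiener bridge\<close>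

definition wiener_process :: "'a measure \<Rightarrow> (real \<Rightarrow> 'a \<Rightarrow> real) \<Rightarrow> bool" where
  "wiener_process M B \<longleftrightarrow>
     prob_space M \<and>
     (\<forall>t\<ge>0. B t \<in> borel_measurable M) \<and>
     (AE \<omega> in M. B 0 \<omega> = 0) \<and>
     (\<forall>s t. 0 \<le> s \<and> s < t \<longrightarrow>
        distributed M lborel (\<lambda>\<omega>. B t \<omega> - B s \<omega>) (normal_density 0 (sqrt (t - s)))) \<and>
     (\<forall>(t :: nat \<Rightarrow> real) n. 0 \<le> t 0 \<and> incseq t \<longrightarrow>
        prob_space.indep_vars M (\<lambda>_. borel) (\<lambda>i \<omega>. B (t (Suc i)) \<omega> - B (t i) \<omega>) {..<n}) \<and>
     (AE \<omega> in M. continuous_on {0..} (\<lambda>t. B t \<omega>))"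

text \<open>
  \<open>X\<close> solves \<open>dX\<^sub>t = - \<alpha> / (T - t) X\<^sub>t dt + dB\<^sub>t\<close>, \<open>X\<^sub>0 = 0\<close> on \<open>[0,T)\<close>, and \<open>X\<^sub>T = 0\<close>. The noise is
  additive, so the integral form of the equation contains no stochastic integral. Adaptedness
  (``strong'' solution) need not be required: the equation determines almost every path of \<open>X\<close>
  on \<open>[0,t]\<close> from the path of \<open>B\<close> on \<open>[0,t]\<close>. Continuity at \<open>T\<close> is not part of the definition.
\<close>

definition alpha_wiener_bridge ::
  "'a measure \<Rightarrow> (real \<Rightarrow> 'a \<Rightarrow> real) \<Rightarrow> real \<Rightarrow> real \<Rightarrow> (real \<Rightarrow> 'a \<Rightarrow> real) \<Rightarrow> bool" where
  "alpha_wiener_bridge M B T \<alpha> X \<longleftrightarrow>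
     (\<forall>t\<in>{0..T}. X t \<in> borel_measurable M) \<and>
     (AE \<omega> in M.
        X 0 \<omega> = 0 \<and>
        continuous_on {0..<T} (\<lambda>t. X t \<omega>) \<and>
        (\<forall>t\<in>{0..<T}. X t \<omega> = (LBINT s:{0..t}. - (\<alpha> / (T - s)) * X s \<omega>) + B t \<omega>) \<and>
        X T \<omega> = 0)"


section \<open>The covariance operator on \<open>L\<^sup>2[0,T]\<close> and the Karhunen--Loeve expansion\<close>

definition covariance_kernel :: "'a measure \<Rightarrow> (real \<Rightarrow> 'a \<Rightarrow> real) \<Rightarrow> real \<Rightarrow> real \<Rightarrow> real" where
  "covariance_kernel M X s t =
     (\<integral>\<omega>. (X s \<omega> - (\<integral>\<eta>. X s \<eta> \<partial>M)) * (X t \<omega> - (\<integral>\<eta>. X t \<eta> \<partial>M)) \<partial>M)"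

definition integral_operator :: "real \<Rightarrow> (real \<Rightarrow> real \<Rightarrow> real) \<Rightarrow> (real \<Rightarrow> real) \<Rightarrow> real \<Rightarrow> real" where
  "integral_operator T R \<phi> t = (LBINT s:{0..T}. R t s * \<phi> s)"

text \<open>Elements of \<open>L\<^sup>2[0,T]\<close> are represented by functions; equality in \<open>L\<^sup>2[0,T]\<close> is equality
  almost everywhere on \<open>[0,T]\<close>.\<close>

definition L2_fun :: "real \<Rightarrow> (real \<Rightarrow> real) \<Rightarrow> bool" where
  "L2_fun T \<phi> \<longleftrightarrow> set_borel_measurable lborel {0..T} \<phi> \<and> set_integrable lborel {0..T} (\<lambda>t. (\<phi> t)\<^sup>2)"

definition L2_inner :: "real \<Rightarrow> (real \<Rightarrow> real) \<Rightarrow> (real \<Rightarrow> real) \<Rightarrow> real" where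
  "L2_inner T \<phi> \<psi> = (LBINT t:{0..T}. \<phi> t * \<psi> t)"

definition eigenfunction ::
  "real \<Rightarrow> (real \<Rightarrow> real \<Rightarrow> real) \<Rightarrow> real \<Rightarrow> (real \<Rightarrow> real) \<Rightarrow> bool" where
  "eigenfunction T R \<mu> \<phi> \<longleftrightarrow>
     L2_fun T \<phi> \<and>
     \<not> (AE t in lborel. t \<in> {0..T} \<longrightarrow> \<phi> t = 0) \<and>
     (AE t in lborel. t \<in> {0..T} \<longrightarrow> integral_operator T R \<phi> t = \<mu> * \<phi> t)"

definition eigenvalue :: "real \<Rightarrow> (real \<Rightarrow> real \<Rightarrow> real) \<Rightarrow> real \<Rightarrow> bool" where
  "eigenvalue T R \<mu> \<longleftrightarrow> (\<exists>\<phi>. eigenfunction T R \<mu> \<phi>)"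

definition normed_eigenfunction ::
  "real \<Rightarrow> (real \<Rightarrow> real \<Rightarrow> real) \<Rightarrow> real \<Rightarrow> (real \<Rightarrow> real) \<Rightarrow> bool" where
  "normed_eigenfunction T R \<mu> \<phi> \<longleftrightarrow>
     continuous_on {0..T} \<phi> \<and> eigenfunction T R \<mu> \<phi> \<and> L2_inner T \<phi> \<phi> = 1"

text \<open>
  Families are indexed by \<open>k \<ge> 1\<close>. The third condition says that no non-zero eigenvalue is missing,
  counted with multiplicity: no eigenfunction of a non-zero eigenvalue is orthogonal to all \<open>e k\<close>.
  The last two conditions are convergence of the series to \<open>X t\<close> in \<open>L\<^sup>2\<close> of the probability space,
  uniformly in \<open>t \<in> [0,T]\<close>. The process is meant to be centred.
\<close>

definition karhunen_loeve_expansion ::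
  "'a measure \<Rightarrow> real \<Rightarrow> (real \<Rightarrow> 'a \<Rightarrow> real) \<Rightarrow>
   (nat \<Rightarrow> real) \<Rightarrow> (nat \<Rightarrow> 'a \<Rightarrow> real) \<Rightarrow> (nat \<Rightarrow> real \<Rightarrow> real) \<Rightarrow> bool" where
  "karhunen_loeve_expansion M T X l \<xi> e \<longleftrightarrow>
     (\<forall>k\<ge>1. l k \<noteq> 0 \<and> normed_eigenfunction T (covariance_kernel M X) (l k) (e k)) \<and>
     (\<forall>j\<ge>1. \<forall>k\<ge>1. j \<noteq> k \<longrightarrow> L2_inner T (e j) (e k) = 0) \<and>
     (\<forall>\<mu> \<phi>. \<mu> \<noteq> 0 \<and> eigenfunction T (covariance_kernel M X) \<mu> \<phi> \<longrightarrow>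
        (\<exists>k\<ge>1. L2_inner T \<phi> (e k) \<noteq> 0)) \<and>
     prob_space.indep_vars M (\<lambda>_. borel) \<xi> {1..} \<and>
     (\<forall>k\<ge>1. distributed M lborel (\<xi> k) std_normal_density) \<and>
     (\<forall>n. \<forall>t\<in>{0..T}. integrable M (\<lambda>\<omega>. (X t \<omega> - (\<Sum>k=1..n. sqrt (l k) * \<xi> k \<omega> * e k t))\<^sup>2)) \<and>
     uniform_limit {0..T}
       (\<lambda>n t. \<integral>\<omega>. (X t \<omega> - (\<Sum>k=1..n. sqrt (l k) * \<xi> k \<omega> * e k t))\<^sup>2 \<partial>M) (\<lambda>t. 0) sequentially"

end

theory Submission
  imports Defs "HOL-Complex_Analysis.Great_Picard"
begin

text \<open>
  On \<open>[0,T)\<close> the equation is solved pathwise by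
  \<open>X\<^sub>t = B\<^sub>t - (T - t)\<^sup>\<alpha> \<integral> \<alpha> (T - s)\<^bsup>-\<alpha>-1\<^esup> B\<^sub>s ds\<close> (integral over \<open>[0,t]\<close>). Hence every \<open>X\<^sub>t\<close> lies in the
  \<open>L\<^sup>2\<close>-closure of the span of \<open>B\<close>, and the covariance is \<open>R s t = w s w t V (min s t)\<close> with
  \<open>w t = (T - t)\<^sup>\<alpha>\<close> and \<open>V' = 1 / w\<^sup>2\<close>, \<open>V 0 = 0\<close>. Writing an eigenfunction for \<open>\<mu>\<close> as \<open>w u\<close> turns the
  integral equation into the system \<open>\<mu> w\<^sup>2 u' = Q\<close>, \<open>Q' = - w\<^sup>2 u\<close> with \<open>u 0 = 0\<close>, \<open>Q T = 0\<close>. Its solution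
  that is regular at \<open>T\<close> is an entire function times a power, namely \<open>x\<^bsup>-\<nu>\<^esup> J\<^sub>\<nu>(\<surd>(1/\<mu>) T x)\<close> at
  \<open>x = 1 - t/T\<close>; a Wronskian shows that there is no other one, and \<open>u 0 = 0\<close> selects the zeros of \<open>J\<^sub>\<nu>\<close>.

  Instead of the spectral theorem, power iteration and the Arzela--Ascoli theorem show that a
  continuous function orthogonal to all \<open>e\<^sub>k\<close> is annihilated by the covariance operator. Applied to
  \<open>R s - \<Sum> \<lambda>\<^sub>k e\<^sub>k(s) e\<^sub>k\<close> this yields \<open>R s s = \<Sum> \<lambda>\<^sub>k e\<^sub>k(s)\<^sup>2\<close>, uniformly by Dini's theorem. The coefficients
  \<open>\<xi>\<^sub>k = \<lambda>\<^sub>k\<^bsup>-1/2\<^esup> \<integral> X\<^sub>s e\<^sub>k(s) ds\<close>, taken as mean-square integrals, are orthonormal elements of a Gaussian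
  space and therefore independent, and the mean-square error of the partial sums at \<open>t\<close> is
  \<open>R t t - \<Sum> \<lambda>\<^sub>k e\<^sub>k(t)\<^sup>2\<close>.
\<close>

section \<open>Bessel functions\<close>

text \<open>The obstacle is the end point \<open>T\<close>. There \<open>w\<close> vanishes, while
  \<open>V\<close> blows up as soon as \<open>a \<ge> 1/2\<close>, so no initial value for
  \<open>u\<close> can be prescribed at \<open>T\<close>; that end only offers
  \<open>Q T = 0\<close> and the continuity of \<open>w u\<close>. Identities that reach
  \<open>T\<close> are therefore integrated between quantities that stay continuous there, and
  uniqueness is argued from \<open>0\<close>, on intervals \<open>[0,b]\<close> with
  \<open>b < T\<close>. The first-order system needs no second derivatives: its coefficients match
  two recurrences of the entire factor.

  On the side of probability, measurability in the sample point is available for each fixed time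
  only. Integrals over time are therefore limits of Riemann sums in mean square; their existence
  depends on the covariance alone, and they stay in the Gaussian space.

  Completeness rests on the classification of eigenfunctions: power iteration from a function
  orthogonal to all \<open>e k\<close> but not annihilated would end in an eigenfunction orthogonal
  to all of them, although it must be a multiple of some \<open>e k\<close>.\<close>

text \<open>The entire factor of \<open>J\<^sub>\<nu>\<close>; unlike \<open>J\<^sub>\<nu>\<close> it also serves the negative arguments that arise from
  possible negative eigenvalues.\<close>

definition bessel_entire :: "real \<Rightarrow> real \<Rightarrow> real" where
  "bessel_entire \<nu> y = (\<Sum>k. (-1/4) ^ k / fact k * rGamma (real k + \<nu> + 1) * y ^ k)"

text \<open>Consecutive terms are compared through \<open>rGamma d = d * rGamma (d + 1)\<close>,
  which also holds at the poles of Gamma, so no quotient of Gamma values is formed.\<close>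

lemma bessel_entire_summable: "summable (\<lambda>k. (-1/4) ^ k / fact k * rGamma (real k + \<nu> + 1) * (y::real) ^ k)"
proof -
  \<comment> \<open>From \<open>N\<close> on, \<open>d = n + \<nu> + 1\<close> is positive and
    dominates \<open>abs y\<close>; this is all that the ratio \<open>1/2\<close> needs.\<close>
  obtain N :: nat where N: "real N > \<bar>\<nu>\<bar> + 1 + \<bar>y\<bar>"
    using reals_Archimedean2 by blast
  show ?thesis
  proof (rule summable_ratio_test[where c = "1/2" and N = N])
    fix n assume n: "N \<le> n"
    define r where "r = rGamma (real (Suc n) + \<nu> + 1)"
    define d where "d = real n + \<nu> + 1"
    have "real N \<le> real n" using n by simp
    then have d: "d \<ge> \<bar>y\<bar>" "d > 0" using N by (auto simp: d_def)
    have "rGamma (real n + \<nu> + 1) = d * r"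
      using rGamma_plus1[of d] by (simp add: d_def r_def algebra_simps)
    then have eq: "norm ((-1/4) ^ n / fact n * rGamma (real n + \<nu> + 1) * y ^ n) =
        (1/4)^n / fact n * \<bar>y\<bar>^n * \<bar>r\<bar> * d"
      using d by (simp add: abs_mult power_abs power_mult_distrib[symmetric])
    have "norm ((-1/4) ^ Suc n / fact (Suc n) * rGamma (real (Suc n) + \<nu> + 1) * y ^ Suc n) =
        (1/4)^n / fact n * \<bar>y\<bar>^n * \<bar>r\<bar> * (\<bar>y\<bar> / (4 * real (Suc n)))"
      by (simp add: abs_mult power_abs r_def field_simps)
    also have "\<dots> \<le> (1/4)^n / fact n * \<bar>y\<bar>^n * \<bar>r\<bar> * (1 / 2 * d)"
    proof (rule mult_left_mono)
      have "\<bar>y\<bar> / (4 * real (Suc n)) \<le> \<bar>y\<bar> / 2" by (rule divide_left_mono) auto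
      also have "\<dots> \<le> 1/2 * d" using d by simp
      finally show "\<bar>y\<bar> / (4 * real (Suc n)) \<le> 1/2 * d" .
    qed simp
    finally show "norm ((-1/4) ^ Suc n / fact (Suc n) * rGamma (real (Suc n) + \<nu> + 1) * y ^ Suc n)
        \<le> 1/2 * norm ((-1/4) ^ n / fact n * rGamma (real n + \<nu> + 1) * y ^ n)"
      unfolding eq by (simp add: algebra_simps)
  qed simp
qed

lemma bessel_J_eq_bessel_entire:
  assumes "x > 0"
  shows "bessel_J \<nu> x = (x/2) powr \<nu> * bessel_entire \<nu> (x\<^sup>2)"
proof -
  have *: "(-1) ^ k / fact k * rGamma (real k + \<nu> + 1) * (x/2) powr (2 * real k + \<nu>)
      = (x/2) powr \<nu> * ((-1/4) ^ k / fact k * rGamma (real k + \<nu> + 1) * (x\<^sup>2) ^ k)" for k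
  proof -
    have "(x/2) powr (2 * real k + \<nu>) = (x/2) powr \<nu> * ((x/2)\<^sup>2)^k"
    proof -
      have "(x/2) powr (2 * real k + \<nu>) = (x/2) powr (real (2 * k)) * (x/2) powr \<nu>"
        by (simp add: powr_add)
      also have "(x/2) powr (real (2 * k)) = (x/2) ^ (2 * k)"
        using assms by (intro powr_realpow) simp
      finally show ?thesis by (simp only: power_mult mult.commute[of "(x/2) powr \<nu>"])
    qed
    moreover have "(-1::real)^k * ((x/2)\<^sup>2)^k = (-1/4)^k * (x\<^sup>2)^k"
      unfolding power_mult_distrib[symmetric] by (simp add: power_divide)
    ultimately show ?thesis by (simp add: algebra_simps)
  qed
  have "bessel_J \<nu> x = (\<Sum>k. (x/2) powr \<nu> * ((-1/4) ^ k / fact k * rGamma (real k + \<nu> + 1) * (x\<^sup>2) ^ k))"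
    using assms by (simp only: bessel_J_def * less_imp_neq[symmetric] if_False)
  also have "\<dots> = (x/2) powr \<nu> * bessel_entire \<nu> (x\<^sup>2)"
    unfolding bessel_entire_def by (rule suminf_mult[OF bessel_entire_summable])
  finally show ?thesis .
qed

text \<open>In terms of \<open>J\<close> this is
  \<open>(x^(-\<nu>) J_\<nu>)' = - x^(-\<nu>) J_(\<nu>+1)\<close>. The factor \<open>k + 1\<close>
  of the derived series cancels against the factorial, and the shifted index is read as a shifted
  order.\<close>

lemma DERIV_bessel_entire: "(bessel_entire \<nu> has_real_derivative - (bessel_entire (\<nu> + 1) y / 4)) (at y)"
proof -
  let ?c = "\<lambda>\<nu> k. (-1/4) ^ k / fact k * rGamma (real k + \<nu> + 1) :: real"
  have "((\<lambda>y. \<Sum>k. ?c \<nu> k * y ^ k) has_real_derivative (\<Sum>k. diffs (?c \<nu>) k * y ^ k)) (at y)"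
    by (rule termdiffs_strong_converges_everywhere) (rule bessel_entire_summable)
  moreover have "diffs (?c \<nu>) k = - (1/4) * ?c (\<nu> + 1) k" for k
  proof -
    have "real (Suc k) / fact (Suc k) = (1 / fact k :: real)"
      by (simp only: fact_Suc of_nat_mult) (simp del: of_nat_Suc)
    moreover have "real (Suc k) * ((-1/4) ^ Suc k / fact (Suc k) * r)
        = (-1/4) ^ Suc k * r * (real (Suc k) / fact (Suc k))" for r :: real
      by (simp only: times_divide_eq_left times_divide_eq_right mult_ac)
    ultimately have "real (Suc k) * ((-1/4) ^ Suc k / fact (Suc k) * r) = - (1/4) * ((-1/4) ^ k / fact k * r)" for r :: real
      by simp
    then show ?thesis by (simp add: diffs_def add_ac)
  qed
  then have "(\<Sum>k. diffs (?c \<nu>) k * y ^ k) = (\<Sum>k. - (1/4) * (?c (\<nu> + 1) k * y ^ k))"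
    by (simp add: mult.assoc)
  also have "\<dots> = - (1/4) * bessel_entire (\<nu> + 1) y"
    unfolding bessel_entire_def by (rule suminf_mult[OF bessel_entire_summable])
  ultimately show ?thesis by (simp add: bessel_entire_def[abs_def])
qed

lemma DERIV_bessel_entire_chain [derivative_intros]:
  assumes "(g has_real_derivative g') (at x within S)"
  shows "((\<lambda>x. bessel_entire \<nu> (g x)) has_real_derivative - (bessel_entire (\<nu> + 1) (g x) / 4) * g') (at x within S)"
  using DERIV_chain2[OF DERIV_bessel_entire assms] .

lemma continuous_on_bessel_entire [continuous_intros]:
  assumes "continuous_on S g"
  shows "continuous_on S (\<lambda>x. bessel_entire \<nu> (g x))"
proof -
  have "continuous_on UNIV (bessel_entire \<nu>)"
    by (rule DERIV_continuous_on) (rule DERIV_subset[OF DERIV_bessel_entire], simp)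
  then show ?thesis by (rule continuous_on_compose2) (use assms in auto)
qed

text \<open>Equivalent to \<open>J_(\<nu>-1) + J_(\<nu>+1) = (2 \<nu> / x) J_\<nu>\<close>. In
  \<open>rGamma (k + \<nu>) = (k + \<nu>) * rGamma (k + \<nu> + 1)\<close> the summand
  \<open>\<nu>\<close> yields the first term; the summand \<open>k\<close> cancels against
  \<open>fact k\<close> and yields the second one after an index shift.\<close>

lemma bessel_entire_recurrence: "bessel_entire (\<nu> - 1) y = \<nu> * bessel_entire \<nu> y - y / 4 * bessel_entire (\<nu> + 1) y"
proof -
  let ?c = "\<lambda>\<nu> k. (-1/4) ^ k / fact k * rGamma (real k + \<nu> + 1) :: real"
  have s: "(\<lambda>k. ?c \<nu> k * y ^ k) sums bessel_entire \<nu> y" for \<nu> unfolding bessel_entire_def using bessel_entire_summable by (rule summable_sums)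
  have "(\<lambda>k. - (y/4) * (?c (\<nu>+1) k * y ^ k)) sums (- (y / 4) * bessel_entire (\<nu>+1) y)"
    by (intro sums_mult s)
  moreover have "real (Suc k) * ?c \<nu> (Suc k) * y ^ Suc k = - (y/4) * (?c (\<nu>+1) k * y ^ k)" for k
  proof -
    have "real (Suc k) / fact (Suc k) = (1 / fact k :: real)"
      by (simp only: fact_Suc of_nat_mult) (simp del: of_nat_Suc)
    moreover have "real (Suc k) * ((-1/4) ^ Suc k / fact (Suc k) * r)
        = (-1/4) ^ Suc k * r * (real (Suc k) / fact (Suc k))" for r :: real
      by (simp only: times_divide_eq_left times_divide_eq_right mult_ac)
    ultimately have "real (Suc k) * ((-1/4) ^ Suc k / fact (Suc k) * r) = - (1/4) * ((-1/4) ^ k / fact k * r)" for r :: real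
      by simp
    then show ?thesis by (simp add: add_ac)
  qed
  ultimately have "(\<lambda>k. real (Suc k) * ?c \<nu> (Suc k) * y ^ Suc k) sums (- (y / 4) * bessel_entire (\<nu>+1) y)"
    by (simp only:)
  \<comment> \<open>The index shift is free because the term for \<open>k = 0\<close> carries the
    factor \<open>k\<close>.\<close>
  then have "(\<lambda>k. real k * ?c \<nu> k * y ^ k) sums (- (y / 4) * bessel_entire (\<nu>+1) y)"
    by (subst (asm) sums_Suc_iff) simp
  then have "(\<lambda>k. \<nu> * (?c \<nu> k * y ^ k) + real k * ?c \<nu> k * y ^ k) sums (\<nu> * bessel_entire \<nu> y + (- (y / 4) * bessel_entire (\<nu>+1) y))"
    by (intro sums_add sums_mult s)
  moreover have "\<nu> * (?c \<nu> k * y ^ k) + real k * ?c \<nu> k * y ^ k = ?c (\<nu> - 1) k * y ^ k" for k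
  proof -
    have "real k + (\<nu> - 1) + 1 = real k + \<nu>" by simp
    then have "?c (\<nu> - 1) k * y ^ k = (-1/4) ^ k / fact k * ((real k + \<nu>) * rGamma (real k + \<nu> + 1)) * y ^ k"
      by (simp only: rGamma_plus1)
    then show ?thesis by (simp only: distrib_right distrib_left mult_ac add_ac)
  qed
  ultimately show ?thesis using sums_unique2[OF s[of "\<nu> - 1"]] by simp
qed

text \<open>For \<open>y \<le> 0\<close> the alternating signs disappear, so the sum is at least its
  term of index 0. This is what excludes negative eigenvalues, and \<open>y = 0\<close> shows that
  the regular solution does not vanish at \<open>T\<close>.\<close>

lemma bessel_entire_pos:
  assumes "\<nu> > -1" "y \<le> 0"
  shows "bessel_entire \<nu> y > 0"
proof -
  have "0 < rGamma (\<nu> + 1)" using assms by (simp add: rGamma_inverse_Gamma Gamma_real_pos)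
  also have "\<dots> = (\<Sum>k<1. (-1/4) ^ k / fact k * rGamma (real k + \<nu> + 1) * y ^ k)" by simp
  also have "\<dots> \<le> bessel_entire \<nu> y" unfolding bessel_entire_def
  proof (rule sum_le_suminf[OF bessel_entire_summable])
    fix k
    have "(-1/4) ^ k * y ^ k = (-y/4)^k" unfolding power_mult_distrib[symmetric] by simp
    then have "(-1/4) ^ k / fact k * rGamma (real k + \<nu> + 1) * y ^ k
        = (-y/4)^k / fact k * rGamma (real k + \<nu> + 1)" by (simp add: field_simps)
    also have "\<dots> \<ge> 0" using assms
      by (intro mult_nonneg_nonneg divide_nonneg_nonneg zero_le_power)
         (auto simp: rGamma_inverse_Gamma intro!: less_imp_le[OF Gamma_real_pos])
    finally show "0 \<le> (-1/4) ^ k / fact k * rGamma (real k + \<nu> + 1) * y ^ k" .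
  qed simp
  finally show ?thesis .
qed

text \<open>At a zero the middle term of the recurrence drops out. This makes the two normalisations
  of the eigenfunctions, by \<open>J_(\<nu>+1)\<close> and by \<open>J_(\<nu>-1)\<close>,
  equal.\<close>

lemma bessel_J_neighbours_at_zero:
  assumes "x > 0" "bessel_J \<nu> x = 0"
  shows "bessel_J (\<nu> - 1) x = - bessel_J (\<nu> + 1) x"
proof -
  have "bessel_entire \<nu> (x\<^sup>2) = 0" using assms by (simp add: bessel_J_eq_bessel_entire)
  then have "bessel_entire (\<nu> - 1) (x\<^sup>2) = - (x/2)\<^sup>2 * bessel_entire (\<nu> + 1) (x\<^sup>2)"
    using bessel_entire_recurrence[of \<nu> "x\<^sup>2"] by (simp add: power_divide)
  moreover have "(x/2) powr (\<nu> - 1) * (x/2)\<^sup>2 = (x/2) powr (\<nu> + 1)"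
  proof -
    have "(x/2)\<^sup>2 = (x/2) powr 2" using assms by simp
    moreover have "\<nu> + 1 = (\<nu> - 1) + 2" by simp
    ultimately show ?thesis by (simp only: powr_add)
  qed
  ultimately show ?thesis using assms by (simp add: bessel_J_eq_bessel_entire mult.assoc[symmetric])
qed

section \<open>The eigenvalue problem of the covariance kernel\<close>

locale bridge_parameters =
  fixes T a :: real
  assumes T_pos: "0 < T" and a_pos: "0 < a"
begin

definition w :: "real \<Rightarrow> real" where "w t = (T - t) powr a"
text \<open>The integrand is \<open>1 / w^2\<close>. Since the integral is not evaluated, the
  logarithmic case \<open>a = 1/2\<close> of the covariance needs no separate treatment.\<close>

definition V :: "real \<Rightarrow> real" where "V t = integral {0..t} (\<lambda>u. (T - u) powr (- 2 * a))"
definition R :: "real \<Rightarrow> real \<Rightarrow> real" where "R s t = w s * w t * V (min s t)"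
text \<open>For \<open>q = 1 / \<mu>\<close>, \<open>(v q, P q)\<close> is the solution of \<open>\<mu> w\<^sup>2 v' = P\<close>, \<open>P' = - w\<^sup>2 v\<close> that is regular at \<open>T\<close>.\<close>

definition v :: "real \<Rightarrow> real \<Rightarrow> real" where "v q t = bessel_entire (a - 1/2) (q * (T - t)\<^sup>2)"
definition P :: "real \<Rightarrow> real \<Rightarrow> real"
  where "P q t = 1/2 * (T - t) powr (2 * a + 1) * bessel_entire (a + 1/2) (q * (T - t)\<^sup>2)"

lemma w_T [simp]: "w T = 0" by (simp add: w_def)
lemma P_T [simp]: "P q T = 0" by (simp add: P_def)
lemma V_0 [simp]: "V 0 = 0" by (simp add: V_def)
lemma w_pos: "t < T \<Longrightarrow> w t > 0" by (simp add: w_def)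
lemma w_sq: "(w t)\<^sup>2 = (T - t) powr (2 * a)"
  by (simp add: w_def power2_eq_square powr_add[symmetric])

lemma continuous_on_w: "S \<subseteq> {..T} \<Longrightarrow> continuous_on S w"
  unfolding w_def using a_pos by (intro continuous_on_powr' continuous_intros) auto

lemma continuous_on_v: "continuous_on S (v q)"
  unfolding v_def[abs_def] by (intro continuous_intros)

lemma continuous_on_P: "S \<subseteq> {..T} \<Longrightarrow> continuous_on S (P q)"
  unfolding P_def[abs_def] using a_pos by (intro continuous_on_powr' continuous_intros) auto

lemma v_T_pos: "v q T > 0"
  using a_pos by (simp add: v_def bessel_entire_pos)

lemma P_over_w_sq:
  assumes "t < T"
  shows "P q t / (w t)\<^sup>2 = (T - t) * bessel_entire (a + 1/2) (q * (T - t)\<^sup>2) / 2"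
  using assms by (simp add: P_def w_sq powr_add)

lemma DERIV_v:
  assumes "t < T"
  shows "(v q has_real_derivative q * P q t / (w t)\<^sup>2) (at t)"
proof -
  have "(v q has_real_derivative (- (bessel_entire (a - 1/2 + 1) (q * (T - t)\<^sup>2) / 4) * (q * (2 * (T - t) * (-1))))) (at t)"
    unfolding v_def[abs_def] by (auto intro!: derivative_eq_intros)
  also have "- (bessel_entire (a - 1/2 + 1) (q * (T - t)\<^sup>2) / 4) * (q * (2 * (T - t) * (-1)))
      = q * (P q t / (w t)\<^sup>2)"
  proof -
    have "a - 1/2 + 1 = a + 1/2" by simp
    then have "bessel_entire (a - 1/2 + 1) (q * (T - t)\<^sup>2) = bessel_entire (a + 1/2) (q * (T - t)\<^sup>2)" by (simp only:)
    then show ?thesis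
      by (simp only: P_over_w_sq[OF assms]) (simp add: field_simps)
  qed
  finally show ?thesis by simp
qed

text \<open>The product rule produces exactly the right-hand side of
  \<open>bessel_entire_recurrence\<close> at order \<open>a + 1/2\<close>, which lowers the order
  back to that of \<open>v\<close>.\<close>

lemma DERIV_P:
  assumes "t < T"
  shows "(P q has_real_derivative - (w t)\<^sup>2 * v q t) (at t)"
proof -
  let ?y = "q * (T - t)\<^sup>2"
  have "(P q has_real_derivative
      (1/2 * (T - t) powr (2 * a + 1) * (- (bessel_entire (a + 1/2 + 1) ?y / 4) * (q * (2 * (T - t) * (-1))))
      + 1/2 * ((2 * a + 1) * (T - t) powr (2 * a + 1 - 1) * (-1)) * bessel_entire (a + 1/2) ?y)) (at t)"
    unfolding P_def[abs_def] using assms by (auto intro!: derivative_eq_intros)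
  also have "1/2 * (T - t) powr (2 * a + 1) * (- (bessel_entire (a + 1/2 + 1) ?y / 4) * (q * (2 * (T - t) * (-1))))
      + 1/2 * ((2 * a + 1) * (T - t) powr (2 * a + 1 - 1) * (-1)) * bessel_entire (a + 1/2) ?y
      = - ((T - t) powr (2 * a)) * ((a + 1/2) * bessel_entire (a + 1/2) ?y - ?y / 4 * bessel_entire (a + 1/2 + 1) ?y)"
    using assms by (simp add: powr_add power2_eq_square algebra_simps)
  also have "(a + 1/2) * bessel_entire (a + 1/2) ?y - ?y / 4 * bessel_entire (a + 1/2 + 1) ?y = v q t"
    using bessel_entire_recurrence[of "a + 1/2" ?y] by (simp add: v_def)
  finally show ?thesis by (simp add: w_sq)
qed

lemma continuous_on_powr_T: "S \<subseteq> {..<T} \<Longrightarrow> continuous_on S (\<lambda>u. (T - u) powr c)"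
  by (intro continuous_on_powr' continuous_intros) auto

lemma DERIV_V:
  assumes "0 < t" "t < T"
  shows "(V has_real_derivative 1 / (w t)\<^sup>2) (at t)"
proof -
  \<comment> \<open>The integrand of \<open>V\<close> is singular at \<open>T\<close>, so the
    fundamental theorem is applied on \<open>[0,b]\<close> with \<open>t < b < T\<close>.\<close>
  define b where "b = (t + T) / 2"
  have b: "t < b" "b < T" using assms by (auto simp: b_def)
  have "(V has_real_derivative (T - t) powr (- 2 * a)) (at t within {0..b})"
    unfolding V_def[abs_def] using b assms
    by (intro integral_has_real_derivative continuous_on_powr_T) auto
  moreover have "at t within {0..b} = at t" using assms b by (intro at_within_interior) auto
  ultimately show ?thesis using assms by (simp add: w_sq powr_minus field_simps)
qed

lemma continuous_on_V:
  assumes "S \<subseteq> {0..b}" "b < T"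
  shows "continuous_on S V"
proof -
  have "continuous_on {0..b} V" unfolding V_def[abs_def] using assms
    by (intro indefinite_integral_continuous_1 integrable_continuous_real continuous_on_powr_T) auto
  then show ?thesis using assms continuous_on_subset by blast
qed

lemma V_mono:
  assumes "s \<le> t" "t < T"
  shows "V s \<le> V t"
  unfolding V_def
  by (rule integral_subset_le) (use assms in \<open>auto intro!: integrable_continuous_real continuous_on_powr_T\<close>)

lemma V_nonneg: "t < T \<Longrightarrow> 0 \<le> V t"
  unfolding V_def by (rule integral_nonneg) (auto intro!: integrable_continuous_real continuous_on_powr_T)

section \<open>Continuity of the covariance kernel up to \<open>T\<close>\<close>

lemma R_sym: "R s t = R t s"
  by (simp add: R_def min.commute)

lemma R_eq_0 [simp]: "R T t = 0" "R t T = 0"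
  by (simp_all add: R_def)

text \<open>Near \<open>T\<close> the product \<open>w^2 * V\<close> may have the form zero times
  infinity. Part of the singularity of \<open>1 / w^2\<close> is estimated by its value at the upper
  limit \<open>t\<close> and paid for by \<open>w^2\<close>; what remains is integrable up to
  \<open>T\<close>.\<close>

lemma R_diag_bound:
  obtains b C where "0 < b" "0 \<le> C" "\<And>t. 0 \<le> t \<Longrightarrow> t \<le> T \<Longrightarrow> R t t \<le> C * (T - t) powr b"
proof -
  \<comment> \<open>\<open>b \<le> 2 * a\<close> makes \<open>(T - u) powr (b - 2 * a)\<close>
    nondecreasing in \<open>u\<close>, and \<open>b < 1\<close> makes
    \<open>(T - u) powr (- b)\<close> integrable up to \<open>T\<close>; \<open>1/2\<close> stands
    for any number strictly between 0 and 1.\<close>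
  define b where "b = min (2 * a) (1/2)"
  have b: "0 < b" "b \<le> 2 * a" "b < 1" using a_pos by (auto simp: b_def)
  have "R t t \<le> T powr (1 - b) / (1 - b) * (T - t) powr b" if t: "0 \<le> t" "t \<le> T" for t
  proof (cases "t = T")
    case False
    then have tT: "t < T" using t by simp
    have i: "((\<lambda>u. (T - u) powr (- b)) has_integral (- ((T - t) powr (1 - b) / (1 - b)) - - ((T - 0) powr (1 - b) / (1 - b)))) {0..t}"
    proof (rule fundamental_theorem_of_calculus[OF t(1)])
      fix u assume u: "u \<in> {0..t}"
      have "((\<lambda>u. - ((T - u) powr (1 - b) / (1 - b))) has_real_derivative
          - (((1 - b) * (T - u) powr (1 - b - 1) * (-1)) / (1 - b))) (at u within {0..t})"
        using u tT b by (auto intro!: derivative_eq_intros)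
      then show "((\<lambda>u. - ((T - u) powr (1 - b) / (1 - b))) has_vector_derivative (T - u) powr (- b)) (at u within {0..t})"
        using b by (simp add: has_real_derivative_iff_has_vector_derivative)
    qed
    have "V t \<le> integral {0..t} (\<lambda>u. (T - t) powr (b - 2 * a) * (T - u) powr (- b))"
      unfolding V_def
    proof (rule integral_le)
      fix u assume u: "u \<in> {0..t}"
      have "(T - u) powr (- 2 * a) = (T - u) powr (b - 2 * a) * (T - u) powr (- b)"
        by (simp add: powr_add[symmetric])
      also have "\<dots> \<le> (T - t) powr (b - 2 * a) * (T - u) powr (- b)"
        using u tT b by (intro mult_right_mono powr_mono2') auto
      finally show "(T - u) powr (- 2 * a) \<le> (T - t) powr (b - 2 * a) * (T - u) powr (- b)" .
    qed (use tT in \<open>auto intro!: integrable_continuous_real continuous_on_powr_T continuous_intros\<close>)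
    also have "\<dots> = (T - t) powr (b - 2 * a) * (T powr (1 - b) / (1 - b) - (T - t) powr (1 - b) / (1 - b))"
      using integral_unique[OF i] by simp
    also have "\<dots> \<le> (T - t) powr (b - 2 * a) * (T powr (1 - b) / (1 - b))"
      using b by (intro mult_left_mono) auto
    finally have "(w t)\<^sup>2 * V t \<le> (w t)\<^sup>2 * ((T - t) powr (b - 2 * a) * (T powr (1 - b) / (1 - b)))"
      by (intro mult_left_mono) auto
    also have "\<dots> = ((T - t) powr (2 * a) * (T - t) powr (b - 2 * a)) * (T powr (1 - b) / (1 - b))"
      by (simp add: w_sq)
    also have "(T - t) powr (2 * a) * (T - t) powr (b - 2 * a) = (T - t) powr b"
      by (simp add: powr_add[symmetric])
    finally show ?thesis by (simp add: R_def power2_eq_square mult_ac)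
  qed simp
  then show thesis using b that[of b "T powr (1 - b) / (1 - b)"] by auto
qed

lemma R_diag_nonneg: "0 \<le> t \<Longrightarrow> t \<le> T \<Longrightarrow> 0 \<le> R t t"
  by (cases "t = T") (auto simp: R_def V_nonneg)

text \<open>\<open>R\<close> is at this point an explicit function, not yet a covariance, so the
  inequality is taken from the monotonicity of \<open>V\<close>: the value at \<open>min s t\<close>
  is below both \<open>V s\<close> and \<open>V t\<close>.\<close>

lemma R_Cauchy_Schwarz:
  assumes "s \<in> {0..T}" "t \<in> {0..T}"
  shows "\<bar>R s t\<bar> \<le> sqrt (R s s) * sqrt (R t t)"
proof (cases "s = T \<or> t = T")
  case False
  then have st: "s < T" "t < T" using assms by auto
  have "V (min s t) \<le> sqrt (V s * V t)"
  proof (rule real_le_rsqrt)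
    show "(V (min s t))\<^sup>2 \<le> V s * V t" unfolding power2_eq_square
      using st V_mono[of "min s t" s] V_mono[of "min s t" t] V_nonneg[of "min s t"] V_nonneg[of s]
      by (intro mult_mono) auto
  qed
  then have "\<bar>R s t\<bar> \<le> w s * w t * sqrt (V s * V t)"
    using st V_nonneg[of "min s t"] w_pos[of s] w_pos[of t]
    by (auto simp: R_def abs_mult intro!: mult_left_mono)
  also have "\<dots> = sqrt (R s s) * sqrt (R t t)"
    using st w_pos[of s] w_pos[of t] by (simp add: R_def real_sqrt_mult)
  finally show ?thesis .
qed auto

text \<open>On the two edges where an argument is \<open>T\<close> the kernel vanishes and is
  squeezed by the continuous function \<open>G\<close>, which vanishes there as well. At all other
  points it is locally a product of continuous functions.\<close>

lemma continuous_on_R: "continuous_on ({0..T} \<times> {0..T}) (\<lambda>(s, t). R s t)"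
proof -
  obtain b C where b: "0 < b" "0 \<le> C" and bd: "\<And>t. 0 \<le> t \<Longrightarrow> t \<le> T \<Longrightarrow> R t t \<le> C * (T - t) powr b"
    using R_diag_bound by blast
  define G where "G = (\<lambda>(s, t). sqrt (C * (T - s) powr b) * sqrt (C * (T - t) powr b))"
  have G: "continuous_on ({0..T} \<times> {0..T}) G"
    unfolding G_def case_prod_beta using b
    by (intro continuous_on_powr' continuous_intros) auto
  have RG: "norm (case x of (s, t) \<Rightarrow> R s t) \<le> G x" if x_in: "x \<in> {0..T} \<times> {0..T}" for x
  proof -
    obtain s t where x: "x = (s, t)" "s \<in> {0..T}" "t \<in> {0..T}" using x_in by blast
    have "\<bar>R s t\<bar> \<le> sqrt (R s s) * sqrt (R t t)" using x R_Cauchy_Schwarz by auto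
    also have "\<dots> \<le> G x" unfolding G_def x case_prod_conv
      using x bd[of s] bd[of t] R_diag_nonneg[of s] R_diag_nonneg[of t] b by (intro mult_mono) auto
    finally show ?thesis using x by simp
  qed
  have "continuous (at x within {0..T} \<times> {0..T}) (\<lambda>(s, t). R s t)" if x: "x \<in> {0..T} \<times> {0..T}" for x
  proof (cases "fst x = T \<or> snd x = T")
    case True
    then have G0: "G x = 0" and R0: "(case x of (s, t) \<Rightarrow> R s t) = 0"
      using R_eq_0[of "snd x"] R_eq_0[of "fst x"] by (auto simp: G_def case_prod_beta simp del: R_eq_0)
    have "(G \<longlongrightarrow> 0) (at x within {0..T} \<times> {0..T})"
    proof -
      have "(G \<longlongrightarrow> G x) (at x within {0..T} \<times> {0..T})"
        using G x unfolding continuous_on_def by blast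
      then show ?thesis using G0 by simp
    qed
    then have "((\<lambda>(s, t). R s t) \<longlongrightarrow> 0) (at x within {0..T} \<times> {0..T})"
      by (rule Lim_null_comparison[rotated]) (use RG in \<open>auto simp: eventually_at_filter\<close>)
    then show ?thesis using R0 by (simp add: continuous_within)
  next
    case False
    \<comment> \<open>The square \<open>[0,c]^2\<close> is a neighbourhood of \<open>x\<close>
      within \<open>[0,T]^2\<close> that stays away from the singularity of
      \<open>V\<close>.\<close>
    define c where "c = (max (fst x) (snd x) + T) / 2"
    have c: "fst x < c" "snd x < c" "c < T" "0 \<le> c" using x False by (auto simp: c_def)
    have "continuous_on ({0..c} \<times> {0..c}) (\<lambda>x. w (fst x) * w (snd x) * V (min (fst x) (snd x)))"
      using c
      by (intro continuous_intros continuous_on_compose2[OF continuous_on_w[of "{..T}"]]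
          continuous_on_compose2[OF continuous_on_V[OF order_refl, of c]]) auto
    moreover have "x \<in> {0..c} \<times> {0..c}" using x c by (auto simp: mem_Times_iff)
    ultimately have "((\<lambda>(s, t). R s t) \<longlongrightarrow> (case x of (s, t) \<Rightarrow> R s t)) (at x within {0..c} \<times> {0..c})"
      unfolding continuous_on_def R_def case_prod_beta by blast
    moreover have "at x within {0..c} \<times> {0..c} = at x within {0..T} \<times> {0..T}"
      by (rule at_within_nhd[where S = "{..<c} \<times> {..<c}"])
        (use c in \<open>auto simp: mem_Times_iff open_Times\<close>)
    ultimately show ?thesis by (simp add: continuous_within)
  qed
  then show ?thesis by (simp add: continuous_on_eq_continuous_within)
qed

lemma continuous_on_R1:
  assumes "t \<in> {0..T}"
  shows "continuous_on {0..T} (R t)"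
proof -
  have "continuous_on {0..T} (\<lambda>s. (t, s))" by (rule continuous_on_Pair[OF continuous_on_const continuous_on_id])
  then have "continuous_on {0..T} (\<lambda>s. case (t, s) of (t, s) \<Rightarrow> R t s)"
    by (rule continuous_on_compose2[OF continuous_on_R]) (use assms in auto)
  then show ?thesis by simp
qed

section \<open>The first-order system and the classification of eigenfunctions\<close>

text \<open>A Gronwall argument: the derivative of \<open>u^2 + Q^2\<close> is \<open>2 u Q\<close>
  times the coupling coefficient \<open>q / w^2 - w^2\<close>, so with a bound \<open>C\<close> for
  that coefficient the energy \<open>exp (- C t) * (u^2 + Q^2)\<close> decreases from 0. The bound
  \<open>C\<close> exists only on \<open>[0,b]\<close> with \<open>b < T\<close>.\<close>

lemma ode_unique:
  assumes b: "b < T" "x \<in> {0..b}"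
    and cont: "continuous_on {0..b} u" "continuous_on {0..b} Q"
    and du: "\<And>t. 0 < t \<Longrightarrow> t < b \<Longrightarrow> (u has_real_derivative q * Q t / (w t)\<^sup>2) (at t)"
    and dQ: "\<And>t. 0 < t \<Longrightarrow> t < b \<Longrightarrow> (Q has_real_derivative - (w t)\<^sup>2 * u t) (at t)"
    and init: "u 0 = 0" "Q 0 = 0"
  shows "u x = 0"
proof (cases "x = 0")
  case False
  then have x: "0 < x" "x \<le> b" using b by auto
  have "continuous_on {0..b} (\<lambda>t. q / (w t)\<^sup>2 - (w t)\<^sup>2)"
    using b w_pos by (intro continuous_intros continuous_on_w) (auto simp: less_imp_neq[symmetric])
  then have "bounded ((\<lambda>t. q / (w t)\<^sup>2 - (w t)\<^sup>2) ` {0..b})"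
    by (intro compact_imp_bounded compact_continuous_image) auto
  then obtain C where C: "\<And>t. t \<in> {0..b} \<Longrightarrow> \<bar>q / (w t)\<^sup>2 - (w t)\<^sup>2\<bar> \<le> C"
    unfolding bounded_iff by (metis (no_types, lifting) image_eqI real_norm_def)
  define E where "E t = exp (- C * t) * ((u t)\<^sup>2 + (Q t)\<^sup>2)" for t
  have "E x \<le> E 0"
  proof (rule DERIV_nonpos_imp_decreasing_open[OF less_imp_le[OF x(1)]])
    fix t assume t: "0 < t" "t < x"
    define D where "D = exp (- C * t) * (2 * u t * Q t * (q / (w t)\<^sup>2 - (w t)\<^sup>2) - C * ((u t)\<^sup>2 + (Q t)\<^sup>2))"
    have "(E has_real_derivative exp (- C * t) * (2 * u t * (q * Q t / (w t)\<^sup>2) + 2 * Q t * (- (w t)\<^sup>2 * u t))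
        + exp (- C * t) * (- C) * ((u t)\<^sup>2 + (Q t)\<^sup>2)) (at t)"
      unfolding E_def[abs_def] using t x by (auto intro!: derivative_eq_intros du dQ)
    also have "exp (- C * t) * (2 * u t * (q * Q t / (w t)\<^sup>2) + 2 * Q t * (- (w t)\<^sup>2 * u t))
        + exp (- C * t) * (- C) * ((u t)\<^sup>2 + (Q t)\<^sup>2) = D"
      unfolding D_def by (simp add: algebra_simps)
    finally have E: "(E has_real_derivative D) (at t)" .
    have "\<bar>2 * u t * Q t\<bar> \<le> (u t)\<^sup>2 + (Q t)\<^sup>2"
      using sum_squares_bound[of "\<bar>u t\<bar>" "\<bar>Q t\<bar>"] by (simp add: abs_mult)
    then have "\<bar>2 * u t * Q t\<bar> * \<bar>q / (w t)\<^sup>2 - (w t)\<^sup>2\<bar> \<le> ((u t)\<^sup>2 + (Q t)\<^sup>2) * C"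
      using C[of t] t x by (intro mult_mono) auto
    moreover have "2 * u t * Q t * (q / (w t)\<^sup>2 - (w t)\<^sup>2) \<le> \<bar>2 * u t * Q t\<bar> * \<bar>q / (w t)\<^sup>2 - (w t)\<^sup>2\<bar>"
      by (simp only: abs_mult[symmetric] abs_ge_self)
    ultimately have "2 * u t * Q t * (q / (w t)\<^sup>2 - (w t)\<^sup>2) \<le> C * ((u t)\<^sup>2 + (Q t)\<^sup>2)"
      by (simp only: mult.commute[of C])
    then have "D \<le> 0" unfolding D_def by (intro mult_nonneg_nonpos) auto
    with E show "\<exists>y. (E has_real_derivative y) (at t) \<and> y \<le> 0" by blast
  next
    show "continuous_on {0..x} E" unfolding E_def[abs_def] using x
      by (intro continuous_intros continuous_on_subset[OF cont(1)] continuous_on_subset[OF cont(2)]) auto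
  qed
  also have "E 0 = 0" by (simp add: E_def init)
  finally have "(u x)\<^sup>2 + (Q x)\<^sup>2 \<le> 0" by (simp add: E_def mult_le_0_iff)
  then show ?thesis by (simp add: sum_power2_le_zero_iff)
qed (simp add: init)

text \<open>Zero data at \<open>0\<close> would make \<open>v q\<close> vanish on
  \<open>[0,T)\<close> by uniqueness and then at \<open>T\<close> by continuity, where it is
  positive. This gives both \<open>Q 0 / P q 0\<close> a meaning and, later,
  \<open>J_(\<nu>+1)\<close> a non-zero value at the zeros of \<open>J_\<nu>\<close>.\<close>

lemma v_P_not_both_0: "v q 0 \<noteq> 0 \<or> P q 0 \<noteq> 0"
proof (rule ccontr)
  assume "\<not> (v q 0 \<noteq> 0 \<or> P q 0 \<noteq> 0)"
  then have init: "v q 0 = 0" "P q 0 = 0" by auto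
  have "v q t = 0" if t: "t \<in> {0..<T}" for t
    by (rule ode_unique[where b = t and u = "v q" and Q = "P q" and q = q])
      (use t init DERIV_P in \<open>auto intro!: continuous_on_v continuous_on_P DERIV_v\<close>)
  moreover have "closure {0..<T} = {0..T}" using T_pos by simp
  ultimately have "v q T = 0"
    by (intro continuous_constant_on_closure[of "{0..<T}" "v q" 0 T])
      (use T_pos in \<open>auto intro!: continuous_on_v\<close>)
  then show False using v_T_pos[of q] by simp
qed

lemma integral_R_split:
  assumes cont: "continuous_on {0..T} \<psi>" and t: "t \<in> {0..<T}"
  shows "integral {0..T} (\<lambda>s. R t s * \<psi> s) =
    w t * (integral {0..t} (\<lambda>s. V s * w s * \<psi> s) + V t * integral {t..T} (\<lambda>s. w s * \<psi> s))"
proof -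
  have i: "(\<lambda>s. R t s * \<psi> s) integrable_on {0..T}"
    using t by (intro integrable_continuous_real continuous_intros cont continuous_on_R1) auto
  have "integral {0..T} (\<lambda>s. R t s * \<psi> s) = integral {0..t} (\<lambda>s. R t s * \<psi> s) + integral {t..T} (\<lambda>s. R t s * \<psi> s)"
    using t by (intro Henstock_Kurzweil_Integration.integral_combine[symmetric] i) auto
  also have "integral {0..t} (\<lambda>s. R t s * \<psi> s) = integral {0..t} (\<lambda>s. w t * (V s * w s * \<psi> s))"
    by (rule integral_cong) (simp add: R_def min_absorb2)
  also have "integral {t..T} (\<lambda>s. R t s * \<psi> s) = integral {t..T} (\<lambda>s. w t * V t * (w s * \<psi> s))"
    by (rule integral_cong) (simp add: R_def min_absorb1)
  finally show ?thesis by (simp add: distrib_left)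
qed

text \<open>With \<open>u = \<psi> / w\<close> and the tail integral \<open>Q\<close>, the pair
  \<open>(u, Q)\<close> solves the same system as \<open>(v q, P q)\<close>. Their Wronskian is
  constant and vanishes at \<open>T\<close>, so \<open>v q 0 * Q 0 = 0\<close>; since
  \<open>Q 0\<close> cannot vanish, \<open>v q 0 = 0\<close>. Both pairs then start with first
  component 0, and uniqueness makes them proportional.\<close>

lemma eigenfunction_classification:
  assumes cont: "continuous_on {0..T} \<psi>" and m: "m \<noteq> 0"
    and ev: "\<And>t. t \<in> {0..T} \<Longrightarrow> integral {0..T} (\<lambda>s. R t s * \<psi> s) = m * \<psi> t"
    and nz: "t0 \<in> {0..T}" "\<psi> t0 \<noteq> 0"
  obtains c where "v (1/m) 0 = 0" "c \<noteq> 0" "\<And>t. t \<in> {0..T} \<Longrightarrow> \<psi> t = c * (w t * v (1/m) t)"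
proof -
  define Q where "Q t = integral {t..T} (\<lambda>s. w s * \<psi> s)" for t
  define I where "I t = integral {0..t} (\<lambda>s. V s * w s * \<psi> s)" for t
  define u where "u t = \<psi> t / w t" for t
  define q where "q = 1 / m"
  have contw\<psi>: "continuous_on {0..T} (\<lambda>s. w s * \<psi> s)"
    by (intro continuous_intros cont continuous_on_w) auto
  have \<psi>T: "\<psi> T = 0" using ev[of T] T_pos m by simp
  have mu: "m * \<psi> t = w t * (I t + V t * Q t)" if "t \<in> {0..<T}" for t
    using that ev[of t] integral_R_split[OF cont that] by (simp add: I_def Q_def)
  \<comment> \<open>Both \<open>I 0\<close> and \<open>V 0\<close> vanish; this is the initial
    condition \<open>u 0 = 0\<close>.\<close>
  have \<psi>0: "\<psi> 0 = 0" using mu[of 0] T_pos m by (simp add: I_def)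
  have Qeq: "Q t = integral {0..T} (\<lambda>s. w s * \<psi> s) - integral {0..t} (\<lambda>s. w s * \<psi> s)" if "t \<in> {0..T}" for t
    using that Henstock_Kurzweil_Integration.integral_combine[of 0 t T "\<lambda>s. w s * \<psi> s"] contw\<psi>
    by (simp add: Q_def integrable_continuous_real)
  have contQ: "continuous_on {0..T} Q"
    by (subst continuous_on_cong[OF refl Qeq], simp)
      (intro continuous_intros indefinite_integral_continuous_1 integrable_continuous_real contw\<psi>)
  have atT: "at t within {0..T} = at t" if "0 < t" "t < T" for t
    using that by (intro at_within_interior) auto
  have dQ: "(Q has_real_derivative - (w t * \<psi> t)) (at t)" if t: "0 < t" "t < T" for t
  proof -
    have "((\<lambda>t. integral {0..T} (\<lambda>s. w s * \<psi> s) - integral {0..t} (\<lambda>s. w s * \<psi> s))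
        has_real_derivative 0 - w t * \<psi> t) (at t within {0..T})"
      using t by (intro derivative_intros integral_has_real_derivative contw\<psi>) auto
    then have "(Q has_real_derivative 0 - w t * \<psi> t) (at t within {0..T})"
      unfolding has_field_derivative_def
      by (rule has_derivative_transform[rotated 2]) (use Qeq t in auto)
    then show ?thesis using atT[OF t] by simp
  qed
  have dQ': "(Q has_real_derivative - (w t)\<^sup>2 * u t) (at t)" if t: "0 < t" "t < T" for t
    using dQ[OF t] w_pos[OF t(2)] by (simp add: u_def power2_eq_square)
  have dI: "(I has_real_derivative V t * w t * \<psi> t) (at t)" if t: "0 < t" "t < T" for t
  proof -
    define b where "b = (t + T) / 2"
    have b: "t < b" "b < T" using t by (auto simp: b_def)
    have "(I has_real_derivative V t * w t * \<psi> t) (at t within {0..b})"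
      unfolding I_def[abs_def] using b t
      by (intro integral_has_real_derivative continuous_intros continuous_on_V[of _ b] continuous_on_w
          continuous_on_subset[OF cont]) auto
    moreover have "at t within {0..b} = at t" using t b by (intro at_within_interior) auto
    ultimately show ?thesis by simp
  qed
  have du: "(u has_real_derivative q * Q t / (w t)\<^sup>2) (at t)" if t: "0 < t" "t < T" for t
  proof -
    \<comment> \<open>The contributions \<open>V w \<psi>\<close> of \<open>I'\<close> and of
      \<open>V Q'\<close> cancel, so that only \<open>V' Q = Q / w^2\<close> is left.\<close>
    have "((\<lambda>t. q * (I t + V t * Q t)) has_real_derivative
        q * (V t * w t * \<psi> t + (1 / (w t)\<^sup>2 * Q t + V t * (- (w t * \<psi> t))))) (at t)"
      using t by (auto intro!: derivative_eq_intros dI dQ DERIV_V)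
    then have "((\<lambda>t. q * (I t + V t * Q t)) has_real_derivative q * Q t / (w t)\<^sup>2) (at t)"
      by (simp add: algebra_simps)
    then show ?thesis
    proof (rule has_field_derivative_transform_within_open[where S = "{0<..<T}"])
      fix s assume s: "s \<in> {0<..<T}"
      have "u s = (m * \<psi> s) / (m * w s)" using m by (simp add: u_def)
      also have "\<dots> = q * (I s + V s * Q s)"
        using mu[of s] s w_pos[of s] m by (simp add: q_def)
      finally show "q * (I s + V s * Q s) = u s" ..
    qed (use t in auto)
  qed
  have contu: "continuous_on {0..b} u" if "b < T" for b
    unfolding u_def[abs_def] using that w_pos
    by (intro continuous_intros continuous_on_subset[OF cont] continuous_on_w) (auto simp: less_imp_neq[symmetric])
  have v0Q0: "v q 0 * Q 0 = 0"
  proof -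
    \<comment> \<open>the Wronskian of \<open>(u, Q)\<close> and \<open>(v q, P q)\<close>, in a form that is continuous at \<open>T\<close> and vanishes there\<close>
    define W where "W t = \<psi> t * (1/2 * (T - t) powr (a + 1) * bessel_entire (a + 1/2) (q * (T - t)\<^sup>2)) - v q t * Q t" for t
    have WP: "W t = u t * P q t - v q t * Q t" if "t < T" for t
    proof -
      have "(T - t) powr (2 * a + 1) = w t * (T - t) powr (a + 1)"
        by (simp add: w_def powr_add[symmetric])
      then show ?thesis using w_pos[OF that] by (simp add: W_def u_def P_def)
    qed
    have "W T = W 0"
    proof (rule DERIV_isconst_end[OF T_pos])
      show "continuous_on {0..T} W"
        unfolding W_def[abs_def] using a_pos
        by (intro continuous_intros continuous_on_powr' cont contQ continuous_on_v) auto
      fix t assume t: "0 < t" "t < T"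
      have "((\<lambda>t. u t * P q t - v q t * Q t) has_real_derivative
          (q * Q t / (w t)\<^sup>2 * P q t + u t * (- (w t)\<^sup>2 * v q t))
          - (q * P q t / (w t)\<^sup>2 * Q t + v q t * (- (w t)\<^sup>2 * u t))) (at t)"
        using t by (auto intro!: derivative_eq_intros du dQ' DERIV_v DERIV_P)
      then have "((\<lambda>t. u t * P q t - v q t * Q t) has_real_derivative 0) (at t)"
        by (simp add: mult_ac)
      then show "(W has_real_derivative 0) (at t)"
        by (rule has_field_derivative_transform_within_open[where S = "{..<T}"]) (use t WP in auto)
    qed
    moreover have "W T = 0" by (simp add: W_def Q_def)
    moreover have "W 0 = - (v q 0 * Q 0)" by (simp add: W_def \<psi>0)
    ultimately show ?thesis by simp
  qed
  \<comment> \<open>Together with \<open>u 0 = 0\<close>, a zero value would be zero initial data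
    for the system and force \<open>\<psi> = 0\<close>.\<close>
  have Q0: "Q 0 \<noteq> 0"
  proof
    assume "Q 0 = 0"
    have "u t = 0" if t: "t \<in> {0..<T}" for t
      by (rule ode_unique[where b = t and u = u and Q = Q and q = q])
        (use t \<open>Q 0 = 0\<close> contu contQ \<psi>0 du dQ' in \<open>auto simp: u_def[of 0] intro: continuous_on_subset\<close>)
    then have "\<psi> t = 0" if "t \<in> {0..T}" for t
      using that \<psi>T w_pos[of t] by (cases "t = T") (force simp: u_def)+
    with nz show False by simp
  qed
  then have v0: "v q 0 = 0" using v0Q0 by simp
  then have P0: "P q 0 \<noteq> 0" using v_P_not_both_0 by blast
  \<comment> \<open>Makes the second component of \<open>(u, Q) - c (v q, P q)\<close> vanish at
    \<open>0\<close>; the first one does so already.\<close>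
  define c where "c = Q 0 / P q 0"
  have uc: "u t = c * v q t" if t: "t \<in> {0..<T}" for t
  proof -
    have "u t - c * v q t = 0"
    proof (rule ode_unique[where b = t and u = "\<lambda>t. u t - c * v q t" and Q = "\<lambda>t. Q t - c * P q t" and q = q])
      fix s assume s: "0 < s" "s < t"
      then have sT: "s < T" using t by simp
      have "((\<lambda>t. u t - c * v q t) has_real_derivative q * Q s / (w s)\<^sup>2 - c * (q * P q s / (w s)\<^sup>2)) (at s)"
        using s sT by (auto intro!: derivative_eq_intros du DERIV_v)
      then show "((\<lambda>t. u t - c * v q t) has_real_derivative q * (Q s - c * P q s) / (w s)\<^sup>2) (at s)"
        by (simp add: algebra_simps diff_divide_distrib)
      have "((\<lambda>t. Q t - c * P q t) has_real_derivative - (w s)\<^sup>2 * u s - c * (- (w s)\<^sup>2 * v q s)) (at s)"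
        using s sT by (auto intro!: derivative_eq_intros dQ' DERIV_P)
      then show "((\<lambda>t. Q t - c * P q t) has_real_derivative - (w s)\<^sup>2 * (u s - c * v q s)) (at s)"
        by (simp add: algebra_simps)
    qed (use t v0 \<psi>0 P0 contu in \<open>auto simp: u_def[of 0] c_def intro!: continuous_intros continuous_on_v continuous_on_P
          intro: continuous_on_subset[OF contQ]\<close>)
    then show ?thesis by simp
  qed
  have "\<psi> t = c * (w t * v q t)" if "t \<in> {0..T}" for t
  proof (cases "t = T")
    case False
    then have "t \<in> {0..<T}" using that by auto
    then show ?thesis using uc[of t] w_pos[of t] by (simp add: u_def field_simps)
  qed (simp add: \<psi>T)
  moreover have "c \<noteq> 0" using Q0 P0 by (simp add: c_def)
  ultimately show ?thesis using that[of c] v0 unfolding q_def by blast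
qed

section \<open>Eigenvalue equation, orthogonality and norms for \<open>w v\<close>\<close>

text \<open>The converse of the classification. Both parts of the split integral have explicit
  antiderivatives, \<open>v q / q - V * P q\<close> and \<open>- P q\<close>, and the terms
  \<open>V t * P q t\<close> cancel; \<open>v q 0 = 0\<close> removes the constant of the first
  one.\<close>

lemma eigenfunction_wv:
  assumes v0: "v q 0 = 0" and q: "q \<noteq> 0" and t: "t \<in> {0..T}"
  shows "integral {0..T} (\<lambda>s. R t s * (w s * v q s)) = w t * v q t / q"
proof (cases "t = T")
  case False
  then have t': "t \<in> {0..<T}" using t by auto
  have cwv: "continuous_on {0..T} (\<lambda>s. w s * v q s)"
    by (intro continuous_intros continuous_on_w continuous_on_v) auto
  have "((\<lambda>s. V s * w s * (w s * v q s)) has_integral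
      (v q t / q - V t * P q t) - (v q 0 / q - V 0 * P q 0)) {0..t}"
  proof (rule fundamental_theorem_of_calculus_interior)
    show "continuous_on {0..t} (\<lambda>t. v q t / q - V t * P q t)"
      using t' q by (intro continuous_intros continuous_on_v continuous_on_P continuous_on_V[of _ t]) auto
    fix s assume s: "s \<in> {0<..<t}"
    then have s': "0 < s" "s < T" using t' by auto
    have "((\<lambda>t. v q t / q - V t * P q t) has_real_derivative
        (q * P q s / (w s)\<^sup>2) / q - (1 / (w s)\<^sup>2 * P q s + V s * (- (w s)\<^sup>2 * v q s))) (at s)"
      using s' q by (auto intro!: derivative_eq_intros DERIV_v DERIV_P DERIV_V)
    then show "((\<lambda>t. v q t / q - V t * P q t) has_vector_derivative V s * w s * (w s * v q s)) (at s)"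
      using q by (simp add: has_real_derivative_iff_has_vector_derivative power2_eq_square mult_ac)
  qed (use t in auto)
  then have 1: "integral {0..t} (\<lambda>s. V s * w s * (w s * v q s)) = v q t / q - V t * P q t"
    using v0 by (simp add: integral_unique)
  have "((\<lambda>s. w s * (w s * v q s)) has_integral (- P q T) - (- P q t)) {t..T}"
  proof (rule fundamental_theorem_of_calculus_interior)
    show "continuous_on {t..T} (\<lambda>s. - P q s)" by (intro continuous_intros continuous_on_P) auto
    fix s assume s: "s \<in> {t<..<T}"
    have "((\<lambda>s. - P q s) has_real_derivative - (- (w s)\<^sup>2 * v q s)) (at s)"
      using s by (auto intro!: derivative_eq_intros DERIV_P)
    then show "((\<lambda>s. - P q s) has_vector_derivative w s * (w s * v q s)) (at s)"
      by (simp add: has_real_derivative_iff_has_vector_derivative power2_eq_square mult_ac)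
  qed (use t in auto)
  then have 2: "integral {t..T} (\<lambda>s. w s * (w s * v q s)) = P q t"
    by (simp add: integral_unique)
  show ?thesis using integral_R_split[OF cwv t'] 1 2 by simp
qed simp

text \<open>A Lagrange identity. The derivatives of \<open>v q * P r / q\<close> and
  \<open>v r * P q / r\<close> share the term \<open>P q * P r / w^2\<close>, which cancels in the
  difference and leaves a multiple of \<open>w^2 * v q * v r\<close>. The boundary terms vanish at
  \<open>T\<close> through \<open>P\<close> and at \<open>0\<close> by assumption.\<close>

lemma wv_orthogonal:
  assumes v0: "v q 0 = 0" "v r 0 = 0" and q: "q \<noteq> 0" "r \<noteq> 0" "q \<noteq> r"
  shows "integral {0..T} (\<lambda>t. (w t * v q t) * (w t * v r t)) = 0"
proof -
  have "((\<lambda>t. (1/r - 1/q) * ((w t * v q t) * (w t * v r t))) has_integral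
      (v q T * P r T / q - v r T * P q T / r) - (v q 0 * P r 0 / q - v r 0 * P q 0 / r)) {0..T}"
  proof (rule fundamental_theorem_of_calculus_interior)
    show "continuous_on {0..T} (\<lambda>t. v q t * P r t / q - v r t * P q t / r)"
      using q by (intro continuous_intros continuous_on_v continuous_on_P) auto
    fix t assume t: "t \<in> {0<..<T}"
    have "((\<lambda>t. v q t * P r t / q - v r t * P q t / r) has_real_derivative
        (v q t * (- (w t)\<^sup>2 * v r t) + q * P q t / (w t)\<^sup>2 * P r t) / q
        - (v r t * (- (w t)\<^sup>2 * v q t) + r * P r t / (w t)\<^sup>2 * P q t) / r) (at t)"
      by (intro DERIV_diff DERIV_cdivide DERIV_mult' DERIV_v DERIV_P) (use t in auto)
    also have "(v q t * (- (w t)\<^sup>2 * v r t) + q * P q t / (w t)\<^sup>2 * P r t) / q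
        - (v r t * (- (w t)\<^sup>2 * v q t) + r * P r t / (w t)\<^sup>2 * P q t) / r
        = (1/r - 1/q) * ((w t * v q t) * (w t * v r t))"
    proof -
      have eq: "(x * (- W * x') + q * k) / q - (x' * (- W * x) + r * k) / r = (1/r - 1/q) * (W * x * x')"
        for k W x x' :: real
        using q by (simp add: field_simps)
      have "q * P q t / (w t)\<^sup>2 * P r t = q * (P q t * P r t / (w t)\<^sup>2)"
        "r * P r t / (w t)\<^sup>2 * P q t = r * (P q t * P r t / (w t)\<^sup>2)" by simp_all
      then show ?thesis by (simp only: eq) (simp add: power2_eq_square)
    qed
    finally show "((\<lambda>t. v q t * P r t / q - v r t * P q t / r) has_vector_derivative
        (1/r - 1/q) * ((w t * v q t) * (w t * v r t))) (at t)"
      by (simp add: has_real_derivative_iff_has_vector_derivative)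
  qed (use T_pos in auto)
  then have "integral {0..T} (\<lambda>t. (1/r - 1/q) * ((w t * v q t) * (w t * v r t))) = 0"
  proof -
    have zero: "(v q T * P r T / q - v r T * P q T / r) - (v q 0 * P r 0 / q - v r 0 * P q 0 / r) = 0"
      by (simp add: v0)
    assume "((\<lambda>t. (1/r - 1/q) * ((w t * v q t) * (w t * v r t))) has_integral
      (v q T * P r T / q - v r T * P q T / r) - (v q 0 * P r 0 / q - v r 0 * P q 0 / r)) {0..T}"
    then show ?thesis unfolding zero by (rule integral_unique)
  qed
  then have "(1/r - 1/q) * integral {0..T} (\<lambda>t. (w t * v q t) * (w t * v r t)) = 0"
    by (simp only: integral_mult_right)
  then show ?thesis using q by simp
qed

text \<open>The analogue of Lommel's integral of \<open>x J_\<nu>(x)^2\<close>. At \<open>T\<close>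
  all terms of the antiderivative vanish; at \<open>0\<close> only the term \<open>S\<close>
  survives because \<open>v q 0 = 0\<close>.\<close>

lemma wv_norm:
  assumes v0: "v q 0 = 0"
  shows "integral {0..T} (\<lambda>t. (w t * v q t)\<^sup>2) = q * T powr (2 * a + 3) * (bessel_entire (a + 1/2) (q * T\<^sup>2))\<^sup>2 / 8"
proof -
  \<comment> \<open>\<open>q (T - t) P\<^sup>2 / w\<^sup>2\<close>, without the quotient \<open>0 / 0\<close> at \<open>T\<close>\<close>
  define S where "S t = q / 4 * (T - t) powr (2 * a + 3) * (bessel_entire (a + 1/2) (q * (T - t)\<^sup>2))\<^sup>2" for t
  \<comment> \<open>With \<open>y = T - t\<close>, the derivative of \<open>y w^2 v^2\<close>
    contains the cross term \<open>2 q y v P\<close>, which \<open>S\<close> cancels; this leaves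
    \<open>- (2 a - 1) q P^2 / w^2\<close>, which \<open>(2 a - 1) v P\<close> cancels. The
    remaining multiples of \<open>w^2 v^2\<close> add up to \<open>2 w^2 v^2\<close>.\<close>
  define F where "F t = 1/2 * ((2 * a - 1) * (v q t * P q t) - S t - (T - t) * (w t * v q t)\<^sup>2)" for t
  have S: "S t = q * ((T - t) * (P q t / w t)\<^sup>2)" if "t < T" for t
  proof -
    have "(T - t) powr (2 * a + 3) = (T - t) powr (2 * a + 1) * (T - t) powr 2"
      by (simp add: powr_add[symmetric] add_ac)
    also have "(T - t) powr 2 = (T - t)\<^sup>2" using that by simp
    finally have eq: "(T - t) powr (2 * a + 3) = (T - t) powr (2 * a + 1) * (T - t)\<^sup>2" .
    have "(P q t / w t)\<^sup>2 = P q t / (w t)\<^sup>2 * P q t" by (simp add: power2_eq_square)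
    also have "\<dots> = (T - t) * bessel_entire (a + 1/2) (q * (T - t)\<^sup>2) / 2 * (1/2 * (T - t) powr (2 * a + 1) * bessel_entire (a + 1/2) (q * (T - t)\<^sup>2))"
      unfolding P_over_w_sq[OF that] by (simp only: P_def)
    finally have eq': "(P q t / w t)\<^sup>2 = \<dots>" .
    show ?thesis unfolding S_def eq eq' by (simp add: power2_eq_square)
  qed
  have dw: "(w has_real_derivative - a * w t / (T - t)) (at t)" if "t < T" for t
  proof -
    have "(w has_real_derivative a * (T - t) powr (a - 1) * (-1)) (at t)"
      unfolding w_def[abs_def] using that by (auto intro!: derivative_eq_intros)
    then show ?thesis using that by (simp add: w_def powr_diff)
  qed
  have "((\<lambda>t. (w t * v q t)\<^sup>2) has_integral F T - F 0) {0..T}"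
  proof (rule fundamental_theorem_of_calculus_interior)
    show "continuous_on {0..T} F" unfolding F_def[abs_def] S_def[abs_def] using a_pos
      by (intro continuous_intros continuous_on_powr' continuous_on_v continuous_on_P continuous_on_w) auto
    fix t assume t: "t \<in> {0<..<T}"
    then have tT: "t < T" by simp
    define y where "y = T - t"
    define W where "W = w t"
    define p where "p = P q t"
    define x where "x = v q t"
    have nz: "y \<noteq> 0" "W \<noteq> 0" using tT w_pos[OF tT] by (auto simp: y_def W_def)
    define h where "h = ((- W\<^sup>2 * x) * W - p * (- a * W / y)) / (W * W)"
    define g where "g = W * (q * p / W\<^sup>2) + (- a * W / y) * x"
    have dy: "((\<lambda>t. T - t) has_real_derivative - 1) (at t)" by (auto intro!: derivative_eq_intros)
    have "((\<lambda>t. 1/2 * ((2 * a - 1) * (v q t * P q t) - q * ((T - t) * ((P q t / w t) * (P q t / w t)))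
          - (T - t) * ((w t * v q t) * (w t * v q t))))
       has_real_derivative 1/2 * ((2 * a - 1) * (x * (- W\<^sup>2 * x) + q * p / W\<^sup>2 * p)
         - q * (y * (p / W * h + h * (p / W)) + - 1 * (p / W * (p / W)))
         - (y * (W * x * g + g * (W * x)) + - 1 * (W * x * (W * x))))) (at t)"
      unfolding h_def g_def y_def W_def p_def x_def
      by (intro dy DERIV_cmult DERIV_diff DERIV_mult' DERIV_divide DERIV_v DERIV_P dw tT)
        (use w_pos[OF tT] in auto)
    also have "1/2 * ((2 * a - 1) * (x * (- W\<^sup>2 * x) + q * p / W\<^sup>2 * p)
         - q * (y * (p / W * h + h * (p / W)) + - 1 * (p / W * (p / W)))
         - (y * (W * x * g + g * (W * x)) + - 1 * (W * x * (W * x)))) = (W * x)\<^sup>2"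
      unfolding h_def g_def using nz by (simp add: field_simps power2_eq_square)
    finally have "(F has_real_derivative (w t * v q t)\<^sup>2) (at t)"
      unfolding W_def x_def
      by (rule has_field_derivative_transform_within_open[where S = "{..<T}"]) (use tT S in \<open>auto simp: F_def power2_eq_square\<close>)
    then show "(F has_vector_derivative (w t * v q t)\<^sup>2) (at t)"
      by (simp add: has_real_derivative_iff_has_vector_derivative)
  qed (use T_pos in auto)
  moreover have "F T = 0" by (simp add: F_def S_def)
  moreover have "F 0 = - (q * T powr (2 * a + 3) * (bessel_entire (a + 1/2) (q * T\<^sup>2))\<^sup>2 / 8)"
    by (simp add: F_def S_def v0)
  ultimately show ?thesis by (simp add: integral_unique)
qed

end

section \<open>Mercer's theorem for continuous kernels\<close>

text \<open>Otherwise there are points \<open>x n\<close> with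
  \<open>\<epsilon> \<le> f n (x n)\<close>, clustering at some \<open>y\<close>. For fixed
  \<open>N\<close> monotonicity gives \<open>\<epsilon> \<le> f N (x (r n))\<close> eventually, and
  in the limit \<open>\<epsilon> \<le> f N y\<close>, against pointwise convergence.\<close>

lemma Dini_decreasing_to_0:
  fixes f :: "nat \<Rightarrow> 'a::metric_space \<Rightarrow> real"
  assumes S: "compact S" and cont: "\<And>n. continuous_on S (f n)"
    and nonneg: "\<And>n x. x \<in> S \<Longrightarrow> 0 \<le> f n x"
    and dec: "\<And>m n x. x \<in> S \<Longrightarrow> m \<le> n \<Longrightarrow> f n x \<le> f m x"
    and lim: "\<And>x. x \<in> S \<Longrightarrow> (\<lambda>n. f n x) \<longlonglongrightarrow> 0"
  shows "uniform_limit S f (\<lambda>_. 0) sequentially"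
  unfolding uniform_limit_iff
proof (intro allI impI, rule ccontr)
  fix \<epsilon> :: real assume \<epsilon>: "0 < \<epsilon>"
    and "\<not> (\<forall>\<^sub>F n in sequentially. \<forall>x\<in>S. dist (f n x) 0 < \<epsilon>)"
  then have "\<forall>N. \<exists>n\<ge>N. \<exists>x\<in>S. \<epsilon> \<le> f n x"
    using nonneg by (auto simp: eventually_sequentially not_less)
  then have "\<forall>N. \<exists>x\<in>S. \<epsilon> \<le> f N x" using dec by (meson order_trans)
  then obtain x where x: "\<And>n. x n \<in> S" "\<And>n. \<epsilon> \<le> f n (x n)" by metis
  obtain y r where y: "y \<in> S" "strict_mono r" "(x \<circ> r) \<longlonglongrightarrow> y"
    using S x(1) unfolding compact_def by metis
  obtain N where N: "f N y < \<epsilon>"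
    using order_tendstoD(2)[OF lim[OF y(1)] \<epsilon>] by (auto simp: eventually_sequentially)
  have "(\<lambda>n. f N (x (r n))) \<longlonglongrightarrow> f N y"
    using continuous_on_tendsto_compose[OF cont y(3) y(1)] x(1) by (simp add: o_def)
  moreover have "\<forall>\<^sub>F n in sequentially. \<epsilon> \<le> f N (x (r n))"
    unfolding eventually_sequentially
  proof (intro exI allI impI)
    fix n assume "N \<le> n"
    then have "N \<le> r n" using seq_suble[OF y(2), of n] by simp
    then have "f (r n) (x (r n)) \<le> f N (x (r n))" by (rule dec[OF x(1)])
    with x(2)[of "r n"] show "\<epsilon> \<le> f N (x (r n))" by linarith
  qed
  ultimately have "\<epsilon> \<le> f N y" by (rule tendsto_lowerbound) simp
  with N show False by simp
qed

section \<open>Integral operators with continuous symmetric kernels\<close>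

locale continuous_kernel =
  fixes T :: real and K :: "real \<Rightarrow> real \<Rightarrow> real"
  assumes T_pos: "0 < T"
    and K_cont: "continuous_on ({0..T} \<times> {0..T}) (\<lambda>(s, t). K s t)"
    and K_sym: "\<And>s t. s \<in> {0..T} \<Longrightarrow> t \<in> {0..T} \<Longrightarrow> K s t = K t s"
begin

abbreviation cont :: "(real \<Rightarrow> real) \<Rightarrow> bool" where "cont \<equiv> continuous_on {0..T}"
definition ip :: "(real \<Rightarrow> real) \<Rightarrow> (real \<Rightarrow> real) \<Rightarrow> real" where "ip f g = integral {0..T} (\<lambda>t. f t * g t)"
definition op :: "(real \<Rightarrow> real) \<Rightarrow> real \<Rightarrow> real" where "op f t = integral {0..T} (\<lambda>s. K t s * f s)"

lemma op_eq_ip: "op f t = ip (K t) f"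
  by (simp add: op_def ip_def)

lemma ip_commute: "ip f g = ip g f"
  by (simp add: ip_def mult.commute)

lemma ip_int: "cont f \<Longrightarrow> cont g \<Longrightarrow> (\<lambda>t. f t * g t) integrable_on {0..T}"
  by (intro integrable_continuous_real continuous_intros)

lemma ip_cong: "(\<And>t. t \<in> {0..T} \<Longrightarrow> f t = f' t) \<Longrightarrow> (\<And>t. t \<in> {0..T} \<Longrightarrow> g t = g' t) \<Longrightarrow> ip f g = ip f' g'"
  unfolding ip_def by (rule integral_cong) simp

lemma op_cong: "(\<And>t. t \<in> {0..T} \<Longrightarrow> f t = f' t) \<Longrightarrow> op f s = op f' s"
  unfolding op_eq_ip by (rule ip_cong) auto

lemma ip_add: "cont f \<Longrightarrow> cont g \<Longrightarrow> cont h \<Longrightarrow> ip (\<lambda>t. f t + g t) h = ip f h + ip g h"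
  using ip_int[of f h] ip_int[of g h] by (simp add: ip_def distrib_right integral_add)

lemma ip_diff: "cont f \<Longrightarrow> cont g \<Longrightarrow> cont h \<Longrightarrow> ip (\<lambda>t. f t - g t) h = ip f h - ip g h"
  using ip_int[of f h] ip_int[of g h] by (simp add: ip_def left_diff_distrib integral_diff)

lemma ip_scale: "ip (\<lambda>t. c * f t) h = c * ip f h"
  by (simp add: ip_def mult.assoc)

lemma ip_diff_right: "cont f \<Longrightarrow> cont g \<Longrightarrow> cont h \<Longrightarrow> ip h (\<lambda>t. f t - g t) = ip h f - ip h g"
  using ip_diff by (simp add: ip_commute)

lemma ip_add_right: "cont f \<Longrightarrow> cont g \<Longrightarrow> cont h \<Longrightarrow> ip h (\<lambda>t. f t + g t) = ip h f + ip h g"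
  using ip_add by (simp add: ip_commute)

lemma ip_scale_right: "ip h (\<lambda>t. c * f t) = c * ip h f"
  using ip_scale by (simp add: ip_commute)

lemma ip_sum:
  assumes "\<And>i. i \<in> I \<Longrightarrow> cont (f i)" "cont h"
  shows "ip (\<lambda>t. \<Sum>i\<in>I. f i t) h = (\<Sum>i\<in>I. ip (f i) h)"
proof (cases "finite I")
  case True
  then show ?thesis using assms ip_int
    by (simp add: ip_def sum_distrib_right integral_sum)
qed (simp add: ip_def)

lemma ip_self_nonneg: "0 \<le> ip f f"
  unfolding ip_def by (cases "(\<lambda>t. f t * f t) integrable_on {0..T}")
    (auto intro: integral_nonneg simp: not_integrable_integral)

lemma ip_self_eq_0:
  assumes "cont f" "ip f f = 0" "t \<in> {0..T}"
  shows "f t = 0"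
proof -
  have "((\<lambda>t. f t * f t) has_integral 0) (cbox 0 T)"
    using ip_int[OF assms(1,1)] assms(2) by (simp add: ip_def has_integral_integral)
  then have "f t * f t = 0"
    by (rule has_integral_0_cbox_imp_0[rotated 2])
      (use assms T_pos in \<open>auto intro!: continuous_intros\<close>)
  then show ?thesis by simp
qed

lemma ip_Cauchy_Schwarz:
  assumes "cont f" "cont g"
  shows "(ip f g)\<^sup>2 \<le> ip f f * ip g g"
proof (cases "ip g g = 0")
  case True
  then have "ip f g = ip f (\<lambda>_. 0)" using ip_self_eq_0[OF assms(2)] by (intro ip_cong) auto
  then show ?thesis using True by (simp add: ip_def)
next
  case False
  define c where "c = ip f g / ip g g"
  have pos: "ip g g > 0" using False ip_self_nonneg[of g] by simp
  have c: "cont (\<lambda>t. c * g t)" using assms by (intro continuous_intros)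
  have "0 \<le> ip (\<lambda>t. f t - c * g t) (\<lambda>t. f t - c * g t)" by (rule ip_self_nonneg)
  also have "\<dots> = ip f f - c * ip f g - (c * ip f g - c * (c * ip g g))"
    using assms c by (simp add: ip_diff ip_diff_right continuous_intros ip_scale ip_scale_right ip_commute[of g f] right_diff_distrib)
  also have "\<dots> = ip f f - (ip f g)\<^sup>2 / ip g g"
    using False by (simp add: c_def power2_eq_square)
  finally show ?thesis using pos by (simp add: field_simps)
qed

lemma cont_K1:
  assumes "t \<in> {0..T}"
  shows "cont (K t)"
proof -
  have "continuous_on {0..T} (\<lambda>s. (t, s))" by (rule continuous_on_Pair[OF continuous_on_const continuous_on_id])
  then have "continuous_on {0..T} (\<lambda>s. case (t, s) of (t, s) \<Rightarrow> K t s)"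
    by (rule continuous_on_compose2[OF K_cont]) (use assms in auto)
  then show ?thesis by simp
qed

lemma cont_K_diag: "cont (\<lambda>t. K t t)"
proof -
  have "continuous_on {0..T} (\<lambda>s. (s, s))" by (rule continuous_on_Pair[OF continuous_on_id continuous_on_id])
  then have "continuous_on {0..T} (\<lambda>s. case (s, s) of (t, s) \<Rightarrow> K t s)"
    by (rule continuous_on_compose2[OF K_cont]) auto
  then show ?thesis by simp
qed

lemma op_add: "cont f \<Longrightarrow> cont g \<Longrightarrow> t \<in> {0..T} \<Longrightarrow> op (\<lambda>t. f t + g t) t = op f t + op g t"
  by (simp add: op_eq_ip ip_add_right cont_K1)

lemma op_diff: "cont f \<Longrightarrow> cont g \<Longrightarrow> t \<in> {0..T} \<Longrightarrow> op (\<lambda>t. f t - g t) t = op f t - op g t"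
  by (simp add: op_eq_ip ip_diff_right cont_K1)

lemma op_scale: "op (\<lambda>t. c * f t) t = c * op f t"
  by (simp add: op_eq_ip ip_scale_right)

lemma cont_op:
  assumes "cont f"
  shows "cont (op f)"
proof -
  have "continuous_on ({0..T} \<times> cbox 0 T) (\<lambda>x. (case x of (s, t) \<Rightarrow> K s t) * f (snd x))"
    using K_cont by (intro continuous_intros continuous_on_compose2[OF assms]) auto
  then have "continuous_on ({0..T} \<times> cbox 0 T) (\<lambda>(t, s). K t s * f s)"
    by (simp add: case_prod_beta)
  then show ?thesis unfolding op_def[abs_def]
    using integral_continuous_on_param[of "{0..T}" 0 T "\<lambda>t s. K t s * f s"] by simp
qed

lemma op_selfadjoint:
  assumes "cont f" "cont g"
  shows "ip (op f) g = ip f (op g)"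
proof -
  have "continuous_on ({0..T} \<times> {0..T}) (\<lambda>x. (case x of (s, t) \<Rightarrow> K s t) * f (snd x) * g (fst x))"
    using K_cont
    by (intro continuous_intros continuous_on_compose2[OF assms(1)] continuous_on_compose2[OF assms(2)]) auto
  then have c: "continuous_on (cbox (0, 0) (T, T)) (\<lambda>(t, s). K t s * f s * g t)"
    by (simp add: case_prod_beta cbox_Pair_eq)
  have "ip (op f) g = integral {0..T} (\<lambda>t. integral {0..T} (\<lambda>s. K t s * f s * g t))"
    by (simp add: ip_def op_def)
  also have "\<dots> = integral {0..T} (\<lambda>s. integral {0..T} (\<lambda>t. K t s * f s * g t))"
    using integral_swap_continuous[OF c] by simp
  also have "\<dots> = integral {0..T} (\<lambda>s. integral {0..T} (\<lambda>t. f s * (K s t * g t)))"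
    by (intro integral_cong) (simp add: K_sym mult_ac)
  also have "\<dots> = ip f (op g)" by (simp add: ip_def op_def)
  finally show ?thesis .
qed

lemma K_bound: obtains C where "C > 0" "\<And>s t. s \<in> {0..T} \<Longrightarrow> t \<in> {0..T} \<Longrightarrow> \<bar>K s t\<bar> \<le> C"
proof -
  have "bounded ((\<lambda>(s, t). K s t) ` ({0..T} \<times> {0..T}))"
    by (intro compact_imp_bounded compact_continuous_image K_cont compact_Times) auto
  then obtain C where C: "C > 0" "\<forall>x \<in> (\<lambda>(s, t). K s t) ` ({0..T} \<times> {0..T}). norm x \<le> C"
    unfolding bounded_pos by blast
  have "\<bar>K s t\<bar> \<le> C" if "s \<in> {0..T}" "t \<in> {0..T}" for s t
    using C(2) that by (metis (no_types, lifting) SigmaI case_prod_conv image_eqI real_norm_def)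
  with C(1) show ?thesis using that by blast
qed

lemma ip_self_le:
  assumes "cont f" "\<And>t. t \<in> {0..T} \<Longrightarrow> \<bar>f t\<bar> \<le> B"
  shows "ip f f \<le> T * B\<^sup>2"
proof -
  have "ip f f \<le> integral {0..T} (\<lambda>t. B\<^sup>2)"
    unfolding ip_def
  proof (rule integral_le)
    fix t assume "t \<in> {0..T}"
    then show "f t * f t \<le> B\<^sup>2" using assms(2) by (metis abs_ge_zero abs_mult_self_eq power2_eq_square power_mono)
  qed (use assms ip_int in auto)
  also have "\<dots> = T * B\<^sup>2" using T_pos by simp
  finally show ?thesis .
qed

lemma op_bound:
  obtains B where "B > 0" "\<And>f t. cont f \<Longrightarrow> t \<in> {0..T} \<Longrightarrow> (op f t)\<^sup>2 \<le> B * ip f f"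
proof -
  obtain C where C: "C > 0" "\<And>s t. s \<in> {0..T} \<Longrightarrow> t \<in> {0..T} \<Longrightarrow> \<bar>K s t\<bar> \<le> C"
    using K_bound by blast
  have "(op f t)\<^sup>2 \<le> (T * C\<^sup>2) * ip f f" if "cont f" "t \<in> {0..T}" for f t
  proof -
    have "(op f t)\<^sup>2 \<le> ip (K t) (K t) * ip f f"
      unfolding op_eq_ip by (rule ip_Cauchy_Schwarz) (use that cont_K1 in auto)
    also have "\<dots> \<le> (T * C\<^sup>2) * ip f f"
      using that by (intro mult_right_mono ip_self_le ip_self_nonneg cont_K1 C) auto
    finally show ?thesis .
  qed
  then show ?thesis using that[of "T * C\<^sup>2"] C T_pos by simp
qed

text \<open>By Cauchy--Schwarz the oscillation of \<open>op f\<close> is controlled by that of the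
  rows \<open>K x - K y\<close>, so one \<open>d\<close> serves the whole ball
  \<open>ip f f \<le> A\<close>. This is the compactness of \<open>op\<close> that Arzela--Ascoli
  consumes.\<close>

lemma op_equicontinuous:
  assumes x: "x \<in> {0..T}" and e: "0 < e" and A: "0 \<le> A"
  obtains d where "0 < d"
    "\<And>f y. cont f \<Longrightarrow> ip f f \<le> A \<Longrightarrow> y \<in> {0..T} \<Longrightarrow> \<bar>x - y\<bar> < d \<Longrightarrow> \<bar>op f x - op f y\<bar> < e"
proof -
  \<comment> \<open>Chosen so that \<open>\<eta> * sqrt (T * A) < e\<close>; the summand 1 keeps the
    denominator positive for \<open>A = 0\<close>.\<close>
  define \<eta> where "\<eta> = e / (2 * (sqrt (T * A) + 1))"
  have \<eta>: "0 < \<eta>" using e A T_pos by (auto simp: \<eta>_def intro!: divide_pos_pos mult_pos_pos add_nonneg_pos)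
  have "uniformly_continuous_on ({0..T} \<times> {0..T}) (\<lambda>(s, t). K s t)"
    by (intro compact_uniformly_continuous K_cont compact_Times) auto
  then obtain d where d: "0 < d" "\<And>p q. p \<in> {0..T} \<times> {0..T} \<Longrightarrow> q \<in> {0..T} \<times> {0..T} \<Longrightarrow> dist q p < d
      \<Longrightarrow> dist (case q of (s, t) \<Rightarrow> K s t) (case p of (s, t) \<Rightarrow> K s t) < \<eta>"
    using \<eta> unfolding uniformly_continuous_on_def by metis
  have "\<bar>op f x - op f y\<bar> < e"
    if f: "cont f" "ip f f \<le> A" and y: "y \<in> {0..T}" "\<bar>x - y\<bar> < d" for f y
  proof -
    have cK: "cont (\<lambda>s. K x s - K y s)" using x y by (intro continuous_intros cont_K1)
    have "(op f x - op f y)\<^sup>2 = (ip (\<lambda>s. K x s - K y s) f)\<^sup>2"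
      using x y f by (simp add: op_eq_ip ip_diff cont_K1)
    also have "\<dots> \<le> ip (\<lambda>s. K x s - K y s) (\<lambda>s. K x s - K y s) * ip f f"
      by (rule ip_Cauchy_Schwarz[OF cK f(1)])
    also have "\<dots> \<le> (T * \<eta>\<^sup>2) * A"
    proof (intro mult_mono f(2) ip_self_le[OF cK] ip_self_nonneg)
      fix s assume s: "s \<in> {0..T}"
      have "dist (x, s) (y, s) < d" using y by (simp add: dist_Pair_Pair dist_real_def)
      then show "\<bar>K x s - K y s\<bar> \<le> \<eta>" using d(2)[of "(y, s)" "(x, s)"] x y s by (simp add: dist_real_def)
    qed (use T_pos in auto)
    also have "\<dots> = (\<eta> * sqrt (T * A))\<^sup>2"
      using T_pos A by (simp add: power_mult_distrib)
    finally have "\<bar>op f x - op f y\<bar> \<le> \<eta> * sqrt (T * A)"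
      using \<eta> T_pos A by (simp add: abs_le_square_iff[symmetric])
    also have "\<dots> < e"
    proof -
      define S where "S = sqrt (T * A)"
      have S: "S \<ge> 0" using T_pos A by (simp add: S_def)
      then have "e * S < e * (2 * (S + 1))" using e by (intro mult_strict_left_mono) auto
      then show ?thesis unfolding \<eta>_def S_def[symmetric] using S by (simp add: field_simps)
    qed
    finally show ?thesis .
  qed
  with d(1) show ?thesis using that by blast
qed

lemma ip_tendsto:
  assumes c: "\<And>n. cont (f n)" "cont g" "cont h"
    and lim: "(\<lambda>n. ip (\<lambda>t. f n t - g t) (\<lambda>t. f n t - g t)) \<longlonglongrightarrow> 0"
  shows "(\<lambda>n. ip (f n) h) \<longlonglongrightarrow> ip g h"
proof -
  have "(\<lambda>n. (ip (f n) h - ip g h)\<^sup>2) \<longlonglongrightarrow> 0"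
  proof (rule tendsto_sandwich[OF _ _ tendsto_const])
    show "(\<lambda>n. ip (\<lambda>t. f n t - g t) (\<lambda>t. f n t - g t) * ip h h) \<longlonglongrightarrow> 0"
      using tendsto_mult_right[OF lim, of "ip h h"] by simp
    show "\<forall>\<^sub>F n in sequentially. (ip (f n) h - ip g h)\<^sup>2 \<le> ip (\<lambda>t. f n t - g t) (\<lambda>t. f n t - g t) * ip h h"
      using c ip_Cauchy_Schwarz[of "\<lambda>t. f n t - g t" h for n]
      by (intro always_eventually allI) (simp add: ip_diff continuous_intros)
  qed auto
  then have "(\<lambda>n. ip (f n) h - ip g h) \<longlonglongrightarrow> 0" by (simp add: power_tendsto_0_iff)
  then show ?thesis by (simp add: LIM_zero_iff)
qed

lemma op_tendsto:
  assumes c: "\<And>n. cont (f n)" "cont g" and t: "t \<in> {0..T}"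
    and lim: "(\<lambda>n. ip (\<lambda>t. f n t - g t) (\<lambda>t. f n t - g t)) \<longlonglongrightarrow> 0"
  shows "(\<lambda>n. op (f n) t) \<longlonglongrightarrow> op g t"
  using ip_tendsto[OF c cont_K1[OF t] lim] by (simp add: op_eq_ip ip_commute)

lemma op_L2_bound:
  obtains B where "B > 0" "\<And>f. cont f \<Longrightarrow> ip (op f) (op f) \<le> B * ip f f"
proof -
  obtain B where B: "B > 0" "\<And>f t. cont f \<Longrightarrow> t \<in> {0..T} \<Longrightarrow> (op f t)\<^sup>2 \<le> B * ip f f"
    using op_bound by blast
  have "ip (op f) (op f) \<le> (T * B) * ip f f" if f: "cont f" for f
  proof -
    have "\<bar>op f t\<bar> \<le> sqrt (B * ip f f)" if "t \<in> {0..T}" for t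
      using B(2)[OF f that] by (metis real_sqrt_abs real_sqrt_le_iff)
    then have "ip (op f) (op f) \<le> T * (sqrt (B * ip f f))\<^sup>2"
      by (rule ip_self_le[OF cont_op[OF f]])
    then show ?thesis using B(1) ip_self_nonneg[of f] by simp
  qed
  then show ?thesis using that[of "T * B"] T_pos B(1) by simp
qed

lemma op_L2_tendsto:
  assumes c: "\<And>n. cont (f n)" "cont g"
    and lim: "(\<lambda>n. ip (\<lambda>t. f n t - g t) (\<lambda>t. f n t - g t)) \<longlonglongrightarrow> 0"
  shows "(\<lambda>n. ip (\<lambda>t. op (f n) t - op g t) (\<lambda>t. op (f n) t - op g t)) \<longlonglongrightarrow> 0"
proof -
  obtain B where B: "B > 0" "\<And>f. cont f \<Longrightarrow> ip (op f) (op f) \<le> B * ip f f"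
    using op_L2_bound by blast
  show ?thesis
  proof (rule tendsto_sandwich[OF _ _ tendsto_const])
    show "(\<lambda>n. B * ip (\<lambda>t. f n t - g t) (\<lambda>t. f n t - g t)) \<longlonglongrightarrow> 0"
      using tendsto_mult_left[OF lim, of B] by simp
    have "ip (\<lambda>t. op (f n) t - op g t) (\<lambda>t. op (f n) t - op g t)
        = ip (op (\<lambda>t. f n t - g t)) (op (\<lambda>t. f n t - g t))" for n
      using c by (intro ip_cong) (simp_all add: op_diff)
    then show "\<forall>\<^sub>F n in sequentially. ip (\<lambda>t. op (f n) t - op g t) (\<lambda>t. op (f n) t - op g t)
        \<le> B * ip (\<lambda>t. f n t - g t) (\<lambda>t. f n t - g t)"
      using B(2)[of "\<lambda>t. f n t - g t" for n] c by (intro always_eventually allI) (simp add: continuous_intros)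
  qed (auto simp: ip_self_nonneg)
qed

text \<open>Power iteration: the ratios \<open>r n\<close> of the squared norms of successive iterates increase to some
  \<open>\<rho>\<close>, and a limit point \<open>h\<close> of the normalised iterates satisfies \<open>op (op h) = \<rho> h\<close>, so that
  \<open>op h + \<surd>\<rho> h\<close> or \<open>h\<close> itself is an eigenfunction.\<close>

lemma eigenfunction_exists:
  assumes \<phi>: "cont \<phi>" and nz: "s0 \<in> {0..T}" "op \<phi> s0 \<noteq> 0"
  obtains \<psi> \<mu> where "cont \<psi>" "\<mu> \<noteq> 0" "\<exists>t\<in>{0..T}. \<psi> t \<noteq> 0" "\<And>t. t \<in> {0..T} \<Longrightarrow> op \<psi> t = \<mu> * \<psi> t"
    "\<And>e l. cont e \<Longrightarrow> (\<And>t. t \<in> {0..T} \<Longrightarrow> op e t = l * e t) \<Longrightarrow> ip \<phi> e = 0 \<Longrightarrow> ip \<psi> e = 0"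
proof -
  define f where "f n = (op ^^ n) \<phi>" for n
  have f_Suc: "f (Suc n) = op (f n)" and f_0: "f 0 = \<phi>" for n by (simp_all add: f_def)
  have cf: "cont (f n)" for n by (induction n) (simp_all add: f_0 f_Suc \<phi> cont_op)
  \<comment> \<open>Self-adjointness moves all powers of the operator to one side, so inner products
    of iterates depend only on \<open>i + j\<close>. With Cauchy--Schwarz this yields the
    log-convexity \<open>q_sq\<close>, from which the ratios \<open>r\<close> increase.\<close>
  have ipf: "ip (f i) (f j) = ip \<phi> (f (i + j))" for i j
  proof (induction i arbitrary: j)
    case (Suc i)
    have "ip (f (Suc i)) (f j) = ip (f i) (f (Suc j))"
      unfolding f_Suc by (rule op_selfadjoint[OF cf cf])
    with Suc show ?case by simp
  qed (simp add: f_0)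
  define q where "q n = ip (f n) (f n)" for n
  have q_nonneg: "0 \<le> q n" for n by (simp add: q_def ip_self_nonneg)
  have q_Suc: "ip (f n) (f (Suc (Suc n))) = q (Suc n)" for n by (simp add: q_def ipf)
  have q_sq: "(q (Suc n))\<^sup>2 \<le> q n * q (Suc (Suc n))" for n
    using ip_Cauchy_Schwarz[OF cf cf, of n "Suc (Suc n)"] unfolding q_Suc by (simp add: q_def)
  have q_pos01: "q (Suc 0) > 0"
    using ip_self_eq_0[OF cf, of "Suc 0" s0] nz q_nonneg[of "Suc 0"]
    by (auto simp: q_def f_Suc f_0 less_le)
  \<comment> \<open>Log-convexity also prevents the norms from dying out once \<open>q 1\<close> is
    positive, so all normalisations below are legitimate.\<close>
  have q_pos: "q n > 0 \<and> q (Suc n) > 0" for n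
  proof (induction n)
    case 0
    have "0 < q 0 * q (Suc (Suc 0))" using q_sq[of 0] q_pos01 by (meson less_le_trans zero_less_power)
    then show ?case using q_pos01 q_nonneg[of 0] by (simp add: zero_less_mult_iff)
  next
    case (Suc n)
    have "0 < q n * q (Suc (Suc n))" using q_sq[of n] Suc by (meson less_le_trans zero_less_power)
    then show ?case using Suc by (simp add: zero_less_mult_iff)
  qed
  then have qp: "q n > 0" for n by simp
  obtain B where B: "B > 0" "\<And>f. cont f \<Longrightarrow> ip (op f) (op f) \<le> B * ip f f"
    using op_L2_bound by blast
  define r where "r n = q (Suc n) / q n" for n
  have r_inc: "incseq r"
    unfolding incseq_Suc_iff r_def using q_sq qp by (simp add: frac_le_eq divide_simps power2_eq_square mult.commute)
  have r_le: "r n \<le> B" for n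
    using B(2)[OF cf, of n] qp[of n] by (simp add: r_def q_def f_Suc field_simps)
  obtain \<rho> where \<rho>: "r \<longlonglongrightarrow> \<rho>" "\<And>n. r n \<le> \<rho>"
    using incseq_convergent[OF r_inc, of B] r_le by blast
  have \<rho>_pos: "\<rho> > 0" using \<rho>(2)[of 0] qp[of 0] qp[of "Suc 0"] by (auto simp: r_def intro: less_le_trans[rotated])
  define g where "g n = (\<lambda>t. (1 / sqrt (q n)) * f n t)" for n
  define h where "h n = op (g n)" for n
  have cg: "cont (g n)" for n unfolding g_def by (intro continuous_intros cf)
  have ch: "cont (h n)" for n unfolding h_def by (rule cont_op[OF cg])
  have ch2: "cont (op (op (h n)))" for n by (intro cont_op ch)
  have ipg: "ip (g n) (g n) = 1" for n
    using qp[of n] unfolding g_def ip_scale ip_scale_right by (simp add: q_def[symmetric] field_simps)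
  have h_eq: "h n t = (1 / sqrt (q n)) * f (Suc n) t" for n t
    unfolding h_def g_def op_scale f_Suc ..
  have iph: "ip (h n) (h n) = r n" for n
  proof -
    have "ip (h n) (h n) = ip (\<lambda>t. (1 / sqrt (q n)) * f (Suc n) t) (\<lambda>t. (1 / sqrt (q n)) * f (Suc n) t)"
      by (rule ip_cong) (simp_all add: h_eq)
    then show ?thesis
      using qp[of n] unfolding ip_scale ip_scale_right by (simp add: q_def[symmetric] r_def field_simps)
  qed
  obtain B1 where B1: "B1 > 0" "\<And>f t. cont f \<Longrightarrow> t \<in> {0..T} \<Longrightarrow> (op f t)\<^sup>2 \<le> B1 * ip f f"
    using op_bound by blast
  \<comment> \<open>The normalised iterates \<open>g n\<close> are only bounded in norm; it is their
    images \<open>h n = op (g n)\<close> that are uniformly bounded and equicontinuous.\<close>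
  obtain hh k where hh: "cont hh" "strict_mono (k :: nat \<Rightarrow> nat)"
    "\<And>e. 0 < e \<Longrightarrow> \<exists>N. \<forall>n x. n \<ge> N \<and> x \<in> {0..T} \<longrightarrow> norm (h (k n) x - hh x) < e"
  proof (rule Arzela_Ascoli[of "{0..T}" h "sqrt B1"])
    show "norm (h n x) \<le> sqrt B1" if "x \<in> {0..T}" for n x
    proof -
      have "(h n x)\<^sup>2 \<le> B1" using B1(2)[OF cg that, of n] by (simp add: ipg h_def)
      then show ?thesis by (metis real_norm_def real_sqrt_abs real_sqrt_le_iff)
    qed
    fix x e :: real assume "x \<in> {0..T}" "0 < e"
    then obtain d where "0 < d"
      "\<And>f y. cont f \<Longrightarrow> ip f f \<le> 1 \<Longrightarrow> y \<in> {0..T} \<Longrightarrow> \<bar>x - y\<bar> < d \<Longrightarrow> \<bar>op f x - op f y\<bar> < e"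
      using op_equicontinuous[of x e 1] by auto
    then show "\<exists>d>0. \<forall>n y. y \<in> {0..T} \<and> norm (x - y) < d \<longrightarrow> norm (h n x - h n y) < e"
      using cg ipg by (auto simp: h_def)
  qed auto
  have lim: "(\<lambda>n. ip (\<lambda>t. h (k n) t - hh t) (\<lambda>t. h (k n) t - hh t)) \<longlonglongrightarrow> 0"
  proof (rule LIMSEQ_I)
    fix e :: real assume e: "0 < e"
    define \<delta> where "\<delta> = sqrt (e / (2 * T))"
    have \<delta>: "\<delta> > 0" "T * \<delta>\<^sup>2 < e" using e T_pos by (simp_all add: \<delta>_def)
    obtain N where N: "\<And>n x. n \<ge> N \<Longrightarrow> x \<in> {0..T} \<Longrightarrow> norm (h (k n) x - hh x) < \<delta>"
      using hh(3)[OF \<delta>(1)] by blast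
    have "norm (ip (\<lambda>t. h (k n) t - hh t) (\<lambda>t. h (k n) t - hh t) - 0) < e" if "n \<ge> N" for n
    proof -
      have "ip (\<lambda>t. h (k n) t - hh t) (\<lambda>t. h (k n) t - hh t) \<le> T * \<delta>\<^sup>2"
        using N[OF that] ch hh(1) by (intro ip_self_le continuous_intros) (auto intro: less_imp_le)
      then show ?thesis using \<delta>(2) ip_self_nonneg[of "\<lambda>t. h (k n) t - hh t"] by simp
    qed
    then show "\<exists>N. \<forall>n\<ge>N. norm (ip (\<lambda>t. h (k n) t - hh t) (\<lambda>t. h (k n) t - hh t) - 0) < e" by blast
  qed
  have chk: "cont (h (k n))" for n by (rule ch)
  have r_lim: "(\<lambda>n. r (k n)) \<longlonglongrightarrow> \<rho>" "(\<lambda>n. r (Suc (k n))) \<longlonglongrightarrow> \<rho>"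
    using LIMSEQ_subseq_LIMSEQ[OF \<rho>(1) hh(2)] LIMSEQ_subseq_LIMSEQ[OF LIMSEQ_Suc[OF \<rho>(1)] hh(2)]
    by (simp_all add: o_def)
  have "ip hh hh = \<rho>"
  proof -
    have 1: "(\<lambda>n. ip (h (k n)) hh) \<longlonglongrightarrow> ip hh hh"
      by (rule ip_tendsto[OF chk hh(1) hh(1) lim])
    have "ip (\<lambda>t. h (k n) t - hh t) (\<lambda>t. h (k n) t - hh t) = r (k n) - 2 * ip (h (k n)) hh + ip hh hh" for n
      using chk hh(1) iph by (simp add: ip_diff ip_diff_right continuous_intros ip_commute[of hh "h (k n)"])
    with lim have "(\<lambda>n. r (k n) - 2 * ip (h (k n)) hh + ip hh hh) \<longlonglongrightarrow> 0" by simp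
    moreover have "(\<lambda>n. r (k n) - 2 * ip (h (k n)) hh + ip hh hh) \<longlonglongrightarrow> \<rho> - 2 * ip hh hh + ip hh hh"
      by (rule tendsto_add[OF tendsto_diff[OF r_lim(1) tendsto_mult[OF tendsto_const 1]] tendsto_const])
    ultimately have "0 = \<rho> - 2 * ip hh hh + ip hh hh" by (rule LIMSEQ_unique)
    then show ?thesis by simp
  qed
  with \<rho>_pos have hh_nz: "\<exists>t\<in>{0..T}. hh t \<noteq> 0"
  proof -
    have False if "\<forall>t\<in>{0..T}. hh t = 0"
    proof -
      have "ip hh hh = ip (\<lambda>_. 0) (\<lambda>_. 0)" using that by (intro ip_cong) auto
      then show False using \<open>ip hh hh = \<rho>\<close> \<rho>_pos by (simp add: ip_def)
    qed
    then show ?thesis by blast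
  qed
  define m where "m = sqrt \<rho>"
  have m: "m > 0" "m * m = \<rho>" using \<rho>_pos by (simp_all add: m_def)
  have op2: "op (op hh) t = \<rho> * hh t" if t: "t \<in> {0..T}" for t
  proof -
    \<comment> \<open>\<open>u n\<close> is the residual of \<open>g n\<close> in the equation
      \<open>op (op g) = \<rho> g\<close>. Its squared norm is a polynomial in \<open>r n\<close>
      and \<open>r (Suc n)\<close> that tends to
      \<open>\<rho>^2 - 2 \<rho>^2 + \<rho>^2 = 0\<close>.\<close>
    define u where "u n = (\<lambda>t. (1 / sqrt (q n)) * (f (Suc (Suc n)) t - \<rho> * f n t))" for n
    have cu: "cont (u n)" for n unfolding u_def by (intro continuous_intros cf)
    have cs: "cont (\<lambda>t. \<rho> * f n t)" for n by (intro continuous_intros cf)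
    have cd: "cont (\<lambda>t. f (Suc (Suc n)) t - \<rho> * f n t)" for n by (intro continuous_intros cf)
    have ipu: "ip (u n) (u n) = r (Suc n) * r n - 2 * \<rho> * r n + \<rho> * \<rho>" for n
    proof -
      have "ip (\<lambda>t. f (Suc (Suc n)) t - \<rho> * f n t) (\<lambda>t. f (Suc (Suc n)) t - \<rho> * f n t)
          = q (Suc (Suc n)) - \<rho> * q (Suc n) - \<rho> * (q (Suc n) - \<rho> * q n)"
        using q_Suc[of n] ip_commute[of "f n" "f (Suc (Suc n))"]
        by (simp add: ip_diff[OF cf cs cd] ip_diff_right[OF cf cs cf] ip_scale ip_scale_right q_def)
      then have "ip (u n) (u n) = (q (Suc (Suc n)) - \<rho> * q (Suc n) - \<rho> * (q (Suc n) - \<rho> * q n)) / q n"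
        using qp[of n] unfolding u_def ip_scale ip_scale_right by simp
      then show ?thesis using qp[of n] qp[of "Suc n"] by (simp add: r_def field_simps)
    qed
    have "op (op (h n)) t - \<rho> * h n t = op (u n) t" for n
    proof -
      have 1: "h n = (\<lambda>t. (1 / sqrt (q n)) * f (Suc n) t)" by (rule ext) (rule h_eq)
      have 2: "op (h n) = (\<lambda>t. (1 / sqrt (q n)) * f (Suc (Suc n)) t)"
        unfolding 1 op_scale[abs_def] f_Suc[symmetric] ..
      have 3: "op (op (h n)) t = (1 / sqrt (q n)) * f (Suc (Suc (Suc n))) t"
        unfolding 2 op_scale f_Suc[symmetric] ..
      have "op (\<lambda>t. f (Suc (Suc n)) t - \<rho> * f n t) t = f (Suc (Suc (Suc n))) t - \<rho> * f (Suc n) t"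
        unfolding op_diff[OF cf cs t] op_scale f_Suc[symmetric] ..
      then show ?thesis unfolding 3 u_def op_scale h_eq by (simp add: right_diff_distrib)
    qed
    then have "(op (op (h (k n))) t - \<rho> * h (k n) t)\<^sup>2 \<le> B1 * ip (u (k n)) (u (k n))" for n
      by (simp only:) (rule B1(2)[OF cu t])
    then have le: "\<forall>\<^sub>F n in sequentially. (op (op (h (k n))) t - \<rho> * h (k n) t)\<^sup>2 \<le> B1 * ip (u (k n)) (u (k n))"
      by (intro always_eventually allI)
    have "(\<lambda>n. B1 * ip (u (k n)) (u (k n))) \<longlonglongrightarrow> B1 * (\<rho> * \<rho> - 2 * \<rho> * \<rho> + \<rho> * \<rho>)"
      unfolding ipu
      by (rule tendsto_mult_left[OF tendsto_add[OF tendsto_diff[OF tendsto_mult[OF r_lim(2) r_lim(1)]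
            tendsto_mult[OF tendsto_const r_lim(1)]] tendsto_const]])
    then have to0: "(\<lambda>n. B1 * ip (u (k n)) (u (k n))) \<longlonglongrightarrow> 0" by simp
    have "(\<lambda>n. (op (op (h (k n))) t - \<rho> * h (k n) t)\<^sup>2) \<longlonglongrightarrow> 0"
      by (rule tendsto_sandwich[OF _ le tendsto_const to0]) simp
    then have "(\<lambda>n. op (op (h (k n))) t - \<rho> * h (k n) t) \<longlonglongrightarrow> 0" by (simp add: power_tendsto_0_iff)
    moreover have "(\<lambda>n. op (op (h (k n))) t - \<rho> * h (k n) t) \<longlonglongrightarrow> op (op hh) t - \<rho> * hh t"
    proof (rule tendsto_diff[OF _ tendsto_mult[OF tendsto_const]])
      show "(\<lambda>n. op (op (h (k n))) t) \<longlonglongrightarrow> op (op hh) t"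
        by (rule op_tendsto[OF cont_op[OF chk] cont_op[OF hh(1)] t op_L2_tendsto[OF chk hh(1) lim]])
      show "(\<lambda>n. h (k n) t) \<longlonglongrightarrow> hh t"
        unfolding LIMSEQ_iff using hh(3) t by blast
    qed
    ultimately have "0 = op (op hh) t - \<rho> * hh t" by (rule LIMSEQ_unique)
    then show ?thesis by simp
  qed
  \<comment> \<open>Orthogonality of the starting function to an eigenfunction is inherited by every
    iterate through self-adjointness, and by the limit through continuity of
    \<open>ip\<close>.\<close>
  have orth: "ip hh e = 0" if e: "cont e" "\<And>t. t \<in> {0..T} \<Longrightarrow> op e t = l * e t" "ip \<phi> e = 0" for e l
  proof -
    have *: "ip (f n) e = 0" for n
    proof (induction n)
      case (Suc n)
      have "ip (f (Suc n)) e = ip (f n) (op e)" unfolding f_Suc by (rule op_selfadjoint[OF cf e(1)])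
      also have "\<dots> = ip (f n) (\<lambda>t. l * e t)" by (rule ip_cong) (simp_all add: e(2))
      finally show ?case using Suc by (simp add: ip_scale_right)
    qed (simp add: f_0 e)
    have "ip (h n) e = 0" for n
    proof -
      have "ip (h n) e = ip (\<lambda>t. (1 / sqrt (q n)) * f (Suc n) t) e" by (rule ip_cong) (simp_all add: h_eq)
      then show ?thesis unfolding ip_scale using * by simp
    qed
    then have "(\<lambda>n. 0) \<longlonglongrightarrow> ip hh e" using ip_tendsto[OF chk hh(1) e(1) lim] by simp
    then show ?thesis by (rule LIMSEQ_unique[OF _ tendsto_const])
  qed
  show thesis
  \<comment> \<open>With \<open>m^2 = \<rho>\<close>, the product of the operators
    \<open>op - m\<close> and \<open>op + m\<close> annihilates \<open>hh\<close>. Either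
    \<open>op + m\<close> leaves something non-zero, an eigenfunction for \<open>m\<close>, or it
    already annihilates \<open>hh\<close>.\<close>
  proof (cases "\<exists>t\<in>{0..T}. op hh t + m * hh t \<noteq> 0")
    case True
    show thesis
    proof (rule that[of "\<lambda>t. op hh t + m * hh t" m])
      show "cont (\<lambda>t. op hh t + m * hh t)" by (intro continuous_intros cont_op hh)
      fix t assume t: "t \<in> {0..T}"
      have "op (\<lambda>t. op hh t + m * hh t) t = op (op hh) t + m * op hh t"
        using t hh(1) by (subst op_add) (auto simp: op_scale intro!: cont_op continuous_intros)
      then show "op (\<lambda>t. op hh t + m * hh t) t = m * (op hh t + m * hh t)"
        using op2[OF t] by (simp add: m(2)[symmetric] algebra_simps)
    next
      fix e l assume e: "cont e" "\<And>t. t \<in> {0..T} \<Longrightarrow> op e t = l * e t" "ip \<phi> e = 0"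
      have "ip (op hh) e = ip hh (op e)" by (rule op_selfadjoint[OF hh(1) e(1)])
      also have "\<dots> = ip hh (\<lambda>t. l * e t)" by (rule ip_cong) (simp_all add: e(2))
      finally have "ip (op hh) e = 0" using orth[OF e] by (simp add: ip_scale_right)
      then show "ip (\<lambda>t. op hh t + m * hh t) e = 0"
        using orth[OF e] hh(1) e(1) by (subst ip_add) (auto simp: ip_scale intro!: cont_op continuous_intros)
    qed (use m True in auto)
  next
    case False
    show thesis
    proof (rule that[of hh "- m"])
      show "op hh t = - m * hh t" if "t \<in> {0..T}" for t using False that by force
    qed (use m hh(1) hh_nz orth in auto)
  qed
qed

text \<open>The locale contains no positive definiteness; \<open>bessel\<close> and the positive
  \<open>l k\<close> stand in for it. The bound \<open>bessel\<close> is what makes the bilinear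
  series converge uniformly in one variable for a fixed other one, so that its limit is continuous
  and can be compared with the kernel row.\<close>

theorem Mercer_diagonal:
  fixes e :: "nat \<Rightarrow> real \<Rightarrow> real" and l :: "nat \<Rightarrow> real"
  assumes ce: "\<And>k. k \<ge> 1 \<Longrightarrow> cont (e k)"
    and ev: "\<And>k t. k \<ge> 1 \<Longrightarrow> t \<in> {0..T} \<Longrightarrow> op (e k) t = l k * e k t"
    and l: "\<And>k. k \<ge> 1 \<Longrightarrow> l k > 0"
    and norm1: "\<And>k. k \<ge> 1 \<Longrightarrow> ip (e k) (e k) = 1"
    and orth: "\<And>j k. j \<ge> 1 \<Longrightarrow> k \<ge> 1 \<Longrightarrow> j \<noteq> k \<Longrightarrow> ip (e j) (e k) = 0"
    and bessel: "\<And>n t. t \<in> {0..T} \<Longrightarrow> (\<Sum>k=1..n. l k * (e k t)\<^sup>2) \<le> K t t"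
    and complete: "\<And>\<psi> \<mu>. cont \<psi> \<Longrightarrow> \<mu> \<noteq> 0 \<Longrightarrow> \<exists>t\<in>{0..T}. \<psi> t \<noteq> 0 \<Longrightarrow>
        (\<And>t. t \<in> {0..T} \<Longrightarrow> op \<psi> t = \<mu> * \<psi> t) \<Longrightarrow> \<exists>k\<ge>1. ip \<psi> (e k) \<noteq> 0"
  shows "uniform_limit {0..T} (\<lambda>n t. K t t - (\<Sum>k=1..n. l k * (e k t)\<^sup>2)) (\<lambda>_. 0) sequentially"
proof -
  obtain C where C: "C > 0" "\<And>s t. s \<in> {0..T} \<Longrightarrow> t \<in> {0..T} \<Longrightarrow> \<bar>K s t\<bar> \<le> C"
    using K_bound by blast
  have mono: "(\<Sum>k=1..m. l k * (e k t)\<^sup>2) \<le> (\<Sum>k=1..n. l k * (e k t)\<^sup>2)" if "m \<le> n" for m n t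
    using that less_imp_le[OF l] by (intro sum_mono2) (auto intro!: mult_nonneg_nonneg)
  have lim: "(\<lambda>n. \<Sum>k=1..n. l k * (e k s)\<^sup>2) \<longlonglongrightarrow> K s s" if s: "s \<in> {0..T}" for s
  proof -
    \<comment> \<open>Partial sums of the expansion of the row \<open>K s\<close>, with
      \<open>s\<close> fixed.\<close>
    define S where "S n t = (\<Sum>k=1..n. (l k * e k s) * e k t)" for n t
    have cS: "cont (S n)" for n unfolding S_def[abs_def] using ce by (intro continuous_intros) auto
    have conv: "convergent (\<lambda>n. \<Sum>k=1..n. l k * (e k s)\<^sup>2)"
    proof (rule Bseq_mono_convergent)
      have "norm (\<Sum>k=1..n. l k * (e k s)\<^sup>2) \<le> C" for n
        using bessel[OF s, of n] C(2)[OF s s] mono[of 0 n s] by simp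
      then show "Bseq (\<lambda>n. \<Sum>k=1..n. l k * (e k s)\<^sup>2)" by (rule BseqI')
      show "\<forall>m n. m \<le> n \<longrightarrow> (\<Sum>k=1..m. l k * (e k s)\<^sup>2) \<le> (\<Sum>k=1..n. l k * (e k s)\<^sup>2)"
        using mono by blast
    qed
    have "uniformly_Cauchy_on {0..T} S"
    proof (rule uniformly_Cauchy_onI')
      fix \<epsilon> :: real assume \<epsilon>: "0 < \<epsilon>"
      have pos: "0 < \<epsilon>\<^sup>2 / C" using \<epsilon> C by simp
      obtain M where M: "\<And>m n. m \<ge> M \<Longrightarrow> n \<ge> M \<Longrightarrow>
          dist (\<Sum>k=1..m. l k * (e k s)\<^sup>2) (\<Sum>k=1..n. l k * (e k s)\<^sup>2) < \<epsilon>\<^sup>2 / C"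
        using metric_CauchyD[OF convergent_Cauchy[OF conv] pos] by blast
      show "\<exists>M. \<forall>x\<in>{0..T}. \<forall>m\<ge>M. \<forall>n>m. dist (S m x) (S n x) < \<epsilon>"
      proof (intro exI ballI allI impI)
        fix t m n assume t: "t \<in> {0..T}" and mn: "M \<le> m" "m < n"
        have split: "sum g {1..n} = sum g {1..m} + sum g {m<..n}" for g :: "nat \<Rightarrow> real"
        proof -
          have "{1..n} = {1..m} \<union> {m<..n}" using mn by auto
          then show ?thesis by (simp only: sum.union_disjoint) (auto intro: sum.union_disjoint)
        qed
        \<comment> \<open>Distributing \<open>sqrt (l k)\<close> over both factors lets
          Cauchy--Schwarz separate the variables: the block at \<open>s\<close> is small by
          convergence, the block at \<open>t\<close> is at most \<open>C\<close> for every
          \<open>t\<close>.\<close>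
        have "(S n t - S m t)\<^sup>2 = (\<Sum>k\<in>{m<..n}. (sqrt (l k) * e k s) * (sqrt (l k) * e k t))\<^sup>2"
        proof -
          have "S n t - S m t = (\<Sum>k\<in>{m<..n}. (l k * e k s) * e k t)" unfolding S_def split by simp
          also have "\<dots> = (\<Sum>k\<in>{m<..n}. (sqrt (l k) * e k s) * (sqrt (l k) * e k t))"
          proof (rule sum.cong)
            fix k assume "k \<in> {m<..n}"
            then have "l k \<ge> 0" using l[of k] by simp
            then have "l k * e k s * e k t = (sqrt (l k) * sqrt (l k)) * e k s * e k t" by simp
            then show "l k * e k s * e k t = sqrt (l k) * e k s * (sqrt (l k) * e k t)"
              by (simp only: mult_ac)
          qed simp
          finally show ?thesis by simp
        qed
        also have "\<dots> \<le> (\<Sum>k\<in>{m<..n}. (sqrt (l k) * e k s)\<^sup>2) * (\<Sum>k\<in>{m<..n}. (sqrt (l k) * e k t)\<^sup>2)"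
          by (rule Cauchy_Schwarz_ineq_sum)
        also have "\<dots> = (\<Sum>k\<in>{m<..n}. l k * (e k s)\<^sup>2) * (\<Sum>k\<in>{m<..n}. l k * (e k t)\<^sup>2)"
          using l by (intro arg_cong2[of _ _ _ _ "(*)"] sum.cong) (simp_all add: power_mult_distrib less_imp_le)
        also have "\<dots> \<le> (\<Sum>k\<in>{m<..n}. l k * (e k s)\<^sup>2) * C"
        proof (rule mult_left_mono)
          show "(\<Sum>k\<in>{m<..n}. l k * (e k t)\<^sup>2) \<le> C"
            using bessel[OF t, of n] C(2)[OF t t] mono[of 0 m t] unfolding split by simp
          show "0 \<le> (\<Sum>k\<in>{m<..n}. l k * (e k s)\<^sup>2)"
            using l by (intro sum_nonneg mult_nonneg_nonneg) (auto intro: less_imp_le)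
        qed
        also have "\<dots> < \<epsilon>\<^sup>2"
        proof -
          have "\<bar>\<Sum>k\<in>{m<..n}. l k * (e k s)\<^sup>2\<bar> < \<epsilon>\<^sup>2 / C"
            using M[of n m] mn unfolding dist_real_def split by simp
          then have "(\<Sum>k\<in>{m<..n}. l k * (e k s)\<^sup>2) < \<epsilon>\<^sup>2 / C" by linarith
          then show ?thesis using C(1) by (simp add: field_simps)
        qed
        finally have "\<bar>S n t - S m t\<bar> < \<epsilon>" using \<epsilon> by (metis abs_of_pos power2_abs power2_less_imp_less abs_ge_zero less_imp_le)
        then show "dist (S m t) (S n t) < \<epsilon>" by (simp add: dist_real_def)
      qed
    qed
    then obtain G where G: "uniform_limit {0..T} S G sequentially"
      using Cauchy_uniformly_convergent unfolding uniformly_convergent_on_def by blast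
    have cG: "cont G"
      by (rule uniform_limit_theorem[OF _ G]) (use cS in auto)
    have limG: "(\<lambda>n. ip (\<lambda>t. S n t - G t) (\<lambda>t. S n t - G t)) \<longlonglongrightarrow> 0"
    proof (rule LIMSEQ_I)
      fix \<epsilon> :: real assume \<epsilon>: "0 < \<epsilon>"
      define \<delta> where "\<delta> = sqrt (\<epsilon> / (2 * T))"
      have \<delta>: "\<delta> > 0" "T * \<delta>\<^sup>2 < \<epsilon>" using \<epsilon> T_pos by (simp_all add: \<delta>_def)
      obtain N where N: "\<And>n x. n \<ge> N \<Longrightarrow> x \<in> {0..T} \<Longrightarrow> dist (S n x) (G x) < \<delta>"
        using G \<delta>(1) unfolding uniform_limit_iff eventually_sequentially by blast
      have "norm (ip (\<lambda>t. S n t - G t) (\<lambda>t. S n t - G t) - 0) < \<epsilon>" if "n \<ge> N" for n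
      proof -
        have "ip (\<lambda>t. S n t - G t) (\<lambda>t. S n t - G t) \<le> T * \<delta>\<^sup>2"
          using N[OF that] cS cG by (intro ip_self_le continuous_intros) (auto intro: less_imp_le simp: dist_real_def)
        then show ?thesis using \<delta>(2) ip_self_nonneg[of "\<lambda>t. S n t - G t"] by simp
      qed
      then show "\<exists>N. \<forall>n\<ge>N. norm (ip (\<lambda>t. S n t - G t) (\<lambda>t. S n t - G t) - 0) < \<epsilon>" by blast
    qed
    \<comment> \<open>orthogonal to every \<open>e k\<close>, hence annihilated by \<open>op\<close>, hence orthogonal to \<open>K s\<close> and to itself\<close>
    define \<phi> where "\<phi> t = K s t - G t" for t
    have c\<phi>: "cont \<phi>" unfolding \<phi>_def[abs_def] by (intro continuous_intros cont_K1 s cG)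
    have ipS: "ip (S n) g = (\<Sum>k=1..n. l k * e k s * ip (e k) g)" if "cont g" for n g
    proof -
      have "ip (S n) g = ip (\<lambda>t. \<Sum>k=1..n. (l k * e k s) * e k t) g" by (simp add: S_def[abs_def])
      also have "\<dots> = (\<Sum>k=1..n. ip (\<lambda>t. (l k * e k s) * e k t) g)"
        using that ce by (intro ip_sum continuous_intros) auto
      finally show ?thesis by (simp add: ip_scale)
    qed
    have perp: "ip \<phi> (e j) = 0" if j: "j \<ge> 1" for j
    proof -
      have "(\<lambda>n. ip (S n) (e j)) \<longlonglongrightarrow> ip G (e j)" by (rule ip_tendsto[OF cS cG ce[OF j] limG])
      moreover have "ip (S n) (e j) = l j * e j s" if "n \<ge> j" for n
      proof -
        have "ip (S n) (e j) = (\<Sum>k=1..n. if k = j then l j * e j s else 0)"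
          unfolding ipS[OF ce[OF j]] using norm1[OF j] orth j by (intro sum.cong) auto
        then show ?thesis using that j by simp
      qed
      then have "(\<lambda>n. ip (S n) (e j)) \<longlonglongrightarrow> l j * e j s"
        by (intro tendsto_eventually eventually_sequentiallyI[of j]) auto
      ultimately have "ip G (e j) = l j * e j s" using LIMSEQ_unique by blast
      moreover have "ip (K s) (e j) = l j * e j s" using ev[OF j s] by (simp add: op_eq_ip)
      ultimately show ?thesis unfolding \<phi>_def[abs_def] using s ce[OF j] cG by (simp add: ip_diff cont_K1)
    qed
    have op\<phi>: "op \<phi> t = 0" if t: "t \<in> {0..T}" for t
    proof (rule ccontr)
      assume "op \<phi> t \<noteq> 0"
      then show False
      proof (rule eigenfunction_exists[OF c\<phi> t])
        fix \<psi> \<mu>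
        assume "cont \<psi>" "\<mu> \<noteq> 0" "\<exists>t\<in>{0..T}. \<psi> t \<noteq> 0" "\<And>t. t \<in> {0..T} \<Longrightarrow> op \<psi> t = \<mu> * \<psi> t"
        then obtain k where k: "k \<ge> 1" "ip \<psi> (e k) \<noteq> 0" using complete[of \<psi> \<mu>] by blast
        assume "\<And>e l. cont e \<Longrightarrow> (\<And>t. t \<in> {0..T} \<Longrightarrow> op e t = l * e t) \<Longrightarrow> ip \<phi> e = 0 \<Longrightarrow> ip \<psi> e = 0"
        from this[OF ce[OF k(1)] ev[OF k(1)] perp[OF k(1)]] k(2) show False by simp
      qed
    qed
    have "ip G \<phi> = 0"
    proof -
      have "(\<lambda>n. ip (S n) \<phi>) \<longlonglongrightarrow> ip G \<phi>" by (rule ip_tendsto[OF cS cG c\<phi> limG])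
      moreover have "ip (S n) \<phi> = 0" for n
        unfolding ipS[OF c\<phi>] using perp by (intro sum.neutral) (simp add: ip_commute)
      ultimately have "(\<lambda>n. 0) \<longlonglongrightarrow> ip G \<phi>" by simp
      then show ?thesis by (rule LIMSEQ_unique[OF _ tendsto_const])
    qed
    then have "ip \<phi> \<phi> = 0"
      using op\<phi>[OF s] s cG c\<phi> unfolding op_eq_ip
      by (subst (1) \<phi>_def[abs_def]) (simp add: ip_diff cont_K1)
    then have "K s s = G s" using ip_self_eq_0[OF c\<phi> _ s] by (simp add: \<phi>_def)
    moreover have "(\<lambda>n. S n s) \<longlonglongrightarrow> G s" by (rule tendsto_uniform_limitI[OF G s])
    ultimately show ?thesis by (simp add: S_def power2_eq_square mult.assoc)
  qed
  show ?thesis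
  proof (rule Dini_decreasing_to_0)
    show "cont (\<lambda>t. K t t - (\<Sum>k=1..n. l k * (e k t)\<^sup>2))" for n
      using ce by (intro continuous_intros cont_K_diag) auto
    show "(\<lambda>n. K t t - (\<Sum>k=1..n. l k * (e k t)\<^sup>2)) \<longlonglongrightarrow> 0" if "t \<in> {0..T}" for t
      using tendsto_diff[OF tendsto_const lim[OF that], of "K t t"] by simp
  qed (use bessel mono in auto)
qed

end

section \<open>Square-integrable random variables\<close>

definition sq_int :: "'a measure \<Rightarrow> ('a \<Rightarrow> real) \<Rightarrow> bool" where
  "sq_int M Z \<longleftrightarrow> Z \<in> borel_measurable M \<and> integrable M (\<lambda>\<omega>. (Z \<omega>)\<^sup>2)"

lemma sq_int_measurable [measurable_dest]: "sq_int M Z \<Longrightarrow> Z \<in> borel_measurable M"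
  by (simp add: sq_int_def)

lemma sq_int_sq: "sq_int M Z \<Longrightarrow> integrable M (\<lambda>\<omega>. (Z \<omega>)\<^sup>2)"
  by (simp add: sq_int_def)

lemma sq_int_mult:
  assumes "sq_int M Z" "sq_int M Y"
  shows "integrable M (\<lambda>\<omega>. Z \<omega> * Y \<omega>)"
proof (rule Bochner_Integration.integrable_bound)
  have [measurable]: "Z \<in> borel_measurable M" "Y \<in> borel_measurable M"
    using assms by (simp_all add: sq_int_def)
  show "integrable M (\<lambda>\<omega>. (Z \<omega>)\<^sup>2 + (Y \<omega>)\<^sup>2)"
    using assms by (simp add: sq_int_def)
  show "(\<lambda>\<omega>. Z \<omega> * Y \<omega>) \<in> borel_measurable M" by measurable
  have "\<bar>Z \<omega> * Y \<omega>\<bar> \<le> (Z \<omega>)\<^sup>2 + (Y \<omega>)\<^sup>2" for \<omega>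
  proof -
    have "2 * (\<bar>Z \<omega>\<bar> * \<bar>Y \<omega>\<bar>) \<le> (Z \<omega>)\<^sup>2 + (Y \<omega>)\<^sup>2"
      using sum_squares_bound[of "\<bar>Z \<omega>\<bar>" "\<bar>Y \<omega>\<bar>"] by simp
    moreover have "0 \<le> \<bar>Z \<omega>\<bar> * \<bar>Y \<omega>\<bar>" by simp
    ultimately show ?thesis unfolding abs_mult by linarith
  qed
  then show "AE \<omega> in M. norm (Z \<omega> * Y \<omega>) \<le> norm ((Z \<omega>)\<^sup>2 + (Y \<omega>)\<^sup>2)" by simp
qed

lemma sq_int_scale: "sq_int M Z \<Longrightarrow> sq_int M (\<lambda>\<omega>. c * Z \<omega>)"
  by (auto simp: sq_int_def power_mult_distrib)

lemma sq_int_add: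
  assumes "sq_int M Z" "sq_int M Y"
  shows "sq_int M (\<lambda>\<omega>. Z \<omega> + Y \<omega>)"
proof -
  have "integrable M (\<lambda>\<omega>. (Z \<omega>)\<^sup>2 + (Y \<omega>)\<^sup>2 + 2 * (Z \<omega> * Y \<omega>))"
    using assms sq_int_mult[OF assms] by (simp add: sq_int_def)
  then show ?thesis using assms by (auto simp: sq_int_def power2_sum mult.assoc)
qed

lemma sq_int_diff:
  assumes "sq_int M Z" "sq_int M Y"
  shows "sq_int M (\<lambda>\<omega>. Z \<omega> - Y \<omega>)"
  using sq_int_add[OF assms(1) sq_int_scale[OF assms(2), of "-1"]] by simp

lemma sq_int_0: "sq_int M (\<lambda>_. 0)"
  by (simp add: sq_int_def)

lemma sq_int_sum: "(\<And>i. i \<in> I \<Longrightarrow> sq_int M (Z i)) \<Longrightarrow> sq_int M (\<lambda>\<omega>. \<Sum>i\<in>I. Z i \<omega>)"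
  by (induction I rule: infinite_finite_induct) (auto intro: sq_int_0 sq_int_add)

lemma sq_int_cong_AE:
  assumes "sq_int M Z" "Y \<in> borel_measurable M" "AE \<omega> in M. Y \<omega> = Z \<omega>"
  shows "sq_int M Y"
proof -
  have [measurable]: "Z \<in> borel_measurable M" "Y \<in> borel_measurable M"
    using assms by (simp_all add: sq_int_def)
  have "integrable M (\<lambda>\<omega>. (Y \<omega>)\<^sup>2) \<longleftrightarrow> integrable M (\<lambda>\<omega>. (Z \<omega>)\<^sup>2)"
    using assms(3) by (intro integrable_cong_AE) auto
  then show ?thesis using assms by (simp add: sq_int_def)
qed

lemma expectation_sq_diff:
  assumes "sq_int M Z" "sq_int M Y"
  shows "(\<integral>\<omega>. (Z \<omega> - Y \<omega>)\<^sup>2 \<partial>M) = (\<integral>\<omega>. (Z \<omega>)\<^sup>2 \<partial>M) - 2 * (\<integral>\<omega>. Z \<omega> * Y \<omega> \<partial>M) + (\<integral>\<omega>. (Y \<omega>)\<^sup>2 \<partial>M)"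
proof -
  have "(\<integral>\<omega>. (Z \<omega> - Y \<omega>)\<^sup>2 \<partial>M) = (\<integral>\<omega>. (Z \<omega>)\<^sup>2 - 2 * (Z \<omega> * Y \<omega>) + (Y \<omega>)\<^sup>2 \<partial>M)"
    by (simp add: power2_diff mult.assoc algebra_simps)
  also have "\<dots> = (\<integral>\<omega>. (Z \<omega>)\<^sup>2 \<partial>M) - 2 * (\<integral>\<omega>. Z \<omega> * Y \<omega> \<partial>M) + (\<integral>\<omega>. (Y \<omega>)\<^sup>2 \<partial>M)"
    using assms sq_int_mult[OF assms] by (simp add: sq_int_def)
  finally show ?thesis .
qed

lemma sq_int_Cauchy_Schwarz:
  assumes "sq_int M Z" "sq_int M Y"
  shows "(\<integral>\<omega>. Z \<omega> * Y \<omega> \<partial>M)\<^sup>2 \<le> (\<integral>\<omega>. (Z \<omega>)\<^sup>2 \<partial>M) * (\<integral>\<omega>. (Y \<omega>)\<^sup>2 \<partial>M)"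
proof (cases "(\<integral>\<omega>. (Y \<omega>)\<^sup>2 \<partial>M) = 0")
  case True
  then have "AE \<omega> in M. (Y \<omega>)\<^sup>2 = 0"
    using integral_nonneg_eq_0_iff_AE[OF sq_int_sq[OF assms(2)]] by simp
  then have "AE \<omega> in M. Z \<omega> * Y \<omega> = 0" by eventually_elim simp
  then have "(\<integral>\<omega>. Z \<omega> * Y \<omega> \<partial>M) = 0" by (rule integral_eq_zero_AE)
  then show ?thesis using True by simp
next
  case False
  define y where "y = (\<integral>\<omega>. (Y \<omega>)\<^sup>2 \<partial>M)"
  define c where "c = (\<integral>\<omega>. Z \<omega> * Y \<omega> \<partial>M) / y"
  have y: "y > 0"
  proof -
    have "0 \<le> y" by (simp add: y_def)
    then show ?thesis using False unfolding y_def[symmetric] by simp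
  qed
  have "0 \<le> (\<integral>\<omega>. (Z \<omega> - c * Y \<omega>)\<^sup>2 \<partial>M)" by simp
  also have "\<dots> = (\<integral>\<omega>. (Z \<omega>)\<^sup>2 \<partial>M) - 2 * (\<integral>\<omega>. Z \<omega> * (c * Y \<omega>) \<partial>M) + (\<integral>\<omega>. (c * Y \<omega>)\<^sup>2 \<partial>M)"
    by (rule expectation_sq_diff[OF assms(1) sq_int_scale[OF assms(2)]])
  also have "(\<integral>\<omega>. Z \<omega> * (c * Y \<omega>) \<partial>M) = (\<integral>\<omega>. c * (Z \<omega> * Y \<omega>) \<partial>M)" by (simp add: mult_ac)
  also have "\<dots> = c * (c * y)" using y by (simp add: c_def)
  also have "(\<integral>\<omega>. (c * Y \<omega>)\<^sup>2 \<partial>M) = c * (c * y)"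
    by (simp add: power_mult_distrib y_def) (simp add: power2_eq_square)
  finally have "c * (c * y) \<le> (\<integral>\<omega>. (Z \<omega>)\<^sup>2 \<partial>M)" by simp
  then have "c * (c * y) * y \<le> (\<integral>\<omega>. (Z \<omega>)\<^sup>2 \<partial>M) * y" using y by (intro mult_right_mono) auto
  then show ?thesis using y unfolding y_def[symmetric] by (simp add: c_def power2_eq_square)
qed

lemma sq_sum_bound: "((x::real) + y)\<^sup>2 \<le> 2 * x\<^sup>2 + 2 * y\<^sup>2"
proof -
  have "0 \<le> (x - y)\<^sup>2" by simp
  then show ?thesis unfolding power2_sum power2_diff by linarith
qed

text \<open>A triangle inequality with a factor 2, stated for squared distances; it avoids square
  roots and is enough for the closure arguments on \<open>gauss_closure\<close>.\<close>

lemma expectation_sq_triangle: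
  assumes "sq_int M X" "sq_int M Y" "sq_int M Z"
  shows "(\<integral>\<omega>. (X \<omega> - Z \<omega>)\<^sup>2 \<partial>M) \<le> 2 * (\<integral>\<omega>. (X \<omega> - Y \<omega>)\<^sup>2 \<partial>M) + 2 * (\<integral>\<omega>. (Y \<omega> - Z \<omega>)\<^sup>2 \<partial>M)"
proof -
  note i = sq_int_sq[OF sq_int_diff[OF assms(1,2)]] sq_int_sq[OF sq_int_diff[OF assms(2,3)]]
    sq_int_sq[OF sq_int_diff[OF assms(1,3)]]
  have "(\<integral>\<omega>. (X \<omega> - Z \<omega>)\<^sup>2 \<partial>M) \<le> (\<integral>\<omega>. 2 * (X \<omega> - Y \<omega>)\<^sup>2 + 2 * (Y \<omega> - Z \<omega>)\<^sup>2 \<partial>M)"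
  proof (rule Bochner_Integration.integral_mono[OF i(3)])
    show "integrable M (\<lambda>\<omega>. 2 * (X \<omega> - Y \<omega>)\<^sup>2 + 2 * (Y \<omega> - Z \<omega>)\<^sup>2)" using i by simp
    show "(X \<omega> - Z \<omega>)\<^sup>2 \<le> 2 * (X \<omega> - Y \<omega>)\<^sup>2 + 2 * (Y \<omega> - Z \<omega>)\<^sup>2" for \<omega>
      using sq_sum_bound[of "X \<omega> - Y \<omega>" "Y \<omega> - Z \<omega>"] by simp
  qed
  then show ?thesis using i by simp
qed

section \<open>Convergence and completeness in mean square\<close>

definition L2_lim :: "'a measure \<Rightarrow> (nat \<Rightarrow> 'a \<Rightarrow> real) \<Rightarrow> ('a \<Rightarrow> real) \<Rightarrow> bool" where
  "L2_lim M S Z \<longleftrightarrow> (\<forall>n. sq_int M (S n)) \<and> sq_int M Z \<and> (\<lambda>n. \<integral>\<omega>. (S n \<omega> - Z \<omega>)\<^sup>2 \<partial>M) \<longlonglongrightarrow> 0"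

definition L2_Cauchy :: "'a measure \<Rightarrow> (nat \<Rightarrow> 'a \<Rightarrow> real) \<Rightarrow> bool" where
  "L2_Cauchy M S \<longleftrightarrow> (\<forall>n. sq_int M (S n)) \<and>
     (\<forall>\<epsilon>>0. \<exists>N. \<forall>m\<ge>N. \<forall>n\<ge>N. (\<integral>\<omega>. (S m \<omega> - S n \<omega>)\<^sup>2 \<partial>M) < \<epsilon>)"

lemma L2_lim_mult:
  assumes "L2_lim M S Z" "sq_int M Y"
  shows "(\<lambda>n. \<integral>\<omega>. Y \<omega> * S n \<omega> \<partial>M) \<longlonglongrightarrow> (\<integral>\<omega>. Y \<omega> * Z \<omega> \<partial>M)"
proof -
  have i: "sq_int M (S n)" "sq_int M Z" for n using assms by (auto simp: L2_lim_def)
  have "(\<lambda>n. ((\<integral>\<omega>. Y \<omega> * S n \<omega> \<partial>M) - (\<integral>\<omega>. Y \<omega> * Z \<omega> \<partial>M))\<^sup>2) \<longlonglongrightarrow> 0"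
  proof (rule tendsto_sandwich[OF _ _ tendsto_const])
    show "(\<lambda>n. (\<integral>\<omega>. (Y \<omega>)\<^sup>2 \<partial>M) * (\<integral>\<omega>. (S n \<omega> - Z \<omega>)\<^sup>2 \<partial>M)) \<longlonglongrightarrow> 0"
    proof -
      have "(\<lambda>n. \<integral>\<omega>. (S n \<omega> - Z \<omega>)\<^sup>2 \<partial>M) \<longlonglongrightarrow> 0" using assms(1) by (simp add: L2_lim_def)
      from tendsto_mult_left[OF this] show ?thesis by (simp only: mult_zero_right)
    qed
    have "((\<integral>\<omega>. Y \<omega> * S n \<omega> \<partial>M) - (\<integral>\<omega>. Y \<omega> * Z \<omega> \<partial>M))\<^sup>2 \<le> (\<integral>\<omega>. (Y \<omega>)\<^sup>2 \<partial>M) * (\<integral>\<omega>. (S n \<omega> - Z \<omega>)\<^sup>2 \<partial>M)" for n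
    proof -
      have "(\<integral>\<omega>. Y \<omega> * S n \<omega> \<partial>M) - (\<integral>\<omega>. Y \<omega> * Z \<omega> \<partial>M) = (\<integral>\<omega>. Y \<omega> * (S n \<omega> - Z \<omega>) \<partial>M)"
        using sq_int_mult[OF assms(2) i(1)] sq_int_mult[OF assms(2) i(2)] by (simp add: right_diff_distrib)
      then show ?thesis using sq_int_Cauchy_Schwarz[OF assms(2) sq_int_diff[OF i]] by simp
    qed
    then show "\<forall>\<^sub>F n in sequentially. ((\<integral>\<omega>. Y \<omega> * S n \<omega> \<partial>M) - (\<integral>\<omega>. Y \<omega> * Z \<omega> \<partial>M))\<^sup>2
        \<le> (\<integral>\<omega>. (Y \<omega>)\<^sup>2 \<partial>M) * (\<integral>\<omega>. (S n \<omega> - Z \<omega>)\<^sup>2 \<partial>M)" by (intro always_eventually allI)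
  qed simp
  then have "(\<lambda>n. (\<integral>\<omega>. Y \<omega> * S n \<omega> \<partial>M) - (\<integral>\<omega>. Y \<omega> * Z \<omega> \<partial>M)) \<longlonglongrightarrow> 0" by (simp add: power_tendsto_0_iff)
  then show ?thesis by (simp add: LIM_zero_iff)
qed

lemma L2_lim_sq:
  assumes "L2_lim M S Z"
  shows "(\<lambda>n. \<integral>\<omega>. (S n \<omega>)\<^sup>2 \<partial>M) \<longlonglongrightarrow> (\<integral>\<omega>. (Z \<omega>)\<^sup>2 \<partial>M)"
proof -
  have i: "sq_int M (S n)" "sq_int M Z" for n using assms by (auto simp: L2_lim_def)
  have 1: "(\<lambda>n. \<integral>\<omega>. (S n \<omega> - Z \<omega>)\<^sup>2 \<partial>M) \<longlonglongrightarrow> 0" using assms by (simp add: L2_lim_def)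
  have 2: "(\<lambda>n. \<integral>\<omega>. Z \<omega> * S n \<omega> \<partial>M) \<longlonglongrightarrow> (\<integral>\<omega>. Z \<omega> * Z \<omega> \<partial>M)" by (rule L2_lim_mult[OF assms i(2)])
  have "(\<integral>\<omega>. (S n \<omega>)\<^sup>2 \<partial>M) = (\<integral>\<omega>. (S n \<omega> - Z \<omega>)\<^sup>2 \<partial>M) + 2 * (\<integral>\<omega>. Z \<omega> * S n \<omega> \<partial>M) - (\<integral>\<omega>. (Z \<omega>)\<^sup>2 \<partial>M)" for n
    unfolding expectation_sq_diff[OF i] by (simp add: mult.commute)
  moreover have "(\<lambda>n. (\<integral>\<omega>. (S n \<omega> - Z \<omega>)\<^sup>2 \<partial>M) + 2 * (\<integral>\<omega>. Z \<omega> * S n \<omega> \<partial>M) - (\<integral>\<omega>. (Z \<omega>)\<^sup>2 \<partial>M))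
      \<longlonglongrightarrow> 0 + 2 * (\<integral>\<omega>. Z \<omega> * Z \<omega> \<partial>M) - (\<integral>\<omega>. (Z \<omega>)\<^sup>2 \<partial>M)"
    by (rule tendsto_diff[OF tendsto_add[OF 1 tendsto_mult[OF tendsto_const 2]] tendsto_const])
  ultimately show ?thesis by (simp add: power2_eq_square)
qed

text \<open>Fatou's lemma along \<open>r\<close> bounds the squared distance of \<open>S n\<close>
  to \<open>Z\<close> by the Cauchy tolerance. A general \<open>r\<close> serves completeness, where
  only a subsequence converges pointwise; \<open>r n = n\<close> serves to recognise a given
  variable as the limit of Riemann sums.\<close>

lemma L2_lim_of_AE_lim:
  assumes C: "L2_Cauchy M S" and Z[measurable]: "Z \<in> borel_measurable M"
    and r: "filterlim r sequentially sequentially"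
    and lim: "AE \<omega> in M. (\<lambda>k. S (r k) \<omega>) \<longlonglongrightarrow> Z \<omega>"
  shows "L2_lim M S Z"
proof -
  have i: "sq_int M (S n)" for n using C by (simp add: L2_Cauchy_def)
  have [measurable]: "S n \<in> borel_measurable M" for n using i by (simp add: sq_int_def)
  have nn: "(\<integral>\<^sup>+\<omega>. ennreal ((S n \<omega> - Z \<omega>)\<^sup>2) \<partial>M) \<le> ennreal \<epsilon>"
    if n: "n \<ge> N" and N: "\<forall>m\<ge>N. \<forall>n\<ge>N. (\<integral>\<omega>. (S m \<omega> - S n \<omega>)\<^sup>2 \<partial>M) < \<epsilon>" for n N \<epsilon>
  proof -
    have "(\<integral>\<^sup>+\<omega>. ennreal ((S n \<omega> - Z \<omega>)\<^sup>2) \<partial>M) \<le> (\<integral>\<^sup>+\<omega>. liminf (\<lambda>k. ennreal ((S n \<omega> - S (r k) \<omega>)\<^sup>2)) \<partial>M)"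
    proof (rule nn_integral_mono_AE)
      show "AE \<omega> in M. ennreal ((S n \<omega> - Z \<omega>)\<^sup>2) \<le> liminf (\<lambda>k. ennreal ((S n \<omega> - S (r k) \<omega>)\<^sup>2))"
        using lim
      proof eventually_elim
        case (elim \<omega>)
        have "(\<lambda>k. ennreal ((S n \<omega> - S (r k) \<omega>)\<^sup>2)) \<longlonglongrightarrow> ennreal ((S n \<omega> - Z \<omega>)\<^sup>2)"
          by (intro tendsto_ennrealI tendsto_power tendsto_diff tendsto_const elim)
        from lim_imp_Liminf[OF _ this] show ?case by simp
      qed
    qed
    also have "\<dots> \<le> liminf (\<lambda>k. \<integral>\<^sup>+\<omega>. ennreal ((S n \<omega> - S (r k) \<omega>)\<^sup>2) \<partial>M)"
      by (rule nn_integral_liminf) measurable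
    also have "\<dots> \<le> liminf (\<lambda>k. ennreal \<epsilon>)"
    proof (rule Liminf_mono)
      have "\<forall>\<^sub>F k in sequentially. N \<le> r k" using r by (simp add: filterlim_at_top)
      then show "\<forall>\<^sub>F k in sequentially. (\<integral>\<^sup>+\<omega>. ennreal ((S n \<omega> - S (r k) \<omega>)\<^sup>2) \<partial>M) \<le> ennreal \<epsilon>"
      proof eventually_elim
        case (elim k)
        have "(\<integral>\<^sup>+\<omega>. ennreal ((S n \<omega> - S (r k) \<omega>)\<^sup>2) \<partial>M) = ennreal (\<integral>\<omega>. (S n \<omega> - S (r k) \<omega>)\<^sup>2 \<partial>M)"
          by (rule nn_integral_eq_integral[OF sq_int_sq[OF sq_int_diff[OF i i]]]) simp
        also have "\<dots> \<le> ennreal \<epsilon>" using N n elim by (intro ennreal_leI less_imp_le) auto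
        finally show ?case .
      qed
    qed
    also have "\<dots> = ennreal \<epsilon>" by (simp add: Liminf_const)
    finally show ?thesis .
  qed
  obtain N1 where N1: "\<forall>m\<ge>N1. \<forall>n\<ge>N1. (\<integral>\<omega>. (S m \<omega> - S n \<omega>)\<^sup>2 \<partial>M) < 1"
    using C zero_less_one unfolding L2_Cauchy_def by blast
  have "integrable M (\<lambda>\<omega>. (S N1 \<omega> - Z \<omega>)\<^sup>2)"
  proof (rule integrableI_bounded)
    have "(\<integral>\<^sup>+\<omega>. ennreal (norm ((S N1 \<omega> - Z \<omega>)\<^sup>2)) \<partial>M) \<le> ennreal 1" using nn[OF order_refl N1] by simp
    also have "\<dots> < \<infinity>" by simp
    finally show "(\<integral>\<^sup>+\<omega>. ennreal (norm ((S N1 \<omega> - Z \<omega>)\<^sup>2)) \<partial>M) < \<infinity>" .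
  qed measurable
  then have "sq_int M (\<lambda>\<omega>. S N1 \<omega> - Z \<omega>)" by (simp add: sq_int_def)
  \<comment> \<open>\<open>Z\<close> is known only to be measurable; it is written as
    \<open>S N1 - (S N1 - Z)\<close>.\<close>
  from sq_int_diff[OF i[of N1] this] have iZ: "sq_int M Z" by simp
  have "(\<lambda>n. \<integral>\<omega>. (S n \<omega> - Z \<omega>)\<^sup>2 \<partial>M) \<longlonglongrightarrow> 0"
  proof (rule LIMSEQ_I)
    fix \<epsilon> :: real assume e: "0 < \<epsilon>"
    then obtain N where N: "\<forall>m\<ge>N. \<forall>n\<ge>N. (\<integral>\<omega>. (S m \<omega> - S n \<omega>)\<^sup>2 \<partial>M) < \<epsilon> / 2"
      using C half_gt_zero unfolding L2_Cauchy_def by blast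
    have "norm ((\<integral>\<omega>. (S n \<omega> - Z \<omega>)\<^sup>2 \<partial>M) - 0) < \<epsilon>" if "n \<ge> N" for n
    proof -
      have "ennreal (\<integral>\<omega>. (S n \<omega> - Z \<omega>)\<^sup>2 \<partial>M) = (\<integral>\<^sup>+\<omega>. ennreal ((S n \<omega> - Z \<omega>)\<^sup>2) \<partial>M)"
        by (rule nn_integral_eq_integral[symmetric, OF sq_int_sq[OF sq_int_diff[OF i iZ]]]) simp
      also have "\<dots> \<le> ennreal (\<epsilon> / 2)" by (rule nn[OF that N])
      finally have "(\<integral>\<omega>. (S n \<omega> - Z \<omega>)\<^sup>2 \<partial>M) \<le> \<epsilon> / 2" using e by (simp add: ennreal_le_iff)
      then show ?thesis using e by simp
    qed
    then show "\<exists>N. \<forall>n\<ge>N. norm ((\<integral>\<omega>. (S n \<omega> - Z \<omega>)\<^sup>2 \<partial>M) - 0) < \<epsilon>" by blast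
  qed
  then show ?thesis using i iZ by (simp add: L2_lim_def)
qed

lemma (in prob_space) sq_int_const: "sq_int M (\<lambda>_. c)"
  by (simp add: sq_int_def)

lemma (in prob_space) sq_int_integrable: "sq_int M Z \<Longrightarrow> integrable M Z"
  using sq_int_mult[OF _ sq_int_const[of 1]] by simp

text \<open>The Riesz--Fischer argument: a subsequence with summable first moments of its increments
  converges almost surely.\<close>

lemma (in prob_space) L2_complete:
  assumes C: "L2_Cauchy M S"
  obtains Z where "L2_lim M S Z"
proof -
  have i: "sq_int M (S n)" for n using C by (simp add: L2_Cauchy_def)
  have [measurable]: "S n \<in> borel_measurable M" for n using i by (simp add: sq_int_def)
  \<comment> \<open>The bound is on squared distances: \<open>(1/4)^k\<close> becomes
    \<open>(1/2)^k\<close> for first moments.\<close>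
  have "\<forall>k. \<exists>N. \<forall>m\<ge>N. \<forall>n\<ge>N. (\<integral>\<omega>. (S m \<omega> - S n \<omega>)\<^sup>2 \<partial>M) < (1/4)^k"
    using C unfolding L2_Cauchy_def by simp
  then obtain N where N: "\<And>k m n. m \<ge> N k \<Longrightarrow> n \<ge> N k \<Longrightarrow> (\<integral>\<omega>. (S m \<omega> - S n \<omega>)\<^sup>2 \<partial>M) < (1/4)^k"
    by metis
  \<comment> \<open>Summing the thresholds makes \<open>r\<close> increasing and at least
    \<open>N k\<close>; the summand \<open>k\<close> sends it to infinity.\<close>
  define r where "r k = k + (\<Sum>i\<le>k. N i)" for k
  have rN: "N k \<le> r k" for k unfolding r_def by (simp add: member_le_sum trans_le_add2)
  have r_Suc: "r k \<le> r (Suc k)" for k by (simp add: r_def)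
  define D where "D k \<omega> = S (r (Suc k)) \<omega> - S (r k) \<omega>" for k \<omega>
  have iD: "sq_int M (D k)" for k unfolding D_def by (intro sq_int_diff i)
  have [measurable]: "D k \<in> borel_measurable M" for k unfolding D_def by measurable
  have D_le: "(\<integral>\<^sup>+\<omega>. ennreal \<bar>D k \<omega>\<bar> \<partial>M) \<le> ennreal ((1/2)^k)" for k
  proof -
    have a: "sq_int M (\<lambda>\<omega>. \<bar>D k \<omega>\<bar>)" using iD[of k] by (simp add: sq_int_def)
    have "(\<integral>\<omega>. \<bar>D k \<omega>\<bar> * 1 \<partial>M)\<^sup>2 \<le> (\<integral>\<omega>. \<bar>D k \<omega>\<bar>\<^sup>2 \<partial>M) * (\<integral>\<omega>. 1\<^sup>2 \<partial>M)"
      by (rule sq_int_Cauchy_Schwarz[OF a sq_int_const])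
    also have "\<dots> = (\<integral>\<omega>. (D k \<omega>)\<^sup>2 \<partial>M)" by (simp add: prob_space)
    also have "\<dots> \<le> (1/4)^k"
      unfolding D_def using N[of k "r (Suc k)" "r k"] rN[of k] r_Suc[of k] by simp
    also have "\<dots> = ((1/2)^k)\<^sup>2" by (simp only: power2_eq_square power_mult_distrib[symmetric]) simp
    finally have "(\<integral>\<omega>. \<bar>D k \<omega>\<bar> \<partial>M)\<^sup>2 \<le> ((1/2)^k)\<^sup>2" by (simp only: mult_1_right)
    then have "(\<integral>\<omega>. \<bar>D k \<omega>\<bar> \<partial>M) \<le> (1/2)^k" by (rule power2_le_imp_le) simp
    moreover have "(\<integral>\<^sup>+\<omega>. ennreal \<bar>D k \<omega>\<bar> \<partial>M) = ennreal (\<integral>\<omega>. \<bar>D k \<omega>\<bar> \<partial>M)"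
      by (rule nn_integral_eq_integral[OF sq_int_integrable[OF a]]) simp
    ultimately show ?thesis by (simp add: ennreal_leI)
  qed
  have "(\<integral>\<^sup>+\<omega>. (\<Sum>k. ennreal \<bar>D k \<omega>\<bar>) \<partial>M) = (\<Sum>k. \<integral>\<^sup>+\<omega>. ennreal \<bar>D k \<omega>\<bar> \<partial>M)"
    by (rule nn_integral_suminf) measurable
  also have "\<dots> \<le> (\<Sum>k. ennreal ((1/2)^k))" by (intro suminf_le D_le) auto
  also have "\<dots> = ennreal (\<Sum>k. (1/2)^k)" by (rule suminf_ennreal2) (auto intro: summable_geometric)
  also have "\<dots> < \<infinity>" by simp
  finally have "(\<integral>\<^sup>+\<omega>. (\<Sum>k. ennreal \<bar>D k \<omega>\<bar>) \<partial>M) \<noteq> \<infinity>" by (rule less_imp_neq)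
  then have "AE \<omega> in M. (\<Sum>k. ennreal \<bar>D k \<omega>\<bar>) \<noteq> \<infinity>" by (intro nn_integral_PInf_AE) measurable
  then have "AE \<omega> in M. (\<lambda>k. S (r k) \<omega>) \<longlonglongrightarrow> lim (\<lambda>k. S (r k) \<omega>)"
  proof eventually_elim
    case (elim \<omega>)
    then have "summable (\<lambda>k. \<bar>D k \<omega>\<bar>)" by (intro summable_suminf_not_top) (simp_all add: infinity_ennreal_def)
    then have "summable (\<lambda>k. D k \<omega>)" by (rule summable_rabs_cancel)
    then have "convergent (\<lambda>n. \<Sum>k<n. D k \<omega>)" by (simp add: summable_iff_convergent)
    then have "convergent (\<lambda>n. S (r n) \<omega> - S (r 0) \<omega>)"
      by (simp only: D_def sum_lessThan_telescope[of "\<lambda>k. S (r k) \<omega>"])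
    then have "convergent (\<lambda>n. (S (r n) \<omega> - S (r 0) \<omega>) + S (r 0) \<omega>)" by (intro convergent_add convergent_const)
    then show ?case by (simp add: convergent_LIMSEQ_iff)
  qed
  moreover have "filterlim r sequentially sequentially"
    by (rule filterlim_at_top_mono[OF filterlim_ident]) (simp add: r_def)
  \<comment> \<open>\<open>lim\<close> is a total function with some value off the set of
    convergence, which gives a limit measurable on the whole space.\<close>
  ultimately have "L2_lim M S (\<lambda>\<omega>. lim (\<lambda>k. S (r k) \<omega>))"
    by (intro L2_lim_of_AE_lim[OF C, where r = r]) measurable
  then show ?thesis by (rule that)
qed

section \<open>Mean-square integrals as limits of dyadic Riemann sums\<close>

definition node :: "real \<Rightarrow> real \<Rightarrow> nat \<Rightarrow> nat \<Rightarrow> real" where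
  "node a b n i = a + real i * ((b - a) / 2 ^ n)"

lemma node_in:
  assumes "a \<le> b" "i \<le> 2 ^ n"
  shows "node a b n i \<in> {a..b}"
proof -
  have "real i \<le> 2 ^ n" using assms(2) of_nat_mono[of i "2 ^ n"] by simp
  then have "real i * ((b - a) / 2 ^ n) \<le> 2 ^ n * ((b - a) / 2 ^ n)"
    using assms by (intro mult_right_mono) auto
  then show ?thesis using assms by (simp add: node_def)
qed

lemma node_0 [simp]: "node a b n 0 = a" by (simp add: node_def)
lemma node_top [simp]: "node a b n (2 ^ n) = b" by (simp add: node_def)
lemma node_Suc: "node a b n (Suc i) = node a b n i + (b - a) / 2 ^ n"
  by (simp add: node_def distrib_right add_divide_distrib)

lemma mesh_eventually_small:
  fixes d :: real
  assumes "0 < d"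
  obtains N where "\<And>n. n \<ge> N \<Longrightarrow> (b - a) / 2 ^ n < d"
proof -
  have "(\<lambda>n. (b - a) * (1 / 2) ^ n) \<longlonglongrightarrow> (b - a) * 0"
    by (intro tendsto_mult tendsto_const LIMSEQ_realpow_zero) auto
  then have "\<forall>\<^sub>F n in sequentially. (b - a) * (1 / 2) ^ n < d"
    using assms by (intro order_tendstoD) auto
  then obtain N where N: "\<And>n. n \<ge> N \<Longrightarrow> (b - a) * (1 / 2) ^ n < d"
    unfolding eventually_sequentially by blast
  have "(b - a) / 2 ^ n = (b - a) * (1 / 2) ^ n" for n by (simp add: power_one_over)
  then have "(b - a) / 2 ^ n < d" if "n \<ge> N" for n using N[OF that] by (simp only:)
  then show ?thesis by (rule that)
qed

lemma riemann_sum_tendsto: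
  fixes f :: "real \<Rightarrow> real"
  assumes ab: "a \<le> b" and f: "continuous_on {a..b} f"
  shows "(\<lambda>n. \<Sum>i<2^n. (b - a) / 2 ^ n * f (node a b n i)) \<longlonglongrightarrow> integral {a..b} f"
proof (rule LIMSEQ_I)
  fix \<epsilon> :: real assume \<epsilon>: "0 < \<epsilon>"
  define \<eta> where "\<eta> = \<epsilon> / (b - a + 1)"
  have \<eta>: "0 < \<eta>" "\<eta> * (b - a) < \<epsilon>" using \<epsilon> ab by (auto simp: \<eta>_def field_simps)
  have "uniformly_continuous_on {a..b} f" using f by (intro compact_uniformly_continuous) auto
  then obtain d where d: "0 < d" "\<And>x y. x \<in> {a..b} \<Longrightarrow> y \<in> {a..b} \<Longrightarrow> dist y x < d \<Longrightarrow> dist (f y) (f x) < \<eta>"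
    using \<eta>(1) unfolding uniformly_continuous_on_def by blast
  obtain N where N: "\<And>n. n \<ge> N \<Longrightarrow> (b - a) / 2 ^ n < d" using mesh_eventually_small[OF d(1)] by blast
  have "norm ((\<Sum>i<2^n. (b - a) / 2 ^ n * f (node a b n i)) - integral {a..b} f) < \<epsilon>" if n: "n \<ge> N" for n
  proof -
    define h where "h = (b - a) / 2 ^ n"
    have h: "0 \<le> h" "h < d" using ab N[OF n] by (auto simp: h_def)
    let ?x = "node a b n"
    define F where "F x = integral {a..x} f" for x
    have step: "\<bar>h * f (?x i) - (F (?x (Suc i)) - F (?x i))\<bar> \<le> \<eta> * h" if i: "i < 2 ^ n" for i
    proof -
      have in1: "?x i \<in> {a..b}" and in2: "?x (Suc i) \<in> {a..b}" and S: "?x (Suc i) = ?x i + h"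
        using i ab node_in[of a b i n] node_in[of a b "Suc i" n] by (auto simp: node_Suc h_def)
      have sub: "{?x i..?x (Suc i)} \<subseteq> {a..b}" using in1 in2 by auto
      have i1: "f integrable_on {a..?x (Suc i)}" and i2: "f integrable_on {?x i..?x (Suc i)}"
        using in2 sub by (auto intro!: integrable_continuous_real continuous_on_subset[OF f])
      have "F (?x (Suc i)) - F (?x i) = integral {?x i..?x (Suc i)} f"
        unfolding F_def using Henstock_Kurzweil_Integration.integral_combine[OF _ _ i1, of "?x i"] in1 S h by simp
      moreover have "integral {?x i..?x (Suc i)} (\<lambda>t. f (?x i) - f t) = h * f (?x i) - integral {?x i..?x (Suc i)} f"
        using i2 h by (subst Henstock_Kurzweil_Integration.integral_diff) (auto simp: S)
      moreover have "norm (integral {?x i..?x (Suc i)} (\<lambda>t. f (?x i) - f t)) \<le> \<eta> * (?x (Suc i) - ?x i)"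
      proof (rule integral_bound)
        show "continuous_on {?x i..?x (Suc i)} (\<lambda>t. f (?x i) - f t)"
          by (intro continuous_intros continuous_on_subset[OF f sub])
        fix t assume t: "t \<in> {?x i..?x (Suc i)}"
        then have "dist (?x i) t < d" using S h by (auto simp: dist_real_def)
        then show "norm (f (?x i) - f t) \<le> \<eta>"
          using d(2)[of t "?x i"] t sub in1 by (auto simp: dist_real_def)
      qed (use S h in auto)
      ultimately show ?thesis using S by simp
    qed
    have "integral {a..b} f = (\<Sum>i<2^n. F (?x (Suc i)) - F (?x i))"
      using sum_lessThan_telescope[of "\<lambda>i. F (?x i)" "2 ^ n"] by (simp only: node_top node_0) (simp add: F_def)
    then have "\<bar>(\<Sum>i<2^n. h * f (?x i)) - integral {a..b} f\<bar> = \<bar>\<Sum>i<2^n. h * f (?x i) - (F (?x (Suc i)) - F (?x i))\<bar>"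
      by (simp only: sum_subtractf)
    also have "\<dots> \<le> (\<Sum>i<(2::nat)^n. \<eta> * h)" using step by (intro order_trans[OF sum_abs] sum_mono) auto
    also have "\<dots> = \<eta> * (b - a)" by (simp add: h_def)
    also have "\<dots> < \<epsilon>" by (rule \<eta>)
    finally show ?thesis by (simp add: h_def)
  qed
  then show "\<exists>N. \<forall>n\<ge>N. norm ((\<Sum>i<2^n. (b - a) / 2 ^ n * f (node a b n i)) - integral {a..b} f) < \<epsilon>" by blast
qed

text \<open>Left end points of dyadic cells. Dyadic partitions are nested, so a coarse sum is also a
  sum over any finer partition, with repeated values.\<close>

definition rsum :: "real \<Rightarrow> real \<Rightarrow> (real \<Rightarrow> 'a \<Rightarrow> real) \<Rightarrow> nat \<Rightarrow> 'a \<Rightarrow> real" where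
  "rsum a b G n \<omega> = (\<Sum>i<2^n. (b - a) / 2 ^ n * G (node a b n i) \<omega>)"

lemma sq_int_rsum:
  assumes "a \<le> b" "\<And>s. s \<in> {a..b} \<Longrightarrow> sq_int M (G s)"
  shows "sq_int M (rsum a b G n)"
  unfolding rsum_def[abs_def] using assms node_in[OF assms(1)]
  by (intro sq_int_sum sq_int_scale) (auto intro: less_imp_le)

text \<open>Nothing is asked of the paths: continuity of the second moments makes the expectation of
  \<open>(G s - G t)^2\<close> uniformly small for close \<open>s\<close> and \<open>t\<close>.
  Written over the fine partition, the difference of two sums is a sum of \<open>2^m\<close> such
  increments with weight \<open>h\<close>, and Cauchy--Schwarz bounds its second moment by
  \<open>(b - a)^2\<close> times that smallness.\<close>

lemma rsum_L2_Cauchy: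
  assumes ab: "a \<le> b" and G: "\<And>s. s \<in> {a..b} \<Longrightarrow> sq_int M (G s)"
    and cont: "continuous_on ({a..b} \<times> {a..b}) (\<lambda>(s, t). \<integral>\<omega>. G s \<omega> * G t \<omega> \<partial>M)"
  shows "L2_Cauchy M (rsum a b G)"
proof -
  define F where "F = (\<lambda>(s, t). \<integral>\<omega>. G s \<omega> * G t \<omega> \<partial>M)"
  have bound: "\<exists>N. \<forall>n\<ge>N. \<forall>m\<ge>n. (\<integral>\<omega>. (rsum a b G m \<omega> - rsum a b G n \<omega>)\<^sup>2 \<partial>M) < \<epsilon>" if \<epsilon>: "0 < \<epsilon>" for \<epsilon>
  proof -
    \<comment> \<open>The summand 1 keeps the divisor positive for \<open>a = b\<close>.\<close>
    define q where "q = (b - a)\<^sup>2 + 1"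
    define \<eta> where "\<eta> = \<epsilon> / (2 * q)"
    have den: "0 < q" by (simp add: q_def add_nonneg_pos)
    have \<eta>: "0 < \<eta>" using \<epsilon> den by (simp add: \<eta>_def)
    have \<eta>2: "(b - a)\<^sup>2 * (2 * \<eta>) < \<epsilon>"
    proof -
      have "(b - a)\<^sup>2 * (2 * \<eta>) < q * (2 * \<eta>)" using \<eta> by (intro mult_strict_right_mono) (auto simp: q_def)
      also have "\<dots> = \<epsilon>" using den by (simp add: \<eta>_def)
      finally show ?thesis .
    qed
    have "uniformly_continuous_on ({a..b} \<times> {a..b}) F"
      using cont unfolding F_def by (intro compact_uniformly_continuous compact_Times) auto
    then obtain d where d: "0 < d" "\<And>p q. p \<in> {a..b} \<times> {a..b} \<Longrightarrow> q \<in> {a..b} \<times> {a..b} \<Longrightarrow> dist q p < d \<Longrightarrow> dist (F q) (F p) < \<eta>"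
      using \<eta> unfolding uniformly_continuous_on_def by blast
    obtain N where N: "\<And>n. n \<ge> N \<Longrightarrow> (b - a) / 2 ^ n < d" using mesh_eventually_small[OF d(1)] by blast
    have close: "(\<integral>\<omega>. (G s \<omega> - G t \<omega>)\<^sup>2 \<partial>M) \<le> 2 * \<eta>"
      if st: "s \<in> {a..b}" "t \<in> {a..b}" "\<bar>s - t\<bar> < d" for s t
    proof -
      have "(\<integral>\<omega>. (G s \<omega> - G t \<omega>)\<^sup>2 \<partial>M) = (F (s, s) - F (s, t)) + (F (t, t) - F (s, t))"
        unfolding expectation_sq_diff[OF G[OF st(1)] G[OF st(2)]] by (simp add: F_def power2_eq_square)
      moreover have "dist (F (s, s)) (F (s, t)) < \<eta>" "dist (F (t, t)) (F (s, t)) < \<eta>"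
        using d(2)[of "(s, t)" "(s, s)"] d(2)[of "(s, t)" "(t, t)"] st
        by (simp_all add: dist_Pair_Pair dist_real_def abs_minus_commute)
      ultimately show ?thesis by (simp add: dist_real_def)
    qed
    show ?thesis
    proof (intro exI allI impI)
      fix n m assume nm: "N \<le> n" "n \<le> m"
      \<comment> \<open>Number of fine cells in a coarse cell, so that fine node \<open>j\<close>
        lies in coarse cell \<open>j div p\<close>, at distance less than the coarse mesh from its
        left end.\<close>
      define p where "p = (2::nat) ^ (m - n)"
      define h where "h = (b - a) / 2 ^ m"
      have p: "p > 0" by (simp add: p_def)
      have p2: "2 ^ n * p = (2::nat) ^ m" unfolding p_def using nm power_add[of "2::nat" n "m - n"] by simp
      have hp: "real p * h = (b - a) / 2 ^ n"
      proof -
        have "(2::real) ^ m = 2 ^ n * real p" unfolding p_def using nm power_add[of "2::real" n "m - n"] by simp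
        then show ?thesis using p by (simp add: h_def)
      qed
      have h: "0 \<le> h" using ab by (simp add: h_def)
      have coarse: "rsum a b G n \<omega> = (\<Sum>j<2^m. h * G (node a b n (j div p)) \<omega>)" for \<omega>
      proof -
        have "(\<Sum>j<2^m. h * G (node a b n (j div p)) \<omega>) = (\<Sum>i<2^n. \<Sum>j=i*p..<i*p+p. h * G (node a b n (j div p)) \<omega>)"
          unfolding sum.nat_group p2 ..
        also have "\<dots> = (\<Sum>i<2^n. \<Sum>j=i*p..<i*p+p. h * G (node a b n i) \<omega>)"
        proof (intro sum.cong refl)
          fix i j assume "j \<in> {i*p..<i*p+p}"
          then have "j div p = i" using p by (intro div_nat_eqI) (auto simp: mult.commute)
          then show "h * G (node a b n (j div p)) \<omega> = h * G (node a b n i) \<omega>" by simp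
        qed
        also have "\<dots> = rsum a b G n \<omega>" unfolding rsum_def hp[symmetric] by (simp add: mult.assoc)
        finally show ?thesis ..
      qed
      have jn: "node a b n (j div p) \<in> {a..b}" if "j < 2 ^ m" for j
      proof -
        have "j div p < 2 ^ n" using that p by (simp add: div_less_iff_less_mult p2)
        then show ?thesis using node_in[OF ab, of "j div p" n] by simp
      qed
      have jm: "node a b m j \<in> {a..b}" if "j < 2 ^ m" for j using node_in[OF ab, of j m] that by simp
      define D where "D j \<omega> = G (node a b m j) \<omega> - G (node a b n (j div p)) \<omega>" for j \<omega>
      have iD: "sq_int M (D j)" if "j < 2 ^ m" for j
        unfolding D_def[abs_def] using that jn jm by (intro sq_int_diff G)
      have D_le: "(\<integral>\<omega>. (D j \<omega>)\<^sup>2 \<partial>M) \<le> 2 * \<eta>" if "j < 2 ^ m" for j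
        unfolding D_def
      proof (rule close[OF jm[OF that] jn[OF that]])
        have "real j = real (j div p) * real p + real (j mod p)"
          by (metis div_mult_mod_eq of_nat_add of_nat_mult)
        then have "node a b m j - node a b n (j div p) = real (j mod p) * h"
          unfolding node_def hp[symmetric] h_def[symmetric] by (simp add: algebra_simps)
        moreover have "real (j mod p) * h \<le> real p * h" using p h by (intro mult_right_mono) (auto simp: less_imp_le)
        ultimately show "\<bar>node a b m j - node a b n (j div p)\<bar> < d"
          using N[OF nm(1)] h hp by simp
      qed
      have "(rsum a b G m \<omega> - rsum a b G n \<omega>)\<^sup>2 \<le> (2 ^ m * h\<^sup>2) * (\<Sum>j<2^m. (D j \<omega>)\<^sup>2)" for \<omega>
      proof -
        have "rsum a b G m \<omega> - rsum a b G n \<omega> = (\<Sum>j<2^m. h * D j \<omega>)"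
          unfolding coarse by (simp add: rsum_def h_def D_def sum_subtractf[symmetric] right_diff_distrib)
        then have "(rsum a b G m \<omega> - rsum a b G n \<omega>)\<^sup>2 \<le> (\<Sum>j<(2::nat)^m. h\<^sup>2) * (\<Sum>j<2^m. (D j \<omega>)\<^sup>2)"
          by (simp only: Cauchy_Schwarz_ineq_sum)
        then show ?thesis by simp
      qed
      then have "(\<integral>\<omega>. (rsum a b G m \<omega> - rsum a b G n \<omega>)\<^sup>2 \<partial>M) \<le> (\<integral>\<omega>. (2 ^ m * h\<^sup>2) * (\<Sum>j<2^m. (D j \<omega>)\<^sup>2) \<partial>M)"
        using iD by (intro Bochner_Integration.integral_mono sq_int_sq sq_int_diff sq_int_rsum ab G
            integrable_mult_right Bochner_Integration.integrable_sum) auto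
      also have "\<dots> = (2 ^ m * h\<^sup>2) * (\<Sum>j<2^m. \<integral>\<omega>. (D j \<omega>)\<^sup>2 \<partial>M)"
        using sq_int_sq[OF iD] by (subst integral_mult_right_zero) (simp add: Bochner_Integration.integral_sum)
      also have "\<dots> \<le> (2 ^ m * h\<^sup>2) * (\<Sum>j<(2::nat)^m. 2 * \<eta>)"
        using D_le by (intro mult_left_mono sum_mono) auto
      also have "\<dots> = (b - a)\<^sup>2 * (2 * \<eta>)"
        by (simp add: h_def power_divide power2_eq_square)
      also have "\<dots> < \<epsilon>" by (rule \<eta>2)
      finally show "(\<integral>\<omega>. (rsum a b G m \<omega> - rsum a b G n \<omega>)\<^sup>2 \<partial>M) < \<epsilon>" .
    qed
  qed
  show ?thesis
    unfolding L2_Cauchy_def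
  proof (intro conjI allI impI)
    fix \<epsilon> :: real assume "0 < \<epsilon>"
    then obtain N where N: "\<forall>n\<ge>N. \<forall>m\<ge>n. (\<integral>\<omega>. (rsum a b G m \<omega> - rsum a b G n \<omega>)\<^sup>2 \<partial>M) < \<epsilon>"
      using bound by blast
    show "\<exists>N. \<forall>m\<ge>N. \<forall>n\<ge>N. (\<integral>\<omega>. (rsum a b G m \<omega> - rsum a b G n \<omega>)\<^sup>2 \<partial>M) < \<epsilon>"
    proof (intro exI allI impI)
      fix m n assume "N \<le> m" "N \<le> n"
      then show "(\<integral>\<omega>. (rsum a b G m \<omega> - rsum a b G n \<omega>)\<^sup>2 \<partial>M) < \<epsilon>"
      proof (cases "n \<le> m")
        case False
        then have "(\<integral>\<omega>. (rsum a b G n \<omega> - rsum a b G m \<omega>)\<^sup>2 \<partial>M) < \<epsilon>" using N \<open>N \<le> m\<close> by simp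
        then show ?thesis by (subst power2_commute)
      qed (use N in auto)
    qed
  qed (rule sq_int_rsum[OF ab G])
qed

lemma expectation_rsum:
  assumes ab: "a \<le> b" and G: "\<And>s. s \<in> {a..b} \<Longrightarrow> sq_int M (G s)" and Y: "sq_int M Y"
  shows "(\<integral>\<omega>. Y \<omega> * rsum a b G n \<omega> \<partial>M) = (\<Sum>i<2^n. (b - a) / 2 ^ n * (\<integral>\<omega>. Y \<omega> * G (node a b n i) \<omega> \<partial>M))"
proof -
  have i: "integrable M (\<lambda>\<omega>. Y \<omega> * G (node a b n i) \<omega>)" if "i < 2 ^ n" for i
    using that node_in[OF ab, of i n] by (intro sq_int_mult Y G) auto
  have "(\<integral>\<omega>. Y \<omega> * rsum a b G n \<omega> \<partial>M) = (\<integral>\<omega>. (\<Sum>i<2^n. (b - a) / 2 ^ n * (Y \<omega> * G (node a b n i) \<omega>)) \<partial>M)"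
    by (simp add: rsum_def sum_distrib_left mult_ac)
  also have "\<dots> = (\<Sum>i<2^n. \<integral>\<omega>. (b - a) / 2 ^ n * (Y \<omega> * G (node a b n i) \<omega>) \<partial>M)"
    using i by (intro Bochner_Integration.integral_sum integrable_mult_right) auto
  finally show ?thesis by simp
qed

text \<open>Takes the place of Fubini's theorem: expectation against a fixed \<open>Y\<close>
  commutes with the mean-square integral, because it is continuous in mean square and turns Riemann
  sums into Riemann sums.\<close>

lemma L2_lim_rsum_expectation:
  assumes ab: "a \<le> b" and G: "\<And>s. s \<in> {a..b} \<Longrightarrow> sq_int M (G s)" and Y: "sq_int M Y"
    and lim: "L2_lim M (rsum a b G) \<zeta>" and c: "continuous_on {a..b} (\<lambda>s. \<integral>\<omega>. Y \<omega> * G s \<omega> \<partial>M)"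
  shows "(\<integral>\<omega>. Y \<omega> * \<zeta> \<omega> \<partial>M) = integral {a..b} (\<lambda>s. \<integral>\<omega>. Y \<omega> * G s \<omega> \<partial>M)"
proof (rule LIMSEQ_unique[OF L2_lim_mult[OF lim Y]])
  show "(\<lambda>n. \<integral>\<omega>. Y \<omega> * rsum a b G n \<omega> \<partial>M) \<longlonglongrightarrow> integral {a..b} (\<lambda>s. \<integral>\<omega>. Y \<omega> * G s \<omega> \<partial>M)"
    using riemann_sum_tendsto[OF ab c] by (simp only: expectation_rsum[OF ab G Y])
qed

section \<open>Gaussian spaces\<close>

abbreviation std_normal_measure :: "real measure" where
  "std_normal_measure \<equiv> density lborel (\<lambda>x. ennreal (std_normal_density x))"

context prob_space begin

text \<open>Under the measure with density \<open>g / m\<close> the variable \<open>\<xi>\<close>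
  has the standard normal characteristic function, hence the standard normal law. This converts an
  identity between exponentials into one between indicators.\<close>

lemma distr_density_eq_std_normal:
  fixes g \<xi> :: "'a \<Rightarrow> real"
  assumes g[measurable]: "g \<in> borel_measurable M" and g_nonneg: "\<And>\<omega>. 0 \<le> g \<omega>" and g_le: "\<And>\<omega>. g \<omega> \<le> C"
    and \<xi>[measurable]: "\<xi> \<in> borel_measurable M"
    and char: "\<And>s. (CLINT \<omega>|M. of_real (g \<omega>) * iexp (s * \<xi> \<omega>)) = of_real (\<integral>\<omega>. g \<omega> \<partial>M) * of_real (exp (- s\<^sup>2 / 2))"
    and A[measurable]: "A \<in> sets borel"
  shows "(\<integral>\<omega>. g \<omega> * indicator A (\<xi> \<omega>) \<partial>M) = (\<integral>\<omega>. g \<omega> \<partial>M) * measure std_normal_measure A"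
proof -
  define m where "m = (\<integral>\<omega>. g \<omega> \<partial>M)"
  have int_g: "integrable M g"
    by (rule integrable_const_bound[of _ C]) (use g_nonneg g_le in auto)
  have m_nonneg: "0 \<le> m" unfolding m_def using g_nonneg by (intro Bochner_Integration.integral_nonneg) auto
  show ?thesis
  \<comment> \<open>Without positive mass there is no normalised density, but then \<open>g\<close>
    vanishes almost everywhere.\<close>
  proof (cases "m = 0")
    case True
    then have "AE \<omega> in M. g \<omega> = 0"
      using integral_nonneg_eq_0_iff_AE[OF int_g] g_nonneg by (simp add: m_def)
    then have "AE \<omega> in M. g \<omega> * indicator A (\<xi> \<omega>) = 0" by eventually_elim simp
    then have "(\<integral>\<omega>. g \<omega> * indicator A (\<xi> \<omega>) \<partial>M) = 0" by (rule integral_eq_zero_AE)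
    then show ?thesis using True by (simp add: m_def)
  next
    case False
    then have m: "m > 0" using m_nonneg by simp
    define D where "D = density M (\<lambda>\<omega>. ennreal (g \<omega> / m))"
    define Q where "Q = distr D borel \<xi>"
    have sets_D: "sets D = sets M" by (simp add: D_def)
    have \<xi>D[measurable]: "\<xi> \<in> borel_measurable D" by (simp add: D_def)
    have gm[measurable]: "(\<lambda>\<omega>. g \<omega> / m) \<in> borel_measurable M" by measurable
    have gm_nonneg: "0 \<le> g \<omega> / m" for \<omega> using g_nonneg m by simp
    have "emeasure D (space D) = (\<integral>\<^sup>+\<omega>. ennreal (g \<omega> / m) \<partial>M)"
      unfolding D_def by (subst emeasure_density) (auto intro!: nn_integral_cong)
    also have "\<dots> = ennreal (\<integral>\<omega>. g \<omega> / m \<partial>M)"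
      using int_g gm_nonneg by (intro nn_integral_eq_integral) auto
    also have "(\<integral>\<omega>. g \<omega> / m \<partial>M) = 1" using m by (simp add: m_def)
    finally have "prob_space D" by (intro prob_spaceI) simp
    then have Q: "real_distribution Q"
      unfolding Q_def by (intro prob_space.real_distribution_distr \<xi>D)
    have "char Q = char std_normal_distribution"
    proof
      fix s
      have "char Q s = (CLINT \<omega>|D. iexp (s * \<xi> \<omega>))"
        unfolding char_def Q_def by (rule integral_distr[OF \<xi>D]) measurable
      also have "\<dots> = (CLINT \<omega>|M. (g \<omega> / m) *\<^sub>R iexp (s * \<xi> \<omega>))"
        unfolding D_def by (rule integral_density) (use gm_nonneg in auto)
      also have "\<dots> = (CLINT \<omega>|M. (1 / of_real m) * (of_real (g \<omega>) * iexp (s * \<xi> \<omega>)))"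
        by (simp add: scaleR_conv_of_real)
      also have "\<dots> = of_real (exp (- s\<^sup>2 / 2))"
        using m unfolding integral_mult_right_zero char by (simp add: m_def[symmetric])
      finally show "char Q s = char std_normal_distribution s"
        by (simp add: char_std_normal_distribution)
    qed
    then have QN: "Q = std_normal_distribution"
      by (intro Levy_uniqueness Q real_dist_normal_dist)
    interpret Q: real_distribution Q by (rule Q)
    have AQ: "A \<in> sets Q" by (simp add: Q_def)
    have "measure Q A = (\<integral>x. indicator A x \<partial>Q)" using AQ by simp
    also have "\<dots> = (\<integral>\<omega>. indicator A (\<xi> \<omega>) \<partial>D)"
      unfolding Q_def by (rule integral_distr[OF \<xi>D]) measurable
    also have "\<dots> = (\<integral>\<omega>. (g \<omega> / m) *\<^sub>R indicator A (\<xi> \<omega>) \<partial>M)"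
      unfolding D_def by (rule integral_density) (use gm_nonneg in auto)
    also have "\<dots> = (\<integral>\<omega>. (1 / m) * (g \<omega> * indicator A (\<xi> \<omega>)) \<partial>M)" by simp
    also have "\<dots> = (1 / m) * (\<integral>\<omega>. g \<omega> * indicator A (\<xi> \<omega>) \<partial>M)" by (rule integral_mult_right_zero)
    finally show ?thesis using m unfolding QN m_def[symmetric] by (simp add: field_simps)
  qed
qed

text \<open>Passes from non-negative to bounded complex weights: real and imaginary parts are
  treated separately, each being a linear combination of \<open>W\<close> and its conjugate.\<close>

lemma integral_mult_indicator_std_normal:
  fixes W :: "'a \<Rightarrow> complex" and \<xi> :: "'a \<Rightarrow> real"
  assumes W[measurable]: "W \<in> borel_measurable M" and W_le: "\<And>\<omega>. cmod (W \<omega>) \<le> 1"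
    and \<xi>[measurable]: "\<xi> \<in> borel_measurable M"
    and char1: "\<And>s. (CLINT \<omega>|M. iexp (s * \<xi> \<omega>)) = of_real (exp (- s\<^sup>2 / 2))"
    and char: "\<And>s. (CLINT \<omega>|M. W \<omega> * iexp (s * \<xi> \<omega>)) = (CLINT \<omega>|M. W \<omega>) * of_real (exp (- s\<^sup>2 / 2))"
    and A[measurable]: "A \<in> sets borel"
  shows "(CLINT \<omega>|M. W \<omega> * indicator A (\<xi> \<omega>)) = (CLINT \<omega>|M. W \<omega>) * of_real (measure std_normal_measure A)"
proof -
  have int_W: "integrable M W" by (rule integrable_const_bound[of _ 1]) (use W_le in auto)
  have int_We: "integrable M (\<lambda>\<omega>. W \<omega> * iexp (s * \<xi> \<omega>))" for s
    by (rule integrable_const_bound[of _ 1]) (use W_le in \<open>auto simp: norm_mult\<close>)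
  have [measurable]: "(\<lambda>\<omega>. cnj (W \<omega>)) \<in> borel_measurable M"
    by (rule borel_measurable_continuous_on[OF continuous_on_cnj[OF continuous_on_id] W])
  have int_cWe: "integrable M (\<lambda>\<omega>. cnj (W \<omega>) * iexp (s * \<xi> \<omega>))" for s
    by (rule integrable_const_bound[of _ 1]) (use W_le in \<open>auto simp: norm_mult\<close>)
  have int_e: "integrable M (\<lambda>\<omega>. iexp (s * \<xi> \<omega>))" for s
    by (rule integrable_const_bound[of _ 1]) auto
  \<comment> \<open>Conjugation reverses the sign of \<open>s\<close>, and the normal characteristic
    function is even.\<close>
  have charc: "(CLINT \<omega>|M. cnj (W \<omega>) * iexp (s * \<xi> \<omega>)) = (CLINT \<omega>|M. cnj (W \<omega>)) * of_real (exp (- s\<^sup>2 / 2))" for s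
  proof -
    have "(CLINT \<omega>|M. cnj (W \<omega>) * iexp (s * \<xi> \<omega>)) = (CLINT \<omega>|M. cnj (W \<omega> * iexp (- s * \<xi> \<omega>)))"
      by (simp add: exp_cnj)
    also have "\<dots> = cnj ((CLINT \<omega>|M. W \<omega>) * of_real (exp (- (- s)\<^sup>2 / 2)))"
      by (simp only: Bochner_Integration.integral_cnj char)
    also have "\<dots> = (CLINT \<omega>|M. cnj (W \<omega>)) * of_real (exp (- s\<^sup>2 / 2))" by simp
    finally show ?thesis .
  qed
  \<comment> \<open>The form \<open>c * W + d * cnj W\<close> covers \<open>Re W\<close> with
    \<open>1/2, 1/2\<close> and \<open>Im W\<close> with
    \<open>- \<i> / 2, \<i> / 2\<close>.\<close>
  have key: "(\<integral>\<omega>. a \<omega> * indicator A (\<xi> \<omega>) \<partial>M) = (\<integral>\<omega>. a \<omega> \<partial>M) * measure std_normal_measure A"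
    if a[measurable]: "a \<in> borel_measurable M" and a_le: "\<And>\<omega>. \<bar>a \<omega>\<bar> \<le> 1"
      and a_eq: "\<And>\<omega>. of_real (a \<omega>) = c * W \<omega> + d * cnj (W \<omega>)" for a :: "'a \<Rightarrow> real" and c d
  proof -
    have int_a: "integrable M a" by (rule integrable_const_bound[of _ 1]) (use a_le in auto)
    have int_ai: "integrable M (\<lambda>\<omega>. a \<omega> * indicator A (\<xi> \<omega>))"
      by (rule integrable_const_bound[of _ 1]) (use a_le in \<open>auto simp: abs_mult indicator_def\<close>)
    have int_i: "integrable M (\<lambda>\<omega>. indicator A (\<xi> \<omega>) :: real)"
      by (rule integrable_const_bound[of _ 1]) (auto simp: indicator_def)
    \<comment> \<open>the weight is shifted by \<open>1\<close> because a density has to be non-negative\<close>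
    have "(CLINT \<omega>|M. of_real (1 + a \<omega>) * iexp (s * \<xi> \<omega>)) = of_real (\<integral>\<omega>. 1 + a \<omega> \<partial>M) * of_real (exp (- s\<^sup>2 / 2))" for s
    proof -
      have "(CLINT \<omega>|M. of_real (1 + a \<omega>) * iexp (s * \<xi> \<omega>))
          = (CLINT \<omega>|M. iexp (s * \<xi> \<omega>) + (c * (W \<omega> * iexp (s * \<xi> \<omega>)) + d * (cnj (W \<omega>) * iexp (s * \<xi> \<omega>))))"
        by (rule Bochner_Integration.integral_cong) (simp_all add: a_eq distrib_right mult.assoc)
      also have "\<dots> = of_real (exp (- s\<^sup>2 / 2)) + (c * ((CLINT \<omega>|M. W \<omega>) * of_real (exp (- s\<^sup>2 / 2)))
          + d * ((CLINT \<omega>|M. cnj (W \<omega>)) * of_real (exp (- s\<^sup>2 / 2))))"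
        using int_e[of s] int_We[of s] int_cWe[of s]
        by (simp only: Bochner_Integration.integral_add Bochner_Integration.integrable_add
            integrable_mult_right integral_mult_right_zero char1 char charc)
      also have "\<dots> = (1 + (c * (CLINT \<omega>|M. W \<omega>) + d * (CLINT \<omega>|M. cnj (W \<omega>)))) * of_real (exp (- s\<^sup>2 / 2))"
        by (simp only: distrib_right mult.assoc mult_1_left)
      also have "c * (CLINT \<omega>|M. W \<omega>) + d * (CLINT \<omega>|M. cnj (W \<omega>)) = (CLINT \<omega>|M. c * W \<omega> + d * cnj (W \<omega>))"
        using int_W by (simp add: integrable_cnj)
      also have "\<dots> = of_real (\<integral>\<omega>. a \<omega> \<partial>M)"
        unfolding a_eq[symmetric] by (rule integral_complex_of_real)
      also have "1 + of_real (\<integral>\<omega>. a \<omega> \<partial>M) = (of_real (\<integral>\<omega>. 1 + a \<omega> \<partial>M) :: complex)"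
        using int_a by (simp add: prob_space)
      finally show ?thesis .
    qed
    note ch = this
    have 1: "(\<integral>\<omega>. (1 + a \<omega>) * indicator A (\<xi> \<omega>) \<partial>M) = (\<integral>\<omega>. 1 + a \<omega> \<partial>M) * measure std_normal_measure A"
    proof -
      have le: "a \<omega> \<le> 1" "- 1 \<le> a \<omega>" for \<omega> using a_le[of \<omega>] by auto
      show ?thesis
      proof (rule distr_density_eq_std_normal[OF _ _ _ \<xi> ch A, of 2])
        show "0 \<le> 1 + a \<omega>" "1 + a \<omega> \<le> 2" for \<omega> using le[of \<omega>] by auto
      qed measurable
    qed
    have "(CLINT \<omega>|M. of_real 1 * iexp (s * \<xi> \<omega>)) = of_real (\<integral>\<omega>. 1 \<partial>M) * of_real (exp (- s\<^sup>2 / 2))" for s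
      using char1[of s] by (simp add: prob_space)
    from distr_density_eq_std_normal[OF _ _ _ \<xi> this A, of 1]
    have 2: "(\<integral>\<omega>. indicator A (\<xi> \<omega>) \<partial>M) = measure std_normal_measure A"
      by (simp add: prob_space)
    have "(\<integral>\<omega>. (1 + a \<omega>) * indicator A (\<xi> \<omega>) \<partial>M) = (\<integral>\<omega>. indicator A (\<xi> \<omega>) \<partial>M) + (\<integral>\<omega>. a \<omega> * indicator A (\<xi> \<omega>) \<partial>M)"
      using int_ai int_i by (simp add: distrib_right)
    moreover have "(\<integral>\<omega>. 1 + a \<omega> \<partial>M) = 1 + (\<integral>\<omega>. a \<omega> \<partial>M)" using int_a by (simp add: prob_space)
    ultimately show ?thesis using 1 2 by (simp add: distrib_right)
  qed
  have Re: "(\<integral>\<omega>. Re (W \<omega>) * indicator A (\<xi> \<omega>) \<partial>M) = (\<integral>\<omega>. Re (W \<omega>) \<partial>M) * measure std_normal_measure A"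
    by (rule key[of _ "1/2" "1/2"])
      (use order_trans[OF abs_Re_le_cmod W_le] in \<open>auto simp: complex_eq_iff\<close>)
  have Im: "(\<integral>\<omega>. Im (W \<omega>) * indicator A (\<xi> \<omega>) \<partial>M) = (\<integral>\<omega>. Im (W \<omega>) \<partial>M) * measure std_normal_measure A"
    by (rule key[of _ "- \<i> / 2" "\<i> / 2"])
      (use order_trans[OF abs_Im_le_cmod W_le] in \<open>auto simp: complex_eq_iff\<close>)
  have int_Wi: "integrable M (\<lambda>\<omega>. W \<omega> * indicator A (\<xi> \<omega>))"
    by (rule integrable_const_bound[of _ 1]) (use W_le in \<open>auto simp: norm_mult indicator_def\<close>)
  have ReI: "Re (indicator A x) = indicator A x" "Im (indicator A x) = 0" for x :: real
    by (simp_all add: indicator_def)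
  show ?thesis
    by (rule complex_eqI)
      (use Re Im int_W int_Wi in \<open>simp_all add: integral_Re[symmetric] integral_Im[symmetric] ReI del: integral_Re integral_Im\<close>)
qed

text \<open>Mixed expectations of indicators over \<open>J\<close> and exponentials over
  \<open>K\<close> interpolate between the joint characteristic function (\<open>J\<close> empty)
  and joint probabilities (\<open>K\<close> empty). Each exchange needs uniqueness of
  one-dimensional laws only.\<close>

lemma indep_std_normal_of_char:
  fixes \<xi> :: "'i \<Rightarrow> 'a \<Rightarrow> real"
  assumes \<xi>: "\<And>k. k \<in> I \<Longrightarrow> \<xi> k \<in> borel_measurable M"
    and char: "\<And>K u. finite K \<Longrightarrow> K \<subseteq> I \<Longrightarrow>
       (CLINT \<omega>|M. iexp (\<Sum>k\<in>K. u k * \<xi> k \<omega>)) = of_real (exp (- (\<Sum>k\<in>K. (u k)\<^sup>2) / 2))"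
  shows "indep_vars (\<lambda>_. borel) \<xi> I" and "\<And>k. k \<in> I \<Longrightarrow> distributed M lborel (\<xi> k) std_normal_density"
proof -
  \<comment> \<open>the induction moves the variables one by one from the exponential to the indicators\<close>
  have claim: "(CLINT \<omega>|M. (\<Prod>j\<in>J. indicator (A j) (\<xi> j \<omega>)) * iexp (\<Sum>k\<in>K. u k * \<xi> k \<omega>))
      = (\<Prod>j\<in>J. of_real (measure std_normal_measure (A j))) * of_real (exp (- (\<Sum>k\<in>K. (u k)\<^sup>2) / 2))"
    if "finite J" "J \<subseteq> I" "\<And>j. j \<in> J \<Longrightarrow> A j \<in> sets borel" "finite K" "K \<subseteq> I" "J \<inter> K = {}" for J A K u
    using that
  proof (induction J arbitrary: K u rule: finite_induct)
    case empty
    then show ?case using char by simp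
  next
    case (insert m J)
    define W where "W \<omega> = (\<Prod>j\<in>J. indicator (A j) (\<xi> j \<omega>)) * iexp (\<Sum>k\<in>K. u k * \<xi> k \<omega>)" for \<omega>
    have m: "m \<in> I" "A m \<in> sets borel" and mK: "m \<notin> K" using insert.prems by auto
    have [measurable]: "\<xi> m \<in> borel_measurable M" using \<xi> m by simp
    have 1: "(\<lambda>\<omega>. \<Sum>k\<in>K. u k * \<xi> k \<omega>) \<in> borel_measurable M"
      using insert.prems \<xi> by (intro borel_measurable_sum borel_measurable_times borel_measurable_const) auto
    have 2: "(\<lambda>\<omega>. \<Prod>j\<in>J. indicator (A j) (\<xi> j \<omega>) :: complex) \<in> borel_measurable M"
    proof (rule borel_measurable_prod)
      fix j assume "j \<in> J"
      then have [measurable]: "\<xi> j \<in> borel_measurable M" "A j \<in> sets borel" using insert.prems \<xi> by auto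
      show "(\<lambda>\<omega>. indicator (A j) (\<xi> j \<omega>) :: complex) \<in> borel_measurable M" by measurable
    qed
    have [measurable]: "W \<in> borel_measurable M" unfolding W_def using 1 2 by measurable
    have W_le: "cmod (W \<omega>) \<le> 1" for \<omega>
    proof -
      have "(\<Prod>j\<in>J. cmod (indicator (A j) (\<xi> j \<omega>))) \<le> (\<Prod>j\<in>J. 1)"
        by (intro prod_mono) (auto simp: indicator_def)
      then show ?thesis by (simp add: W_def norm_mult prod_norm[symmetric] del: of_real_sum)
    qed
    have EW: "(CLINT \<omega>|M. W \<omega>) = (\<Prod>j\<in>J. of_real (measure std_normal_measure (A j))) * of_real (exp (- (\<Sum>k\<in>K. (u k)\<^sup>2) / 2))"
      unfolding W_def using insert.prems by (intro insert.IH) auto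
    have char1: "(CLINT \<omega>|M. iexp (s * \<xi> m \<omega>)) = of_real (exp (- s\<^sup>2 / 2))" for s
      using char[of "{m}" "\<lambda>_. s"] m by simp
    have charW: "(CLINT \<omega>|M. W \<omega> * iexp (s * \<xi> m \<omega>)) = (CLINT \<omega>|M. W \<omega>) * of_real (exp (- s\<^sup>2 / 2))" for s
    proof -
      \<comment> \<open>Lets the extra exponential of variable \<open>m\<close> join the sum over
        \<open>K\<close>, so that the induction hypothesis applies to
        \<open>insert m K\<close>.\<close>
      define u' where "u' = u(m := s)"
      have s1: "(\<Sum>k\<in>insert m K. u' k * \<xi> k \<omega>) = (\<Sum>k\<in>K. u k * \<xi> k \<omega>) + s * \<xi> m \<omega>" for \<omega>
      proof -
        have "(\<Sum>k\<in>K. u' k * \<xi> k \<omega>) = (\<Sum>k\<in>K. u k * \<xi> k \<omega>)"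
          using mK by (intro sum.cong) (auto simp: u'_def)
        then show ?thesis using mK insert.prems by (simp add: u'_def)
      qed
      have s2: "(\<Sum>k\<in>insert m K. (u' k)\<^sup>2) = (\<Sum>k\<in>K. (u k)\<^sup>2) + s\<^sup>2"
      proof -
        have "(\<Sum>k\<in>K. (u' k)\<^sup>2) = (\<Sum>k\<in>K. (u k)\<^sup>2)"
          using mK by (intro sum.cong) (auto simp: u'_def)
        then show ?thesis using mK insert.prems by (simp add: u'_def)
      qed
      have "(CLINT \<omega>|M. W \<omega> * iexp (s * \<xi> m \<omega>))
          = (CLINT \<omega>|M. (\<Prod>j\<in>J. indicator (A j) (\<xi> j \<omega>)) * iexp (\<Sum>k\<in>insert m K. u' k * \<xi> k \<omega>))"
        unfolding s1 W_def of_real_add distrib_left exp_add mult.assoc ..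
      also have "\<dots> = (\<Prod>j\<in>J. of_real (measure std_normal_measure (A j))) * of_real (exp (- (\<Sum>k\<in>insert m K. (u' k)\<^sup>2) / 2))"
        using insert.prems insert.hyps m by (intro insert.IH) auto
      also have "\<dots> = (CLINT \<omega>|M. W \<omega>) * of_real (exp (- s\<^sup>2 / 2))"
        unfolding s2 EW by (simp add: add_divide_distrib exp_add[symmetric] exp_diff[symmetric] of_real_mult[symmetric] mult.assoc del: of_real_mult)
      finally show ?thesis .
    qed
    have "(CLINT \<omega>|M. (\<Prod>j\<in>insert m J. indicator (A j) (\<xi> j \<omega>)) * iexp (\<Sum>k\<in>K. u k * \<xi> k \<omega>))
        = (CLINT \<omega>|M. W \<omega> * indicator (A m) (\<xi> m \<omega>))"
      using insert.hyps by (simp add: W_def mult_ac)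
    also have "\<dots> = (CLINT \<omega>|M. W \<omega>) * of_real (measure std_normal_measure (A m))"
      by (rule integral_mult_indicator_std_normal[OF _ W_le _ char1 charW m(2)]) measurable
    finally show ?case unfolding EW using insert.hyps by (simp add: mult_ac)
  qed
  have prob_claim: "prob (\<Inter>j\<in>J. \<xi> j -` A j \<inter> space M) = (\<Prod>j\<in>J. measure std_normal_measure (A j))"
    if J: "finite J" "J \<noteq> {}" "J \<subseteq> I" "\<And>j. j \<in> J \<Longrightarrow> A j \<in> sets borel" for J A
  proof -
    have ev: "(\<Inter>j\<in>J. \<xi> j -` A j \<inter> space M) \<in> events"
      using J \<xi> by (intro sets.finite_INT measurable_sets) auto
    have "complex_of_real (prob E) = (CLINT \<omega>|M. indicator E \<omega>)" if "E \<in> events" for E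
    proof -
      have "(CLINT \<omega>|M. indicator E \<omega>) = (CLINT \<omega>|M. of_real (indicator E \<omega>))"
        by (rule Bochner_Integration.integral_cong) (auto simp: indicator_def)
      also have "\<dots> = of_real (prob E)" unfolding integral_complex_of_real using that by simp
      finally show ?thesis ..
    qed
    from this[OF ev] have "of_real (prob (\<Inter>j\<in>J. \<xi> j -` A j \<inter> space M)) = (CLINT \<omega>|M. indicator (\<Inter>j\<in>J. \<xi> j -` A j \<inter> space M) \<omega>)" .
    also have "\<dots> = (CLINT \<omega>|M. (\<Prod>j\<in>J. indicator (A j) (\<xi> j \<omega>)) * iexp (\<Sum>k\<in>{}. (\<lambda>_. 0) k * \<xi> k \<omega>))"
    proof (rule Bochner_Integration.integral_cong)
      fix \<omega> assume \<omega>: "\<omega> \<in> space M"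
      show "indicator (\<Inter>j\<in>J. \<xi> j -` A j \<inter> space M) \<omega> = (\<Prod>j\<in>J. indicator (A j) (\<xi> j \<omega>)) * iexp (\<Sum>k\<in>{}. (\<lambda>_. 0) k * \<xi> k \<omega>)"
      proof (cases "\<forall>j\<in>J. \<xi> j \<omega> \<in> A j")
        case True
        then show ?thesis using \<omega> J by simp
      next
        case False
        then obtain j where j: "j \<in> J" "\<xi> j \<omega> \<notin> A j" by blast
        then have "(\<Prod>j\<in>J. indicator (A j) (\<xi> j \<omega>)) = (0::complex)"
          using J by (auto simp: prod_zero_iff indicator_def)
        then show ?thesis using j by (auto simp: indicator_def)
      qed
    qed simp
    also have "\<dots> = of_real (\<Prod>j\<in>J. measure std_normal_measure (A j))"
      using J by (subst claim) auto
    finally show ?thesis by (simp only: of_real_eq_iff)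
  qed
  have single: "prob (\<xi> j -` A \<inter> space M) = measure std_normal_measure A" if "j \<in> I" "A \<in> sets borel" for j A
    using prob_claim[of "{j}" "\<lambda>_. A"] that by simp
  show "indep_vars (\<lambda>_. borel) \<xi> I"
    unfolding indep_vars_def2 indep_sets_def
  proof (intro conjI ballI allI impI)
    fix J E assume J: "J \<subseteq> I" "J \<noteq> {}" "finite J" and E: "E \<in> (\<Pi> j\<in>J. {\<xi> j -` A \<inter> space M |A. A \<in> sets borel})"
    then have "\<forall>j\<in>J. \<exists>A. A \<in> sets borel \<and> E j = \<xi> j -` A \<inter> space M" by (auto simp: Pi_iff)
    then obtain A where A: "\<And>j. j \<in> J \<Longrightarrow> A j \<in> sets borel" "\<And>j. j \<in> J \<Longrightarrow> E j = \<xi> j -` A j \<inter> space M"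
      by metis
    have "(\<Inter>j\<in>J. E j) = (\<Inter>j\<in>J. \<xi> j -` A j \<inter> space M)" using A(2) by auto
    moreover have "(\<Prod>j\<in>J. prob (E j)) = (\<Prod>j\<in>J. measure std_normal_measure (A j))"
      using A J single by (intro prod.cong) auto
    ultimately show "prob (\<Inter>j\<in>J. E j) = (\<Prod>j\<in>J. prob (E j))" using prob_claim[of J A] J A(1) by simp
  qed (use \<xi> in \<open>auto intro: measurable_sets\<close>)
  show "distributed M lborel (\<xi> k) std_normal_density" if k: "k \<in> I" for k
  proof -
    interpret N: prob_space std_normal_measure by (rule prob_space_normal_density) simp
    have [measurable]: "\<xi> k \<in> borel_measurable M" using \<xi> k by simp
    interpret D: prob_space "distr M lborel (\<xi> k)" by (rule prob_space_distr) simp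
    have "distr M lborel (\<xi> k) = std_normal_measure"
    proof (rule measure_eqI)
      fix A assume "A \<in> sets (distr M lborel (\<xi> k))"
      then have A: "A \<in> sets borel" by simp
      have "measure (distr M lborel (\<xi> k)) A = measure std_normal_measure A"
        using single[OF k A] A by (simp add: measure_distr)
      then show "emeasure (distr M lborel (\<xi> k)) A = emeasure std_normal_measure A"
        by (simp add: D.emeasure_eq_measure N.emeasure_eq_measure)
    qed simp
    then show ?thesis by (simp add: distributed_def)
  qed
qed

end

section \<open>The Gaussian space generated by a process\<close>

text \<open>The closed linear span of the variables \<open>B t\<close> in mean square, as a set of
  functions and not of classes; membership is phrased by approximation with finite linear
  combinations.\<close>

definition gauss_closure :: "'a measure \<Rightarrow> (real \<Rightarrow> 'a \<Rightarrow> real) \<Rightarrow> ('a \<Rightarrow> real) set" where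
  "gauss_closure M B = {Z. sq_int M Z \<and>
     (\<forall>\<epsilon>>0. \<exists>F c. finite F \<and> F \<subseteq> {0..} \<and> (\<integral>\<omega>. (Z \<omega> - (\<Sum>t\<in>F. c t * B t \<omega>))\<^sup>2 \<partial>M) < \<epsilon>)}"

context
  fixes M :: "'a measure" and B :: "real \<Rightarrow> 'a \<Rightarrow> real"
  assumes B: "\<And>t. 0 \<le> t \<Longrightarrow> sq_int M (B t)"
begin

lemma sq_int_span: "F \<subseteq> {0..} \<Longrightarrow> sq_int M (\<lambda>\<omega>. \<Sum>t\<in>F. c t * B t \<omega>)"
  using B by (intro sq_int_sum sq_int_scale) auto

lemma gauss_closure_sq_int: "Z \<in> gauss_closure M B \<Longrightarrow> sq_int M Z"
  by (simp add: gauss_closure_def)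

lemma gauss_closure_approx:
  assumes "Z \<in> gauss_closure M B" "0 < \<epsilon>"
  obtains F c where "finite F" "F \<subseteq> {0..}" "(\<integral>\<omega>. (Z \<omega> - (\<Sum>t\<in>F. c t * B t \<omega>))\<^sup>2 \<partial>M) < \<epsilon>"
  using assms unfolding gauss_closure_def by blast

lemma gauss_closure_base:
  assumes "0 \<le> t"
  shows "B t \<in> gauss_closure M B"
proof -
  have "\<exists>F c. finite F \<and> F \<subseteq> {0..} \<and> (\<integral>\<omega>. (B t \<omega> - (\<Sum>t\<in>F. c t * B t \<omega>))\<^sup>2 \<partial>M) < \<epsilon>" if "0 < \<epsilon>" for \<epsilon>
    by (rule exI[of _ "{t}"], rule exI[of _ "\<lambda>_. 1"]) (use assms that in simp)
  then show ?thesis using B[OF assms] by (simp add: gauss_closure_def)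
qed

lemma gauss_closure_scale:
  assumes Z: "Z \<in> gauss_closure M B"
  shows "(\<lambda>\<omega>. a * Z \<omega>) \<in> gauss_closure M B"
proof -
  have "\<exists>F c. finite F \<and> F \<subseteq> {0..} \<and> (\<integral>\<omega>. (a * Z \<omega> - (\<Sum>t\<in>F. c t * B t \<omega>))\<^sup>2 \<partial>M) < \<epsilon>" if e: "0 < \<epsilon>" for \<epsilon>
  proof -
    have a1: "0 < a\<^sup>2 + 1" by (simp add: add_nonneg_pos)
    then have "0 < \<epsilon> / (a\<^sup>2 + 1)" using e by simp
    then obtain F c where F: "finite F" "F \<subseteq> {0..}" "(\<integral>\<omega>. (Z \<omega> - (\<Sum>t\<in>F. c t * B t \<omega>))\<^sup>2 \<partial>M) < \<epsilon> / (a\<^sup>2 + 1)"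
      using gauss_closure_approx[OF Z] by blast
    have "(\<integral>\<omega>. (a * Z \<omega> - (\<Sum>t\<in>F. (a * c t) * B t \<omega>))\<^sup>2 \<partial>M) = (\<integral>\<omega>. a\<^sup>2 * (Z \<omega> - (\<Sum>t\<in>F. c t * B t \<omega>))\<^sup>2 \<partial>M)"
      by (simp add: power_mult_distrib[symmetric] right_diff_distrib sum_distrib_left mult.assoc)
    also have "\<dots> = a\<^sup>2 * (\<integral>\<omega>. (Z \<omega> - (\<Sum>t\<in>F. c t * B t \<omega>))\<^sup>2 \<partial>M)" by (rule integral_mult_right_zero)
    also have "\<dots> \<le> (a\<^sup>2 + 1) * (\<integral>\<omega>. (Z \<omega> - (\<Sum>t\<in>F. c t * B t \<omega>))\<^sup>2 \<partial>M)" by (intro mult_right_mono) auto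
    also have "\<dots> < \<epsilon>" using F(3) a1 by (simp add: pos_less_divide_eq mult.commute)
    finally show ?thesis using F by (intro exI[of _ F] exI[of _ "\<lambda>t. a * c t"] conjI)
  qed
  then show ?thesis using sq_int_scale[OF gauss_closure_sq_int[OF Z]] by (simp add: gauss_closure_def)
qed

lemma gauss_closure_add:
  assumes Z: "Z \<in> gauss_closure M B" and Y: "Y \<in> gauss_closure M B"
  shows "(\<lambda>\<omega>. Z \<omega> + Y \<omega>) \<in> gauss_closure M B"
proof -
  note iZ = gauss_closure_sq_int[OF Z] and iY = gauss_closure_sq_int[OF Y]
  have "\<exists>F c. finite F \<and> F \<subseteq> {0..} \<and> (\<integral>\<omega>. (Z \<omega> + Y \<omega> - (\<Sum>t\<in>F. c t * B t \<omega>))\<^sup>2 \<partial>M) < \<epsilon>" if e: "0 < \<epsilon>" for \<epsilon>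
  proof -
    have e4: "0 < \<epsilon> / 4" using e by simp
    obtain F c where F: "finite F" "F \<subseteq> {0..}" "(\<integral>\<omega>. (Z \<omega> - (\<Sum>t\<in>F. c t * B t \<omega>))\<^sup>2 \<partial>M) < \<epsilon> / 4"
      using gauss_closure_approx[OF Z e4] by blast
    obtain G d where G: "finite G" "G \<subseteq> {0..}" "(\<integral>\<omega>. (Y \<omega> - (\<Sum>t\<in>G. d t * B t \<omega>))\<^sup>2 \<partial>M) < \<epsilon> / 4"
      using gauss_closure_approx[OF Y e4] by blast
    define c' where "c' t = (if t \<in> F then c t else 0)" for t
    define d' where "d' t = (if t \<in> G then d t else 0)" for t
    have c': "(\<Sum>t\<in>F \<union> G. c' t * B t \<omega>) = (\<Sum>t\<in>F. c t * B t \<omega>)" for \<omega>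
      using F(1) G(1) by (intro sum.mono_neutral_cong_right) (auto simp: c'_def)
    have d': "(\<Sum>t\<in>F \<union> G. d' t * B t \<omega>) = (\<Sum>t\<in>G. d t * B t \<omega>)" for \<omega>
      using F(1) G(1) by (intro sum.mono_neutral_cong_right) (auto simp: d'_def)
    define P where "P \<omega> = (\<Sum>t\<in>F. c t * B t \<omega>)" for \<omega>
    define Q where "Q \<omega> = (\<Sum>t\<in>G. d t * B t \<omega>)" for \<omega>
    have iP: "sq_int M P" and iQ: "sq_int M Q" unfolding P_def[abs_def] Q_def[abs_def] using F G by (auto intro: sq_int_span)
    have i1: "sq_int M (\<lambda>\<omega>. Z \<omega> + Y \<omega>)" "sq_int M (\<lambda>\<omega>. P \<omega> + Y \<omega>)" "sq_int M (\<lambda>\<omega>. P \<omega> + Q \<omega>)"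
      by (intro sq_int_add iZ iY iP iQ)+
    have eq: "(\<Sum>t\<in>F \<union> G. (c' t + d' t) * B t \<omega>) = P \<omega> + Q \<omega>" for \<omega>
      by (simp add: distrib_right sum.distrib c' d' P_def Q_def)
    have "(\<integral>\<omega>. (Z \<omega> + Y \<omega> - (P \<omega> + Q \<omega>))\<^sup>2 \<partial>M)
        \<le> 2 * (\<integral>\<omega>. (Z \<omega> + Y \<omega> - (P \<omega> + Y \<omega>))\<^sup>2 \<partial>M) + 2 * (\<integral>\<omega>. (P \<omega> + Y \<omega> - (P \<omega> + Q \<omega>))\<^sup>2 \<partial>M)"
      by (rule expectation_sq_triangle[OF i1])
    also have "\<dots> < \<epsilon>" using F(3) G(3) by (simp add: P_def Q_def)
    finally have "(\<integral>\<omega>. (Z \<omega> + Y \<omega> - (\<Sum>t\<in>F \<union> G. (c' t + d' t) * B t \<omega>))\<^sup>2 \<partial>M) < \<epsilon>" unfolding eq .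
    moreover have "finite (F \<union> G)" "F \<union> G \<subseteq> {0..}" using F G by auto
    ultimately show ?thesis by (intro exI[of _ "F \<union> G"] exI[of _ "\<lambda>t. c' t + d' t"] conjI)
  qed
  then show ?thesis using sq_int_add[OF iZ iY] by (simp add: gauss_closure_def)
qed

lemma gauss_closure_sum:
  "finite I \<Longrightarrow> (\<And>i. i \<in> I \<Longrightarrow> Z i \<in> gauss_closure M B) \<Longrightarrow> (\<lambda>\<omega>. \<Sum>i\<in>I. Z i \<omega>) \<in> gauss_closure M B"
proof (induction I rule: finite_induct)
  case empty
  show ?case using gauss_closure_scale[OF gauss_closure_base[of 0], of 0] by simp
qed (auto intro: gauss_closure_add)

lemma gauss_closure_lim:
  assumes lim: "L2_lim M S Z" and S: "\<And>n. S n \<in> gauss_closure M B"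
  shows "Z \<in> gauss_closure M B"
proof -
  have iZ: "sq_int M Z" using lim by (simp add: L2_lim_def)
  have "\<exists>F c. finite F \<and> F \<subseteq> {0..} \<and> (\<integral>\<omega>. (Z \<omega> - (\<Sum>t\<in>F. c t * B t \<omega>))\<^sup>2 \<partial>M) < \<epsilon>" if e: "0 < \<epsilon>" for \<epsilon>
  proof -
    have e4: "0 < \<epsilon> / 4" using e by simp
    have "(\<lambda>n. \<integral>\<omega>. (S n \<omega> - Z \<omega>)\<^sup>2 \<partial>M) \<longlonglongrightarrow> 0" using lim by (simp add: L2_lim_def)
    from order_tendstoD(2)[OF this e4] obtain n where n: "(\<integral>\<omega>. (S n \<omega> - Z \<omega>)\<^sup>2 \<partial>M) < \<epsilon> / 4"
      by (auto simp: eventually_sequentially)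
    obtain F c where F: "finite F" "F \<subseteq> {0..}" "(\<integral>\<omega>. (S n \<omega> - (\<Sum>t\<in>F. c t * B t \<omega>))\<^sup>2 \<partial>M) < \<epsilon> / 4"
      using gauss_closure_approx[OF S e4] by blast
    have "(\<integral>\<omega>. (Z \<omega> - (\<Sum>t\<in>F. c t * B t \<omega>))\<^sup>2 \<partial>M)
        \<le> 2 * (\<integral>\<omega>. (Z \<omega> - S n \<omega>)\<^sup>2 \<partial>M) + 2 * (\<integral>\<omega>. (S n \<omega> - (\<Sum>t\<in>F. c t * B t \<omega>))\<^sup>2 \<partial>M)"
      by (rule expectation_sq_triangle[OF iZ gauss_closure_sq_int[OF S] sq_int_span[OF F(2)]])
    also have "(\<integral>\<omega>. (Z \<omega> - S n \<omega>)\<^sup>2 \<partial>M) = (\<integral>\<omega>. (S n \<omega> - Z \<omega>)\<^sup>2 \<partial>M)"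
      by (subst power2_commute) (rule refl)
    finally have "(\<integral>\<omega>. (Z \<omega> - (\<Sum>t\<in>F. c t * B t \<omega>))\<^sup>2 \<partial>M) < \<epsilon>" using n F(3) by linarith
    then show ?thesis using F by (intro exI[of _ F] exI[of _ c] conjI)
  qed
  then show ?thesis using iZ by (simp add: gauss_closure_def)
qed

lemma gauss_closure_cong_AE:
  assumes Z: "Z \<in> gauss_closure M B" and Y: "Y \<in> borel_measurable M" and eq: "AE \<omega> in M. Y \<omega> = Z \<omega>"
  shows "Y \<in> gauss_closure M B"
proof (rule gauss_closure_lim[of "\<lambda>_. Z"])
  have iZ: "sq_int M Z" by (rule gauss_closure_sq_int[OF Z])
  have iY: "sq_int M Y" by (rule sq_int_cong_AE[OF iZ Y eq])
  have "(\<integral>\<omega>. (Z \<omega> - Y \<omega>)\<^sup>2 \<partial>M) = 0"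
    by (rule integral_eq_zero_AE) (use eq in eventually_elim, simp)
  then show "L2_lim M (\<lambda>_. Z) Y" using iZ iY by (simp add: L2_lim_def)
qed (rule Z)

end

lemma cmod_iexp_diff_le: "cmod (iexp x - iexp y) \<le> \<bar>x - y\<bar>"
proof -
  have "iexp x - iexp y = iexp y * (iexp (x - y) - 1)"
    by (simp add: right_diff_distrib exp_add[symmetric] algebra_simps)
  then have "cmod (iexp x - iexp y) = cmod (iexp (x - y) - 1)" by (simp add: norm_mult)
  also have "\<dots> \<le> \<bar>x - y\<bar>" using iexp_approx1[of "x - y" 0] by simp
  finally show ?thesis .
qed

text \<open>The complex exponential is 1-Lipschitz on the imaginary axis, so characteristic
  functions differ by at most the first absolute moment, hence by at most the distance in mean
  square.\<close>

lemma (in prob_space) L2_lim_iexp: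
  assumes lim: "L2_lim M S Z"
  shows "(\<lambda>n. CLINT \<omega>|M. iexp (S n \<omega>)) \<longlonglongrightarrow> (CLINT \<omega>|M. iexp (Z \<omega>))"
proof -
  have i: "sq_int M (S n)" "sq_int M Z" for n using lim by (auto simp: L2_lim_def)
  have [measurable]: "S n \<in> borel_measurable M" "Z \<in> borel_measurable M" for n using i by (auto simp: sq_int_def)
  have int: "integrable M (\<lambda>\<omega>. iexp (S n \<omega>))" "integrable M (\<lambda>\<omega>. iexp (Z \<omega>))" for n
    by (auto intro!: integrable_const_bound[of _ 1])
  have le: "cmod ((CLINT \<omega>|M. iexp (S n \<omega>)) - (CLINT \<omega>|M. iexp (Z \<omega>))) \<le> sqrt (\<integral>\<omega>. (S n \<omega> - Z \<omega>)\<^sup>2 \<partial>M)" for n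
  proof -
    have d: "sq_int M (\<lambda>\<omega>. S n \<omega> - Z \<omega>)" by (intro sq_int_diff i)
    then have a: "sq_int M (\<lambda>\<omega>. \<bar>S n \<omega> - Z \<omega>\<bar>)" by (auto simp: sq_int_def)
    have "(\<integral>\<omega>. \<bar>S n \<omega> - Z \<omega>\<bar> * 1 \<partial>M)\<^sup>2 \<le> (\<integral>\<omega>. \<bar>S n \<omega> - Z \<omega>\<bar>\<^sup>2 \<partial>M) * (\<integral>\<omega>. 1\<^sup>2 \<partial>M)"
      by (rule sq_int_Cauchy_Schwarz[OF a sq_int_const])
    then have "(\<integral>\<omega>. \<bar>S n \<omega> - Z \<omega>\<bar> \<partial>M)\<^sup>2 \<le> (\<integral>\<omega>. (S n \<omega> - Z \<omega>)\<^sup>2 \<partial>M)" by (simp add: prob_space)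
    then have "(\<integral>\<omega>. \<bar>S n \<omega> - Z \<omega>\<bar> \<partial>M) \<le> sqrt (\<integral>\<omega>. (S n \<omega> - Z \<omega>)\<^sup>2 \<partial>M)" by (rule real_le_rsqrt)
    moreover have "cmod ((CLINT \<omega>|M. iexp (S n \<omega>)) - (CLINT \<omega>|M. iexp (Z \<omega>))) \<le> (\<integral>\<omega>. \<bar>S n \<omega> - Z \<omega>\<bar> \<partial>M)"
    proof -
      have "(CLINT \<omega>|M. iexp (S n \<omega>)) - (CLINT \<omega>|M. iexp (Z \<omega>)) = (CLINT \<omega>|M. iexp (S n \<omega>) - iexp (Z \<omega>))"
        using int by (rule Bochner_Integration.integral_diff[symmetric])
      also have "cmod \<dots> \<le> (\<integral>\<omega>. cmod (iexp (S n \<omega>) - iexp (Z \<omega>)) \<partial>M)" by (rule integral_norm_bound)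
      also have "\<dots> \<le> (\<integral>\<omega>. \<bar>S n \<omega> - Z \<omega>\<bar> \<partial>M)"
        using int sq_int_integrable[OF a] cmod_iexp_diff_le
        by (intro Bochner_Integration.integral_mono integrable_norm Bochner_Integration.integrable_diff) auto
      finally show ?thesis .
    qed
    ultimately show ?thesis by linarith
  qed
  have "(\<lambda>n. sqrt (\<integral>\<omega>. (S n \<omega> - Z \<omega>)\<^sup>2 \<partial>M)) \<longlonglongrightarrow> sqrt 0"
    using lim by (intro tendsto_real_sqrt) (simp add: L2_lim_def)
  then have "(\<lambda>n. (CLINT \<omega>|M. iexp (S n \<omega>)) - (CLINT \<omega>|M. iexp (Z \<omega>))) \<longlonglongrightarrow> 0"
    by (intro Lim_null_comparison[OF always_eventually[OF allI[OF le]]]) simp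
  then show ?thesis by (simp add: LIM_zero_iff)
qed

text \<open>Both sides are continuous in \<open>Z\<close> with respect to mean-square convergence,
  so the Gaussian form passes from finite combinations to the closure. A degenerate \<open>Z\<close>
  is covered as well.\<close>

lemma (in prob_space) gauss_closure_char:
  assumes B: "\<And>t. 0 \<le> t \<Longrightarrow> sq_int M (B t)"
    and span: "\<And>F c. finite F \<Longrightarrow> F \<subseteq> {0..} \<Longrightarrow>
      (CLINT \<omega>|M. iexp (\<Sum>t\<in>F. c t * B t \<omega>)) = of_real (exp (- (\<integral>\<omega>. (\<Sum>t\<in>F. c t * B t \<omega>)\<^sup>2 \<partial>M) / 2))"
    and Z: "Z \<in> gauss_closure M B"
  shows "(CLINT \<omega>|M. iexp (Z \<omega>)) = of_real (exp (- (\<integral>\<omega>. (Z \<omega>)\<^sup>2 \<partial>M) / 2))"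
proof -
  have 1: "\<forall>n. \<exists>F c. finite F \<and> F \<subseteq> {0..} \<and> (\<integral>\<omega>. (Z \<omega> - (\<Sum>t\<in>F. c t * B t \<omega>))\<^sup>2 \<partial>M) < inverse (real (Suc n))"
    using Z unfolding gauss_closure_def by simp
  from choice[OF 1] obtain F where 2: "\<forall>n. \<exists>c. finite (F n) \<and> F n \<subseteq> {0..} \<and>
      (\<integral>\<omega>. (Z \<omega> - (\<Sum>t\<in>F n. c t * B t \<omega>))\<^sup>2 \<partial>M) < inverse (real (Suc n))" ..
  from choice[OF 2] obtain c where 3: "\<forall>n. finite (F n) \<and> F n \<subseteq> {0..} \<and>
      (\<integral>\<omega>. (Z \<omega> - (\<Sum>t\<in>F n. c n t * B t \<omega>))\<^sup>2 \<partial>M) < inverse (real (Suc n))" ..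
  note F = conjunct1[OF spec[OF 3]] conjunct1[OF conjunct2[OF spec[OF 3]]] conjunct2[OF conjunct2[OF spec[OF 3]]]
  define S where "S n \<omega> = (\<Sum>t\<in>F n. c n t * B t \<omega>)" for n \<omega>
  have iS: "sq_int M (S n)" for n unfolding S_def[abs_def] using F B by (intro sq_int_span) auto
  have iZ: "sq_int M Z" using Z by (simp add: gauss_closure_def)
  have "(\<lambda>n. \<integral>\<omega>. (S n \<omega> - Z \<omega>)\<^sup>2 \<partial>M) \<longlonglongrightarrow> 0"
  proof (rule Lim_null_comparison[OF always_eventually[OF allI]])
    show "norm (\<integral>\<omega>. (S n \<omega> - Z \<omega>)\<^sup>2 \<partial>M) \<le> inverse (real (Suc n))" for n
    proof -
      have "(\<integral>\<omega>. (S n \<omega> - Z \<omega>)\<^sup>2 \<partial>M) = (\<integral>\<omega>. (Z \<omega> - S n \<omega>)\<^sup>2 \<partial>M)" by (subst power2_commute) (rule refl)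
      then show ?thesis using F(3)[of n] by (simp add: S_def del: of_nat_Suc)
    qed
  qed (rule LIMSEQ_inverse_real_of_nat)
  then have lim: "L2_lim M S Z" using iS iZ by (simp add: L2_lim_def)
  have "(CLINT \<omega>|M. iexp (S n \<omega>)) = of_real (exp (- (\<integral>\<omega>. (S n \<omega>)\<^sup>2 \<partial>M) / 2))" for n
    unfolding S_def using F by (intro span) auto
  moreover have "(\<lambda>n. of_real (exp (- (\<integral>\<omega>. (S n \<omega>)\<^sup>2 \<partial>M) / 2)) :: complex) \<longlonglongrightarrow> of_real (exp (- (\<integral>\<omega>. (Z \<omega>)\<^sup>2 \<partial>M) / 2))"
    by (intro tendsto_of_real tendsto_exp tendsto_divide tendsto_minus L2_lim_sq[OF lim] tendsto_const) simp
  ultimately have "(\<lambda>n. CLINT \<omega>|M. iexp (S n \<omega>)) \<longlonglongrightarrow> of_real (exp (- (\<integral>\<omega>. (Z \<omega>)\<^sup>2 \<partial>M) / 2))"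
    by (simp only:)
  then show ?thesis using LIMSEQ_unique[OF L2_lim_iexp[OF lim]] by blast
qed

lemma char_distr_1:
  assumes "f \<in> borel_measurable M"
  shows "char (distr M borel f) 1 = (CLINT \<omega>|M. iexp (f \<omega>))"
proof -
  have "(\<lambda>x. iexp (1 * x)) \<in> borel_measurable borel" by measurable
  from integral_distr[OF assms this] show ?thesis by (simp add: char_def)
qed

lemma (in prob_space) normal_second_moment:
  assumes D: "distributed M lborel X (normal_density 0 \<sigma>)" and \<sigma>: "0 < \<sigma>"
  shows "sq_int M X" "expectation X = 0" "expectation (\<lambda>\<omega>. (X \<omega>)\<^sup>2) = \<sigma>\<^sup>2"
    "(CLINT \<omega>|M. iexp (u * X \<omega>)) = of_real (exp (- u\<^sup>2 * \<sigma>\<^sup>2 / 2))"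
proof -
  have [measurable]: "X \<in> borel_measurable M" using distributed_measurable[OF D] by simp
  have "integrable lborel (\<lambda>x. normal_density 0 \<sigma> x * x\<^sup>2)"
    using integrable_normal_moment[OF \<sigma>, of 0 2] by simp
  then have "integrable M (\<lambda>\<omega>. (X \<omega>)\<^sup>2)"
    using distributed_integrable[OF D, of "\<lambda>x. x\<^sup>2"] by simp
  then show "sq_int M X" by (simp add: sq_int_def)
  show E: "expectation X = 0" by (rule normal_distributed_expectation[OF \<sigma> D])
  show "expectation (\<lambda>\<omega>. (X \<omega>)\<^sup>2) = \<sigma>\<^sup>2" using normal_distributed_variance[OF \<sigma> D] E by simp
  have S: "distributed M lborel (\<lambda>\<omega>. (X \<omega> - 0) / \<sigma>) std_normal_density"
    using D normal_standard_normal_convert[OF \<sigma>, of X 0] by blast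
  have "distr M lborel (\<lambda>\<omega>. (X \<omega> - 0) / \<sigma>) = std_normal_distribution"
    by (rule distributed_distr_eq_density[OF S])
  then have "(CLINT x|distr M lborel (\<lambda>\<omega>. (X \<omega> - 0) / \<sigma>). iexp ((u * \<sigma>) * x)) = char std_normal_distribution (u * \<sigma>)"
    by (simp only: char_def)
  moreover have "(CLINT x|distr M lborel (\<lambda>\<omega>. (X \<omega> - 0) / \<sigma>). iexp ((u * \<sigma>) * x)) = (CLINT \<omega>|M. iexp ((u * \<sigma>) * ((X \<omega> - 0) / \<sigma>)))"
    by (rule integral_distr) measurable
  moreover have "(u * \<sigma>) * ((X \<omega> - 0) / \<sigma>) = u * X \<omega>" for \<omega> using \<sigma> by simp
  ultimately show "(CLINT \<omega>|M. iexp (u * X \<omega>)) = of_real (exp (- u\<^sup>2 * \<sigma>\<^sup>2 / 2))"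
    by (simp add: char_std_normal_distribution power_mult_distrib)
qed

section \<open>Gaussian law and covariance of the Wiener process\<close>

locale wiener =
  fixes M :: "'a measure" and B :: "real \<Rightarrow> 'a \<Rightarrow> real"
  assumes W: "wiener_process M B"
begin

sublocale prob_space M using W by (simp add: wiener_process_def)

lemma B_measurable [measurable]: "0 \<le> t \<Longrightarrow> B t \<in> borel_measurable M"
  using W by (simp add: wiener_process_def)

lemma B_0: "AE \<omega> in M. B 0 \<omega> = 0"
  using W by (simp add: wiener_process_def)

lemma B_incr: "0 \<le> s \<Longrightarrow> s < t \<Longrightarrow> distributed M lborel (\<lambda>\<omega>. B t \<omega> - B s \<omega>) (normal_density 0 (sqrt (t - s)))"
  using W unfolding wiener_process_def by blast

lemma B_indep: "0 \<le> \<tau> 0 \<Longrightarrow> incseq \<tau> \<Longrightarrow> indep_vars (\<lambda>_. borel) (\<lambda>i \<omega>. B (\<tau> (Suc i)) \<omega> - B (\<tau> i) \<omega>) {..<n::nat}"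
  using W unfolding wiener_process_def by blast

lemma B_continuous: "AE \<omega> in M. continuous_on {0..} (\<lambda>t. B t \<omega>)"
  using W by (simp add: wiener_process_def)

lemma sq_int_incr:
  assumes "0 \<le> s" "s \<le> t"
  shows "sq_int M (\<lambda>\<omega>. B t \<omega> - B s \<omega>)" "expectation (\<lambda>\<omega>. B t \<omega> - B s \<omega>) = 0"
    "expectation (\<lambda>\<omega>. (B t \<omega> - B s \<omega>)\<^sup>2) = t - s"
    "(CLINT \<omega>|M. iexp (u * (B t \<omega> - B s \<omega>))) = of_real (exp (- u\<^sup>2 * (t - s) / 2))"
proof -
  have "sq_int M (\<lambda>\<omega>. B t \<omega> - B s \<omega>) \<and> expectation (\<lambda>\<omega>. B t \<omega> - B s \<omega>) = 0 \<and>
    expectation (\<lambda>\<omega>. (B t \<omega> - B s \<omega>)\<^sup>2) = t - s \<and>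
    (CLINT \<omega>|M. iexp (u * (B t \<omega> - B s \<omega>))) = of_real (exp (- u\<^sup>2 * (t - s) / 2))"
  proof (cases "s = t")
    \<comment> \<open>A normal density needs positive variance, so the constant increment is treated
      apart.\<close>
    case True
    then show ?thesis by (simp add: sq_int_0 prob_space)
  next
    case False
    then have st: "s < t" using assms by simp
    then have \<sigma>: "0 < sqrt (t - s)" "(sqrt (t - s))\<^sup>2 = t - s" by simp_all
    show ?thesis
      using normal_second_moment[OF B_incr[OF assms(1) st] \<sigma>(1)] unfolding \<sigma>(2) by blast
  qed
  then show "sq_int M (\<lambda>\<omega>. B t \<omega> - B s \<omega>)" "expectation (\<lambda>\<omega>. B t \<omega> - B s \<omega>) = 0"
    "expectation (\<lambda>\<omega>. (B t \<omega> - B s \<omega>)\<^sup>2) = t - s"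
    "(CLINT \<omega>|M. iexp (u * (B t \<omega> - B s \<omega>))) = of_real (exp (- u\<^sup>2 * (t - s) / 2))"
    by blast+
qed

lemma B_eq_incr: "AE \<omega> in M. B t \<omega> = B t \<omega> - B 0 \<omega>"
  using B_0 by eventually_elim simp

lemma sq_int_B: "0 \<le> t \<Longrightarrow> sq_int M (B t)"
  by (rule sq_int_cong_AE[OF sq_int_incr(1)[of 0 t] _ B_eq_incr]) auto

lemma expectation_B:
  assumes "0 \<le> t"
  shows "expectation (B t) = 0"
proof -
  have "expectation (B t) = expectation (\<lambda>\<omega>. B t \<omega> - B 0 \<omega>)"
    using B_eq_incr assms by (intro integral_cong_AE) auto
  then show ?thesis using sq_int_incr(2)[of 0 t] assms by simp
qed

lemma covariance_B_le:
  assumes s: "0 \<le> s" and t: "s \<le> t"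
  shows "expectation (\<lambda>\<omega>. B s \<omega> * B t \<omega>) = s"
proof -
  \<comment> \<open>Independence of increments is formulated along infinite increasing sequences;
    the times \<open>0, s, t\<close> are continued by the constant \<open>t\<close>.\<close>
  define \<tau> :: "nat \<Rightarrow> real" where "\<tau> i = (if i = 0 then 0 else if i = 1 then s else t)" for i
  have inc: "incseq \<tau>" using s t by (auto simp: incseq_Suc_iff \<tau>_def)
  let ?D = "\<lambda>i \<omega>. B (\<tau> (Suc i)) \<omega> - B (\<tau> i) \<omega>"
  have ind: "indep_vars (\<lambda>_. borel) ?D {..<2}" by (rule B_indep[OF _ inc]) (simp add: \<tau>_def)
  have iD: "sq_int M (?D i)" for i using s t by (intro sq_int_incr) (auto simp: \<tau>_def)
  have "expectation (\<lambda>\<omega>. \<Prod>i<2. ?D i \<omega>) = (\<Prod>i<2. expectation (?D i))"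
    using ind sq_int_integrable[OF iD] by (intro indep_vars_lebesgue_integral) auto
  also have "\<dots> = 0" using sq_int_incr(2)[of s t] s t by (simp add: \<tau>_def lessThan_nat_numeral numeral_2_eq_2 lessThan_Suc)
  finally have D0: "expectation (\<lambda>\<omega>. (B s \<omega> - B 0 \<omega>) * (B t \<omega> - B s \<omega>)) = 0"
    by (simp add: \<tau>_def numeral_2_eq_2 lessThan_Suc mult.commute)
  have i0: "sq_int M (\<lambda>\<omega>. B s \<omega> - B 0 \<omega>)" and i1: "sq_int M (\<lambda>\<omega>. B t \<omega> - B s \<omega>)"
    using s t by (auto intro: sq_int_incr)
  have [measurable]: "B s \<in> borel_measurable M" "B t \<in> borel_measurable M" "B 0 \<in> borel_measurable M" using s t by auto
  have "expectation (\<lambda>\<omega>. B s \<omega> * B t \<omega>)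
      = expectation (\<lambda>\<omega>. (B s \<omega> - B 0 \<omega>)\<^sup>2 + (B s \<omega> - B 0 \<omega>) * (B t \<omega> - B s \<omega>))"
  proof (rule integral_cong_AE)
    show "AE \<omega> in M. B s \<omega> * B t \<omega> = (B s \<omega> - B 0 \<omega>)\<^sup>2 + (B s \<omega> - B 0 \<omega>) * (B t \<omega> - B s \<omega>)"
      using B_0 by eventually_elim (simp add: power2_eq_square right_diff_distrib)
  qed measurable
  also have "\<dots> = s + 0"
    using sq_int_mult[OF i0 i1] sq_int_sq[OF i0] sq_int_incr(3)[of 0 s] s D0 by simp
  finally show ?thesis by simp
qed

lemma covariance_B:
  assumes "0 \<le> s" "0 \<le> t"
  shows "expectation (\<lambda>\<omega>. B s \<omega> * B t \<omega>) = min s t"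
proof (cases "s \<le> t")
  case False
  then show ?thesis using covariance_B_le[of t s] assms by (simp add: mult.commute)
qed (use covariance_B_le assms in simp)

lemma covariance_incr:
  assumes "0 \<le> s" "s \<le> s'" "s' \<le> t" "t \<le> t'"
  shows "expectation (\<lambda>\<omega>. (B s' \<omega> - B s \<omega>) * (B t' \<omega> - B t \<omega>)) = 0"
proof -
  have i: "integrable M (\<lambda>\<omega>. B x \<omega> * B y \<omega>)" if "x \<in> {s, s'}" "y \<in> {t, t'}" for x y
    using that assms by (intro sq_int_mult sq_int_B) auto
  have "expectation (\<lambda>\<omega>. (B s' \<omega> - B s \<omega>) * (B t' \<omega> - B t \<omega>))
    = expectation (\<lambda>\<omega>. (B s' \<omega> * B t' \<omega> - B s' \<omega> * B t \<omega>) - (B s \<omega> * B t' \<omega> - B s \<omega> * B t \<omega>))"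
    by (rule Bochner_Integration.integral_cong) (simp_all add: algebra_simps)
  also have "\<dots> = (s' - s') - (s - s)"
    using i covariance_B_le[of s' t'] covariance_B_le[of s' t] covariance_B_le[of s t'] covariance_B_le[of s t] assms
    by simp
  finally show ?thesis by simp
qed

text \<open>Independence multiplies the normal characteristic functions of the increments, which
  adds the exponents; the same sum is the second moment of \<open>Z\<close> because distinct
  increments are uncorrelated.\<close>

lemma char_independent_increments:
  fixes \<tau> :: "nat \<Rightarrow> real" and d :: "nat \<Rightarrow> real" and n :: nat
  assumes \<tau>0: "0 \<le> \<tau> 0" and inc: "incseq \<tau>"
  defines "Z \<equiv> \<lambda>\<omega>. \<Sum>i<n. d i * (B (\<tau> (Suc i)) \<omega> - B (\<tau> i) \<omega>)"
  shows "(CLINT \<omega>|M. iexp (Z \<omega>)) = of_real (exp (- expectation (\<lambda>\<omega>. (Z \<omega>)\<^sup>2) / 2))"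
proof -
  let ?D = "\<lambda>i \<omega>. B (\<tau> (Suc i)) \<omega> - B (\<tau> i) \<omega>"
  have \<tau>_nn: "0 \<le> \<tau> i" for i using incseqD[OF inc, of 0 i] \<tau>0 by simp
  have \<tau>_le: "\<tau> i \<le> \<tau> j" if "i \<le> j" for i j using incseqD[OF inc that] .
  have [measurable]: "B (\<tau> i) \<in> borel_measurable M" for i using \<tau>_nn by simp
  have iD: "sq_int M (?D i)" for i using \<tau>_nn \<tau>_le by (intro sq_int_incr) auto
  have ind: "indep_vars (\<lambda>_. borel) ?D {..<n}" by (rule B_indep[OF \<tau>0 inc])
  have ind': "indep_vars (\<lambda>_. borel) (\<lambda>i \<omega>. d i * ?D i \<omega>) {..<n}"
    by (rule indep_vars_compose2[OF ind, where Y = "\<lambda>i x. d i * x"]) measurable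
  have Dm: "?D i \<in> borel_measurable M" for i by (rule sq_int_measurable[OF iD])
  have "(CLINT \<omega>|M. iexp (Z \<omega>)) = char (distr M borel Z) 1"
    unfolding Z_def
    by (intro char_distr_1[symmetric] borel_measurable_sum borel_measurable_times borel_measurable_const Dm)
  also have "\<dots> = (\<Prod>i<n. char (distr M borel (\<lambda>\<omega>. d i * ?D i \<omega>)) 1)"
    unfolding Z_def by (rule char_distr_sum[OF ind'])
  also have "\<dots> = (\<Prod>i<n. of_real (exp (- (d i)\<^sup>2 * (\<tau> (Suc i) - \<tau> i) / 2)))"
  proof (rule prod.cong)
    fix i assume "i \<in> {..<n}"
    have "char (distr M borel (\<lambda>\<omega>. d i * ?D i \<omega>)) 1 = (CLINT \<omega>|M. iexp (d i * ?D i \<omega>))"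
      by (intro char_distr_1 borel_measurable_times borel_measurable_const Dm)
    also have "\<dots> = of_real (exp (- (d i)\<^sup>2 * (\<tau> (Suc i) - \<tau> i) / 2))"
      using \<tau>_nn \<tau>_le by (intro sq_int_incr) auto
    finally show "char (distr M borel (\<lambda>\<omega>. d i * ?D i \<omega>)) 1 = of_real (exp (- (d i)\<^sup>2 * (\<tau> (Suc i) - \<tau> i) / 2))" .
  qed simp
  also have "\<dots> = of_real (exp (\<Sum>i<n. - (d i)\<^sup>2 * (\<tau> (Suc i) - \<tau> i) / 2))"
    by (simp add: exp_sum)
  also have "(\<Sum>i<n. - (d i)\<^sup>2 * (\<tau> (Suc i) - \<tau> i) / 2) = - expectation (\<lambda>\<omega>. (Z \<omega>)\<^sup>2) / 2"
  proof -
    have DD: "expectation (\<lambda>\<omega>. ?D i \<omega> * ?D j \<omega>) = (if i = j then \<tau> (Suc i) - \<tau> i else 0)" for i j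
    proof -
      consider "i = j" | "i < j" | "j < i" by linarith
      then show ?thesis
      proof cases
        case 1
        then show ?thesis using sq_int_incr(3)[of "\<tau> i" "\<tau> (Suc i)"] \<tau>_nn \<tau>_le by (simp add: power2_eq_square)
      next
        case 2
        then show ?thesis using \<tau>_nn \<tau>_le by (simp add: covariance_incr)
      next
        case 3
        then have "expectation (\<lambda>\<omega>. ?D j \<omega> * ?D i \<omega>) = 0" using \<tau>_nn \<tau>_le by (intro covariance_incr) auto
        then show ?thesis using 3 by (simp add: mult.commute)
      qed
    qed
    have int: "integrable M (\<lambda>\<omega>. d i * d j * (?D i \<omega> * ?D j \<omega>))" for i j
      by (intro integrable_mult_right sq_int_mult iD)
    have "expectation (\<lambda>\<omega>. (Z \<omega>)\<^sup>2) = expectation (\<lambda>\<omega>. \<Sum>i<n. \<Sum>j<n. d i * d j * (?D i \<omega> * ?D j \<omega>))"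
      unfolding Z_def power2_eq_square sum_product by (simp only: mult_ac)
    also have "\<dots> = (\<Sum>i<n. \<Sum>j<n. d i * d j * (if i = j then \<tau> (Suc i) - \<tau> i else 0))"
      using int by (simp add: Bochner_Integration.integral_sum DD)
    also have "\<dots> = (\<Sum>i<n. (d i)\<^sup>2 * (\<tau> (Suc i) - \<tau> i))"
      by (intro sum.cong refl) (simp add: power2_eq_square if_distrib[of "\<lambda>x. _ * x"] cong: if_cong)
    finally show ?thesis by (simp add: sum_divide_distrib sum_negf)
  qed
  finally show ?thesis .
qed

text \<open>Summation by parts turns a combination of values of \<open>B\<close> at sorted times
  into a combination of increments. The two agree only almost surely, since \<open>B 0 = 0\<close>
  holds only almost surely.\<close>

lemma char_span_B:
  assumes F: "finite F" "F \<subseteq> {0..}"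
  shows "(CLINT \<omega>|M. iexp (\<Sum>t\<in>F. c t * B t \<omega>)) = of_real (exp (- expectation (\<lambda>\<omega>. (\<Sum>t\<in>F. c t * B t \<omega>)\<^sup>2) / 2))"
proof -
  define xs where "xs = sorted_list_of_set F"
  define n where "n = length xs"
  have xs: "sorted xs" "distinct xs" "set xs = F" using F by (simp_all add: xs_def)
  \<comment> \<open>The sorted times with \<open>0\<close> put in front and the last one repeated
    for ever; the clause \<open>n = 0\<close> avoids indexing an empty list.\<close>
  define \<tau> where "\<tau> i = (if i = 0 \<or> n = 0 then 0 else xs ! (min i n - 1))" for i
  have \<tau>_Suc: "\<tau> (Suc i) = xs ! i" if "i < n" for i using that by (simp add: \<tau>_def min_def)
  have xs_nn: "0 \<le> xs ! i" if "i < n" for i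
    using that F xs(3) nth_mem[of i xs] by (auto simp: n_def)
  have inc: "incseq \<tau>"
    unfolding incseq_Suc_iff
  proof
    fix i
    show "\<tau> i \<le> \<tau> (Suc i)"
    proof (cases "n = 0 \<or> i = 0")
      case True
      then show ?thesis using xs_nn[of 0] by (auto simp: \<tau>_def min_def)
    next
      case False
      then have "min i n - 1 \<le> min (Suc i) n - 1" "min (Suc i) n - 1 < length xs" by (auto simp: n_def min_def)
      then show ?thesis using False sorted_nth_mono[OF xs(1)] by (simp add: \<tau>_def)
    qed
  qed
  \<comment> \<open>The increment that ends at the time \<open>xs ! i\<close> occurs in the value of
    \<open>B\<close> at every time of index at least \<open>i\<close>, hence the tail sums.\<close>
  define d where "d i = (\<Sum>j\<in>{i..<n}. c (xs ! j))" for i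
  define Z where "Z \<omega> = (\<Sum>i<n. d i * (B (\<tau> (Suc i)) \<omega> - B (\<tau> i) \<omega>))" for \<omega>
  define Y where "Y \<omega> = (\<Sum>t\<in>F. c t * B t \<omega>)" for \<omega>
  have [measurable]: "B (\<tau> i) \<in> borel_measurable M" for i
    using incseqD[OF inc, of 0 i] by (intro B_measurable) (simp add: \<tau>_def)
  have [measurable]: "Z \<in> borel_measurable M" unfolding Z_def[abs_def] by measurable
  have [measurable]: "Y \<in> borel_measurable M" unfolding Y_def[abs_def] using F
    by (intro borel_measurable_sum borel_measurable_times borel_measurable_const B_measurable) auto
  have "AE \<omega> in M. Y \<omega> = Z \<omega>"
    using B_0
  proof eventually_elim
    case (elim \<omega>)
    have inj: "inj_on ((!) xs) {..<n}" using xs(2) by (auto simp: inj_on_def nth_eq_iff_index_eq n_def)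
    have im: "(!) xs ` {..<n} = F" using xs(3) by (auto simp: set_conv_nth n_def)
    have "Y \<omega> = (\<Sum>j<n. c (xs ! j) * B (xs ! j) \<omega>)"
      unfolding Y_def im[symmetric] by (rule sum.reindex_cong[OF inj refl refl])
    also have "\<dots> = (\<Sum>j<n. \<Sum>i<n. if i \<le> j then c (xs ! j) * (B (\<tau> (Suc i)) \<omega> - B (\<tau> i) \<omega>) else 0)"
    proof (rule sum.cong)
      fix j assume j: "j \<in> {..<n}"
      have "B (xs ! j) \<omega> = B (\<tau> (Suc j)) \<omega> - B (\<tau> 0) \<omega>"
        using j elim by (simp add: \<tau>_Suc) (simp add: \<tau>_def)
      also have "\<dots> = (\<Sum>i<Suc j. B (\<tau> (Suc i)) \<omega> - B (\<tau> i) \<omega>)"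
        using sum_lessThan_telescope[of "\<lambda>i. B (\<tau> i) \<omega>" "Suc j"] by simp
      finally have "c (xs ! j) * B (xs ! j) \<omega> = (\<Sum>i<Suc j. c (xs ! j) * (B (\<tau> (Suc i)) \<omega> - B (\<tau> i) \<omega>))"
        by (simp only: sum_distrib_left)
      also have "\<dots> = (\<Sum>i<n. if i \<le> j then c (xs ! j) * (B (\<tau> (Suc i)) \<omega> - B (\<tau> i) \<omega>) else 0)"
        using j by (intro sum.mono_neutral_cong_left) auto
      finally show "c (xs ! j) * B (xs ! j) \<omega> = (\<Sum>i<n. if i \<le> j then c (xs ! j) * (B (\<tau> (Suc i)) \<omega> - B (\<tau> i) \<omega>) else 0)" .
    qed simp
    also have "\<dots> = (\<Sum>i<n. \<Sum>j<n. if i \<le> j then c (xs ! j) * (B (\<tau> (Suc i)) \<omega> - B (\<tau> i) \<omega>) else 0)"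
      by (rule sum.swap)
    also have "\<dots> = Z \<omega>"
      unfolding Z_def
    proof (rule sum.cong)
      fix i assume "i \<in> {..<n}"
      have "d i * (B (\<tau> (Suc i)) \<omega> - B (\<tau> i) \<omega>) = (\<Sum>j\<in>{i..<n}. c (xs ! j) * (B (\<tau> (Suc i)) \<omega> - B (\<tau> i) \<omega>))"
        unfolding d_def sum_distrib_right ..
      also have "\<dots> = (\<Sum>j<n. if i \<le> j then c (xs ! j) * (B (\<tau> (Suc i)) \<omega> - B (\<tau> i) \<omega>) else 0)"
        by (intro sum.mono_neutral_cong_left) auto
      finally show "(\<Sum>j<n. if i \<le> j then c (xs ! j) * (B (\<tau> (Suc i)) \<omega> - B (\<tau> i) \<omega>) else 0)
        = d i * (B (\<tau> (Suc i)) \<omega> - B (\<tau> i) \<omega>)" by simp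
    qed simp
    finally show ?case .
  qed
  then have "(CLINT \<omega>|M. iexp (Y \<omega>)) = (CLINT \<omega>|M. iexp (Z \<omega>))"
    and "expectation (\<lambda>\<omega>. (Y \<omega>)\<^sup>2) = expectation (\<lambda>\<omega>. (Z \<omega>)\<^sup>2)"
    by (auto intro!: integral_cong_AE)
  moreover have "(CLINT \<omega>|M. iexp (Z \<omega>)) = of_real (exp (- expectation (\<lambda>\<omega>. (Z \<omega>)\<^sup>2) / 2))"
    unfolding Z_def by (rule char_independent_increments[OF _ inc]) (simp add: \<tau>_def)
  ultimately show ?thesis by (simp add: Y_def)
qed

lemma gauss_char:
  "Z \<in> gauss_closure M B \<Longrightarrow> (CLINT \<omega>|M. iexp (Z \<omega>)) = of_real (exp (- expectation (\<lambda>\<omega>. (Z \<omega>)\<^sup>2) / 2))"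
  using gauss_closure_char[OF sq_int_B char_span_B] .

text \<open>A linear combination stays in the Gaussian space and has second moment equal to the sum
  of the squared coefficients, so the joint characteristic function is that of independent standard
  normal variables: uncorrelated implies independent here.\<close>

lemma orthonormal_gauss_indep:
  fixes \<xi> :: "'i \<Rightarrow> 'a \<Rightarrow> real"
  assumes \<xi>: "\<And>k. k \<in> I \<Longrightarrow> \<xi> k \<in> gauss_closure M B"
    and orth: "\<And>j k. j \<in> I \<Longrightarrow> k \<in> I \<Longrightarrow> expectation (\<lambda>\<omega>. \<xi> j \<omega> * \<xi> k \<omega>) = (if j = k then 1 else 0)"
  shows "indep_vars (\<lambda>_. borel) \<xi> I" and "\<And>k. k \<in> I \<Longrightarrow> distributed M lborel (\<xi> k) std_normal_density"
proof -
  have s: "sq_int M (\<xi> k)" if "k \<in> I" for k using gauss_closure_sq_int[OF _ \<xi>[OF that]] sq_int_B by blast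
  have ch: "(CLINT \<omega>|M. iexp (\<Sum>k\<in>K. u k * \<xi> k \<omega>)) = of_real (exp (- (\<Sum>k\<in>K. (u k)\<^sup>2) / 2))"
    if K: "finite K" "K \<subseteq> I" for K u
  proof -
    have mem: "(\<lambda>\<omega>. \<Sum>k\<in>K. u k * \<xi> k \<omega>) \<in> gauss_closure M B"
      using K \<xi> by (intro gauss_closure_sum gauss_closure_scale sq_int_B) auto
    have int: "integrable M (\<lambda>\<omega>. u j * u k * (\<xi> j \<omega> * \<xi> k \<omega>))" if "j \<in> K" "k \<in> K" for j k
      using that K by (intro integrable_mult_right sq_int_mult s) auto
    have "expectation (\<lambda>\<omega>. (\<Sum>k\<in>K. u k * \<xi> k \<omega>)\<^sup>2) = expectation (\<lambda>\<omega>. \<Sum>j\<in>K. \<Sum>k\<in>K. u j * u k * (\<xi> j \<omega> * \<xi> k \<omega>))"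
      unfolding power2_eq_square sum_product by (simp only: mult_ac)
    also have "\<dots> = (\<Sum>j\<in>K. \<Sum>k\<in>K. expectation (\<lambda>\<omega>. u j * u k * (\<xi> j \<omega> * \<xi> k \<omega>)))"
      using int by (subst Bochner_Integration.integral_sum) (auto intro!: sum.cong Bochner_Integration.integral_sum)
    also have "\<dots> = (\<Sum>j\<in>K. \<Sum>k\<in>K. if j = k then u j * u k else 0)"
    proof (intro sum.cong refl)
      fix j k assume "j \<in> K" "k \<in> K"
      then have "expectation (\<lambda>\<omega>. \<xi> j \<omega> * \<xi> k \<omega>) = (if j = k then 1 else 0)" using K by (intro orth) auto
      then show "expectation (\<lambda>\<omega>. u j * u k * (\<xi> j \<omega> * \<xi> k \<omega>)) = (if j = k then u j * u k else 0)"
        unfolding integral_mult_right_zero by simp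
    qed
    also have "\<dots> = (\<Sum>k\<in>K. (u k)\<^sup>2)" using K by (simp add: power2_eq_square)
    finally show ?thesis using gauss_char[OF mem] by simp
  qed
  show "indep_vars (\<lambda>_. borel) \<xi> I"
    by (rule indep_std_normal_of_char(1)[OF sq_int_measurable[OF s] ch])
  show "distributed M lborel (\<xi> k) std_normal_density" if "k \<in> I" for k
    by (rule indep_std_normal_of_char(2)[OF sq_int_measurable[OF s] ch that])
qed

end

section \<open>The bridge and its covariance\<close>

context bridge_parameters begin

definition H :: "real \<Rightarrow> real" where "H t = integral {0..t} (\<lambda>u. (T - u) powr (- a))"
text \<open>On \<open>u < T\<close> the derivative of the integrating factor
  \<open>(T - u) powr (- a) = 1 / w u\<close>.\<close>

definition g :: "real \<Rightarrow> real" where "g u = a * (T - u) powr (- a - 1)"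

lemma H_0 [simp]: "H 0 = 0" by (simp add: H_def)

lemma continuous_on_g: "S \<subseteq> {..<T} \<Longrightarrow> continuous_on S g"
  unfolding g_def[abs_def] by (intro continuous_intros continuous_on_powr_T)

lemma DERIV_G:
  assumes "u < T"
  shows "((\<lambda>u. (T - u) powr (- a)) has_real_derivative g u) (at u within S)"
proof -
  have "((\<lambda>u. (T - u) powr (- a)) has_real_derivative - a * (T - u) powr (- a - 1) * (-1)) (at u within S)"
    using assms by (auto intro!: derivative_eq_intros)
  then show ?thesis by (simp add: g_def)
qed

lemma DERIV_H:
  assumes "0 < t" "t < T"
  shows "(H has_real_derivative (T - t) powr (- a)) (at t)"
proof -
  define b where "b = (t + T) / 2"
  have b: "t < b" "b < T" using assms by (auto simp: b_def)
  have "(H has_real_derivative (T - t) powr (- a)) (at t within {0..b})"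
    unfolding H_def[abs_def] using b assms
    by (intro integral_has_real_derivative continuous_on_powr_T) auto
  moreover have "at t within {0..b} = at t" using assms b by (intro at_within_interior) auto
  ultimately show ?thesis by simp
qed

lemma continuous_on_H: "t < T \<Longrightarrow> continuous_on {0..t} H"
  unfolding H_def[abs_def]
  by (intro indefinite_integral_continuous_1 integrable_continuous_real continuous_on_powr_T) auto

lemma G_w: "t < T \<Longrightarrow> w t * (T - t) powr (- a) = 1"
  by (simp add: w_def powr_add[symmetric])

text \<open>Integration by parts with \<open>g = G'\<close>,
  \<open>G u = (T - u) powr (- a)\<close>: the antiderivative is \<open>G h - k\<close> with
  \<open>k' = G h'\<close>. Beyond \<open>s\<close> the argument of \<open>h\<close> and
  \<open>k\<close> is frozen, so \<open>u = s\<close> is exempted from differentiation. Used for the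
  pairs \<open>(id, H)\<close> and \<open>(H, V)\<close>.\<close>

lemma integral_g_min:
  assumes st: "0 \<le> s" "0 \<le> t" "t < T"
    and h: "continuous_on {0..t} h" "h 0 = 0" "\<And>u. 0 < u \<Longrightarrow> u < T \<Longrightarrow> (h has_real_derivative h' u) (at u)"
    and k: "continuous_on {0..t} k" "k 0 = 0" "\<And>u. 0 < u \<Longrightarrow> u < T \<Longrightarrow> (k has_real_derivative (T - u) powr (- a) * h' u) (at u)"
  shows "integral {0..t} (\<lambda>u. g u * h (min s u)) = (T - t) powr (- a) * h (min s t) - k (min s t)"
proof -
  have c: "continuous_on {0..t} (\<lambda>u. f (min s u))" if "continuous_on {0..t} f" for f :: "real \<Rightarrow> real"
    using st by (intro continuous_on_compose2[OF that] continuous_intros) auto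
  have "((\<lambda>u. g u * h (min s u)) has_integral
      ((T - t) powr (- a) * h (min s t) - k (min s t)) - ((T - 0) powr (- a) * h (min s 0) - k (min s 0))) {0..t}"
  proof (rule fundamental_theorem_of_calculus_interior_strong[of "{s}"])
    show "continuous_on {0..t} (\<lambda>u. (T - u) powr (- a) * h (min s u) - k (min s u))"
      using st by (intro continuous_intros c h k continuous_on_powr_T) auto
    fix u assume "u \<in> {0<..<t} - {s}"
    then have u: "0 < u" "u < T" "u \<noteq> s" using st by auto
    have "((\<lambda>u. (T - u) powr (- a) * h (min s u) - k (min s u)) has_real_derivative g u * h (min s u)) (at u)"
    proof (cases "u < s")
      case True
      have "((\<lambda>u. (T - u) powr (- a) * h u - k u) has_real_derivative
          ((T - u) powr (- a) * h' u + g u * h u) - (T - u) powr (- a) * h' u) (at u)"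
        by (intro DERIV_diff DERIV_mult' DERIV_G h k u)
      then have "((\<lambda>u. (T - u) powr (- a) * h u - k u) has_real_derivative g u * h (min s u)) (at u)"
        using True by simp
      then show ?thesis
        by (rule has_field_derivative_transform_within_open[where S = "{..<s}"]) (use True in auto)
    next
      case False
      have "((\<lambda>u. (T - u) powr (- a) * h s - k s) has_real_derivative
          ((T - u) powr (- a) * 0 + g u * h s) - 0) (at u)"
        by (intro DERIV_diff DERIV_mult' DERIV_G DERIV_const u)
      then have "((\<lambda>u. (T - u) powr (- a) * h s - k s) has_real_derivative g u * h (min s u)) (at u)"
        using False by (simp add: min_absorb1)
      then show ?thesis
        by (rule has_field_derivative_transform_within_open[where S = "{s<..}"]) (use False u in auto)
    qed
    then show "((\<lambda>u. (T - u) powr (- a) * h (min s u) - k (min s u)) has_vector_derivative g u * h (min s u)) (at u)"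
      by (simp add: has_real_derivative_iff_has_vector_derivative)
  qed (use st in auto)
  then show ?thesis using st h(2) k(2) by (simp add: integral_unique min_absorb2)
qed

text \<open>Variation of constants without differentiating \<open>b\<close>: only the drift integral
  \<open>x - b\<close> is multiplied by the integrating factor \<open>G\<close>. Its drift
  \<open>f\<close> satisfies \<open>G f = - g x\<close>, so the derivative of
  \<open>G (x - b)\<close> is \<open>- g x + g (x - b) = - g b\<close>.\<close>

lemma bridge_path_formula:
  assumes b: "continuous_on {0..} b" and x: "continuous_on {0..<T} x"
    and eq: "\<And>t. t \<in> {0..<T} \<Longrightarrow> x t = (LBINT s:{0..t}. - (a / (T - s)) * x s) + b t"
    and t: "t \<in> {0..<T}"
  shows "x t = b t - w t * integral {0..t} (\<lambda>s. g s * b s)"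
proof -
  let ?f = "\<lambda>s. - (a / (T - s)) * x s"
  have contf: "continuous_on {0..t} ?f"
    using t by (intro continuous_intros continuous_on_subset[OF x]) auto
  have d: "x s - b s = integral {0..s} ?f" if s: "s \<in> {0..t}" for s
  proof -
    have "set_integrable lborel {0..s} ?f"
      using s by (intro borel_integrable_atLeastAtMost' continuous_on_subset[OF contf]) auto
    from set_borel_integral_eq_integral(2)[OF this] show ?thesis using eq[of s] s t by simp
  qed
  have "((\<lambda>s. - (g s * b s)) has_integral
      (T - t) powr (- a) * integral {0..t} ?f - (T - 0) powr (- a) * integral {0..0} ?f) {0..t}"
  proof (rule fundamental_theorem_of_calculus)
    fix s assume s: "s \<in> {0..t}"
    then have sT: "s < T" using t by auto
    have "((\<lambda>s. (T - s) powr (- a) * integral {0..s} ?f) has_real_derivative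
        (T - s) powr (- a) * ?f s + g s * integral {0..s} ?f) (at s within {0..t})"
      using s by (intro DERIV_mult' DERIV_G sT integral_has_real_derivative contf) auto
    also have "(T - s) powr (- a) * ?f s + g s * integral {0..s} ?f = - (g s * b s)"
    proof -
      have "(T - s) powr (- a) / (T - s) = (T - s) powr (- a - 1)"
        using sT powr_diff[of "T - s" "- a" 1] by simp
      then have "(T - s) powr (- a) * ?f s = - g s * x s"
        unfolding g_def by (metis (no_types, lifting) minus_mult_left mult.assoc mult.commute times_divide_eq_right)
      then show ?thesis unfolding d[OF s, symmetric] by (simp add: algebra_simps)
    qed
    finally show "((\<lambda>s. (T - s) powr (- a) * integral {0..s} ?f) has_vector_derivative - (g s * b s)) (at s within {0..t})"
      by (simp add: has_real_derivative_iff_has_vector_derivative)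
  qed (use t in auto)
  moreover have "integral {0..t} ?f = x t - b t" by (rule d[symmetric]) (use t in auto)
  moreover have "integral {0..0} ?f = 0" by simp
  ultimately have "((\<lambda>s. - (g s * b s)) has_integral (T - t) powr (- a) * (x t - b t)) {0..t}"
    by (simp only: mult_zero_right diff_zero)
  then have "integral {0..t} (\<lambda>s. - (g s * b s)) = (T - t) powr (- a) * (x t - b t)"
    by (rule integral_unique)
  then have "integral {0..t} (\<lambda>s. g s * b s) = - ((T - t) powr (- a) * (x t - b t))"
    by simp
  then have "w t * integral {0..t} (\<lambda>s. g s * b s) = - (w t * (T - t) powr (- a) * (x t - b t))"
    by (simp only: mult_minus_right mult.assoc)
  then show ?thesis using G_w[of t] t by simp
qed

end

locale wiener_bridge = wiener M B + bridge_parameters T a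
  for M :: "'a measure" and B :: "real \<Rightarrow> 'a \<Rightarrow> real" and T a :: real +
  fixes X :: "real \<Rightarrow> 'a \<Rightarrow> real"
  assumes bridge: "alpha_wiener_bridge M B T a X"
begin

lemma X_measurable: "t \<in> {0..T} \<Longrightarrow> X t \<in> borel_measurable M"
  using bridge unfolding alpha_wiener_bridge_def by blast

lemma X_T: "AE \<omega> in M. X T \<omega> = 0"
  using bridge unfolding alpha_wiener_bridge_def by (auto elim: eventually_mono)

lemma X_formula:
  assumes t: "t \<in> {0..<T}"
  shows "AE \<omega> in M. X t \<omega> = B t \<omega> - w t * integral {0..t} (\<lambda>s. g s * B s \<omega>)"
proof -
  have "AE \<omega> in M. X 0 \<omega> = 0 \<and> continuous_on {0..<T} (\<lambda>t. X t \<omega>) \<and>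
      (\<forall>t\<in>{0..<T}. X t \<omega> = (LBINT s:{0..t}. - (a / (T - s)) * X s \<omega>) + B t \<omega>) \<and> X T \<omega> = 0"
    using bridge unfolding alpha_wiener_bridge_def by blast
  then show ?thesis using B_continuous
  proof eventually_elim
    case (elim \<omega>)
    then show ?case using bridge_path_formula[of "\<lambda>t. B t \<omega>" "\<lambda>t. X t \<omega>" t] t by simp
  qed
qed

text \<open>\<open>(B t - X t) / w t\<close> is a version of \<open>\<integral> g s B\<^sub>s ds\<close> over \<open>[0,t]\<close> whose measurability needs no joint
  measurability of \<open>B\<close>.\<close>

lemma L2_lim_drift:
  assumes t: "t \<in> {0..<T}"
  shows "L2_lim M (rsum 0 t (\<lambda>s \<omega>. g s * B s \<omega>)) (\<lambda>\<omega>. (B t \<omega> - X t \<omega>) / w t)"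
proof (rule L2_lim_of_AE_lim[where r = "\<lambda>n. n"])
  have [measurable]: "B t \<in> borel_measurable M" "X t \<in> borel_measurable M"
    using t X_measurable by auto
  show "(\<lambda>\<omega>. (B t \<omega> - X t \<omega>) / w t) \<in> borel_measurable M" by measurable
  show "filterlim (\<lambda>n. n) sequentially sequentially" by (rule filterlim_ident)
  show "L2_Cauchy M (rsum 0 t (\<lambda>s \<omega>. g s * B s \<omega>))"
  proof (rule rsum_L2_Cauchy)
    show "sq_int M (\<lambda>\<omega>. g s * B s \<omega>)" if "s \<in> {0..t}" for s
      using that by (intro sq_int_scale sq_int_B) auto
    have "(\<integral>\<omega>. g s * B s \<omega> * (g u * B u \<omega>) \<partial>M) = g s * g u * min s u" if "s \<in> {0..t}" "u \<in> {0..t}" for s u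
    proof -
      have "(\<integral>\<omega>. g s * B s \<omega> * (g u * B u \<omega>) \<partial>M) = (\<integral>\<omega>. g s * g u * (B s \<omega> * B u \<omega>) \<partial>M)" by (simp only: mult_ac)
      then show ?thesis using covariance_B[of s u] that by simp
    qed
    moreover have "continuous_on ({0..t} \<times> {0..t}) (\<lambda>(s, u). g s * g u * min s u)"
      unfolding case_prod_beta using t
      by (intro continuous_intros continuous_on_compose2[OF continuous_on_g[of "{..<T}"]]) auto
    ultimately show "continuous_on ({0..t} \<times> {0..t}) (\<lambda>(s, u). \<integral>\<omega>. g s * B s \<omega> * (g u * B u \<omega>) \<partial>M)"
      by (subst continuous_on_cong[OF refl, where g = "\<lambda>(s, u). g s * g u * min s u"]) auto
  qed (use t in auto)
  \<comment> \<open>Along a continuous path these are ordinary Riemann sums; the pathwise limit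
    identifies the limit in mean square.\<close>
  show "AE \<omega> in M. (\<lambda>n. rsum 0 t (\<lambda>s \<omega>. g s * B s \<omega>) n \<omega>) \<longlonglongrightarrow> (B t \<omega> - X t \<omega>) / w t"
    using X_formula[OF t] B_continuous
  proof eventually_elim
    case (elim \<omega>)
    have "continuous_on {0..t} (\<lambda>s. g s * B s \<omega>)"
      using t by (intro continuous_intros continuous_on_g continuous_on_subset[OF elim(2)]) auto
    then have "(\<lambda>n. \<Sum>i<2^n. (t - 0) / 2 ^ n * (g (node 0 t n i) * B (node 0 t n i) \<omega>)) \<longlonglongrightarrow> integral {0..t} (\<lambda>s. g s * B s \<omega>)"
      using t by (intro riemann_sum_tendsto) auto
    moreover have "(B t \<omega> - X t \<omega>) / w t = integral {0..t} (\<lambda>s. g s * B s \<omega>)"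
      using elim(1) w_pos[of t] t by simp
    ultimately show ?case by (simp only: rsum_def)
  qed
qed

lemma X_gauss:
  assumes t: "t \<in> {0..T}"
  shows "X t \<in> gauss_closure M B"
proof (cases "t = T")
  case True
  \<comment> \<open>\<open>0 * B 0\<close> serves as the zero element of the Gaussian space;
    \<open>X T\<close> equals it almost surely.\<close>
  have zero: "(\<lambda>\<omega>. 0 * B 0 \<omega>) \<in> gauss_closure M B"
    by (intro gauss_closure_scale gauss_closure_base sq_int_B) auto
  show ?thesis
  proof (rule gauss_closure_cong_AE[OF sq_int_B zero X_measurable[OF t]])
    show "AE \<omega> in M. X t \<omega> = 0 * B 0 \<omega>" using X_T True by simp
  qed
next
  case False
  then have t': "t \<in> {0..<T}" using t by auto
  have Z: "(\<lambda>\<omega>. (B t \<omega> - X t \<omega>) / w t) \<in> gauss_closure M B"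
  proof (rule gauss_closure_lim[OF sq_int_B L2_lim_drift[OF t']])
    show "rsum 0 t (\<lambda>s \<omega>. g s * B s \<omega>) n \<in> gauss_closure M B" for n
      unfolding rsum_def[abs_def] using t' node_in[of 0 t _ n]
      by (intro gauss_closure_sum gauss_closure_scale gauss_closure_base sq_int_B) (auto intro: less_imp_le)
  qed
  have "(\<lambda>\<omega>. B t \<omega> + (- w t) * ((B t \<omega> - X t \<omega>) / w t)) \<in> gauss_closure M B"
    using t by (intro gauss_closure_add gauss_closure_scale[OF sq_int_B Z] gauss_closure_base sq_int_B) auto
  moreover have "X t = (\<lambda>\<omega>. B t \<omega> + (- w t) * ((B t \<omega> - X t \<omega>) / w t))"
    using w_pos[of t] t' by (intro ext) simp
  ultimately show ?thesis by simp
qed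

lemma sq_int_X: "t \<in> {0..T} \<Longrightarrow> sq_int M (X t)"
  using gauss_closure_sq_int[OF sq_int_B X_gauss] .

text \<open>Reduces moments with \<open>X t\<close> to moments with \<open>B\<close>. With
  \<open>Y = 1\<close> it gives the mean, with \<open>Y = B s\<close> the cross-covariance, and with
  \<open>Y = X s\<close> the covariance from the cross-covariance.\<close>

lemma expectation_mult_X:
  assumes t: "t \<in> {0..<T}" and Y: "sq_int M Y" and c: "continuous_on {0..t} (\<lambda>s. expectation (\<lambda>\<omega>. Y \<omega> * B s \<omega>))"
  shows "expectation (\<lambda>\<omega>. Y \<omega> * X t \<omega>) = expectation (\<lambda>\<omega>. Y \<omega> * B t \<omega>)
    - w t * integral {0..t} (\<lambda>s. g s * expectation (\<lambda>\<omega>. Y \<omega> * B s \<omega>))"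
proof -
  define Z where "Z \<omega> = (B t \<omega> - X t \<omega>) / w t" for \<omega>
  have lim: "L2_lim M (rsum 0 t (\<lambda>s \<omega>. g s * B s \<omega>)) Z"
    unfolding Z_def[abs_def] by (rule L2_lim_drift[OF t])
  have iZ: "sq_int M Z" using lim by (simp add: L2_lim_def)
  have iB: "sq_int M (B t)" using t by (intro sq_int_B) auto
  have eqYB: "expectation (\<lambda>\<omega>. Y \<omega> * (g s * B s \<omega>)) = g s * expectation (\<lambda>\<omega>. Y \<omega> * B s \<omega>)" for s
    by (subst mult.left_commute) (rule integral_mult_right_zero)
  have "expectation (\<lambda>\<omega>. Y \<omega> * Z \<omega>) = integral {0..t} (\<lambda>s. expectation (\<lambda>\<omega>. Y \<omega> * (g s * B s \<omega>)))"
  proof (rule L2_lim_rsum_expectation[OF _ _ Y lim])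
    show "sq_int M (\<lambda>\<omega>. g s * B s \<omega>)" if "s \<in> {0..t}" for s using that by (intro sq_int_scale sq_int_B) auto
    show "continuous_on {0..t} (\<lambda>s. expectation (\<lambda>\<omega>. Y \<omega> * (g s * B s \<omega>)))"
      unfolding eqYB using t by (intro continuous_intros continuous_on_g c) auto
  qed (use t in auto)
  then have YZ: "expectation (\<lambda>\<omega>. Y \<omega> * Z \<omega>) = integral {0..t} (\<lambda>s. g s * expectation (\<lambda>\<omega>. Y \<omega> * B s \<omega>))"
    unfolding eqYB .
  have "Y \<omega> * X t \<omega> = Y \<omega> * B t \<omega> - w t * (Y \<omega> * Z \<omega>)" for \<omega>
  proof -
    have wZ: "w t * Z \<omega> = B t \<omega> - X t \<omega>" using w_pos[of t] t by (simp add: Z_def)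
    have "w t * (Y \<omega> * Z \<omega>) = Y \<omega> * (w t * Z \<omega>)" by (rule mult.left_commute)
    then show ?thesis unfolding wZ by (simp add: right_diff_distrib)
  qed
  then have "expectation (\<lambda>\<omega>. Y \<omega> * X t \<omega>) = expectation (\<lambda>\<omega>. Y \<omega> * B t \<omega> - w t * (Y \<omega> * Z \<omega>))"
    by (simp only:)
  also have "\<dots> = expectation (\<lambda>\<omega>. Y \<omega> * B t \<omega>) - w t * expectation (\<lambda>\<omega>. Y \<omega> * Z \<omega>)"
    using sq_int_mult[OF Y iB] sq_int_mult[OF Y iZ] by simp
  finally show ?thesis unfolding YZ .
qed

lemma expectation_X:
  assumes "t \<in> {0..T}"
  shows "expectation (X t) = 0"
proof (cases "t = T")
  case True
  then show ?thesis using X_T by (intro integral_eq_zero_AE) auto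
next
  case False
  then have t': "t \<in> {0..<T}" using assms by auto
  have eq: "expectation (\<lambda>\<omega>. 1 * B s \<omega>) = 0" if "s \<in> {0..t}" for s using expectation_B[of s] that by simp
  have "continuous_on {0..t} (\<lambda>s. expectation (\<lambda>\<omega>. 1 * B s \<omega>))"
    by (subst continuous_on_cong[OF refl eq]) auto
  from expectation_mult_X[OF t' sq_int_const this]
  have "expectation (X t) = expectation (\<lambda>\<omega>. 1 * B t \<omega>) - w t * integral {0..t} (\<lambda>s. g s * expectation (\<lambda>\<omega>. 1 * B s \<omega>))"
    by simp
  also have "integral {0..t} (\<lambda>s. g s * expectation (\<lambda>\<omega>. 1 * B s \<omega>)) = integral {0..t} (\<lambda>s. 0)"
    by (rule integral_cong) (simp only: eq mult_zero_right)
  finally show ?thesis using eq[of t] t' by simp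
qed

lemma covariance_B_X:
  assumes s: "0 \<le> s" and t: "t \<in> {0..<T}"
  shows "expectation (\<lambda>\<omega>. B s \<omega> * X t \<omega>) = w t * H (min s t)"
proof -
  have eq: "expectation (\<lambda>\<omega>. B s \<omega> * B u \<omega>) = min s u" if "u \<in> {0..t}" for u
    using that s by (intro covariance_B) auto
  have c: "continuous_on {0..t} (\<lambda>u. expectation (\<lambda>\<omega>. B s \<omega> * B u \<omega>))"
    by (subst continuous_on_cong[OF refl eq]) (auto intro!: continuous_intros)
  have "expectation (\<lambda>\<omega>. B s \<omega> * X t \<omega>) = expectation (\<lambda>\<omega>. B s \<omega> * B t \<omega>)
      - w t * integral {0..t} (\<lambda>u. g u * expectation (\<lambda>\<omega>. B s \<omega> * B u \<omega>))"
    by (rule expectation_mult_X[OF t sq_int_B[OF s] c])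
  also have "integral {0..t} (\<lambda>u. g u * expectation (\<lambda>\<omega>. B s \<omega> * B u \<omega>)) = integral {0..t} (\<lambda>u. g u * min s u)"
    by (rule integral_cong) (simp only: eq)
  also have "\<dots> = (T - t) powr (- a) * min s t - H (min s t)"
    using s t DERIV_H by (intro integral_g_min[where h = "\<lambda>u. u" and h' = "\<lambda>_. 1"] continuous_on_H continuous_on_id) auto
  also have "expectation (\<lambda>\<omega>. B s \<omega> * B t \<omega>) = min s t" using t by (intro eq) auto
  also have "min s t - w t * ((T - t) powr (- a) * min s t - H (min s t))
      = min s t - (w t * (T - t) powr (- a)) * min s t + w t * H (min s t)" by (simp add: algebra_simps)
  also have "\<dots> = w t * H (min s t)" using G_w[of t] t by simp
  finally show ?thesis .
qed

text \<open>The same computation as for \<open>covariance_B_X\<close>, one level higher: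
  \<open>min s u\<close> is replaced by \<open>w s * H (min s u)\<close> and \<open>H\<close> by
  \<open>V\<close>. The factor \<open>w t\<close> cancels \<open>(T - t) powr (- a)\<close>, so the
  two terms with \<open>H\<close> disappear.\<close>

lemma covariance_X:
  assumes s: "s \<in> {0..T}" and t: "t \<in> {0..T}"
  shows "expectation (\<lambda>\<omega>. X s \<omega> * X t \<omega>) = R s t"
proof (cases "s = T \<or> t = T")
  case True
  have "AE \<omega> in M. X s \<omega> * X t \<omega> = 0" using X_T by eventually_elim (use True in auto)
  then have "expectation (\<lambda>\<omega>. X s \<omega> * X t \<omega>) = 0" by (rule integral_eq_zero_AE)
  then show ?thesis using True by auto
next
  case False
  then have s': "s \<in> {0..<T}" and t': "t \<in> {0..<T}" using s t by auto
  have eq: "expectation (\<lambda>\<omega>. X s \<omega> * B u \<omega>) = w s * H (min s u)" if "u \<in> {0..t}" for u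
    using covariance_B_X[of u s] that s' by (simp add: mult.commute min.commute)
  have cH: "continuous_on {0..t} (\<lambda>u. H (min s u))"
    using s' t' by (intro continuous_on_compose2[OF continuous_on_H[of t]] continuous_intros) auto
  have c: "continuous_on {0..t} (\<lambda>u. expectation (\<lambda>\<omega>. X s \<omega> * B u \<omega>))"
    by (subst continuous_on_cong[OF refl eq]) (auto intro!: continuous_intros cH)
  have "expectation (\<lambda>\<omega>. X s \<omega> * X t \<omega>) = expectation (\<lambda>\<omega>. X s \<omega> * B t \<omega>)
      - w t * integral {0..t} (\<lambda>u. g u * expectation (\<lambda>\<omega>. X s \<omega> * B u \<omega>))"
    by (rule expectation_mult_X[OF t' sq_int_X[OF s] c])
  also have "integral {0..t} (\<lambda>u. g u * expectation (\<lambda>\<omega>. X s \<omega> * B u \<omega>)) = integral {0..t} (\<lambda>u. w s * (g u * H (min s u)))"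
    by (rule integral_cong) (simp only: eq mult.left_commute)
  also have "\<dots> = w s * integral {0..t} (\<lambda>u. g u * H (min s u))" by simp
  also have "integral {0..t} (\<lambda>u. g u * H (min s u)) = (T - t) powr (- a) * H (min s t) - V (min s t)"
  proof (rule integral_g_min[where h' = "\<lambda>u. (T - u) powr (- a)"])
    fix u assume u: "0 < u" "u < T"
    have "(T - u) powr (- a) * (T - u) powr (- a) = (T - u) powr (- (2 * a))"
      by (simp add: powr_add[symmetric])
    also have "\<dots> = 1 / (w u)\<^sup>2" unfolding w_sq by (rule powr_minus_divide)
    finally have "1 / (w u)\<^sup>2 = (T - u) powr (- a) * (T - u) powr (- a)" ..
    then show "(V has_real_derivative (T - u) powr (- a) * (T - u) powr (- a)) (at u)"
      using DERIV_V[OF u] by simp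
  qed (use s' t' DERIV_H in \<open>auto intro: continuous_on_H continuous_on_V[of _ t]\<close>)
  also have "expectation (\<lambda>\<omega>. X s \<omega> * B t \<omega>) = w s * H (min s t)" using t' by (intro eq) auto
  also have "w s * H (min s t) - w t * (w s * ((T - t) powr (- a) * H (min s t) - V (min s t)))
      = w s * H (min s t) - (w t * (T - t) powr (- a)) * w s * H (min s t) + w s * w t * V (min s t)"
    by (simp add: algebra_simps)
  also have "\<dots> = R s t" using G_w[of t] t' by (simp add: R_def)
  finally show ?thesis .
qed

lemma covariance_kernel_X:
  assumes "s \<in> {0..T}" "t \<in> {0..T}"
  shows "covariance_kernel M X s t = R s t"
  using covariance_X[OF assms] expectation_X[OF assms(1)] expectation_X[OF assms(2)]
  by (simp add: covariance_kernel_def)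

end

section \<open>The Karhunen--Loeve expansion\<close>

lemma L2_fun_set_integrable:
  assumes "L2_fun T \<phi>"
  shows "set_integrable lborel {0..T} \<phi>"
proof -
  have m: "(\<lambda>x. indicator {0..T} x *\<^sub>R \<phi> x) \<in> borel_measurable lborel"
    and i: "integrable lborel (\<lambda>x. indicator {0..T} x *\<^sub>R (\<phi> x)\<^sup>2)"
    using assms by (simp_all add: L2_fun_def set_borel_measurable_def set_integrable_def)
  have "integrable lborel (\<lambda>x. indicator {0..T} x *\<^sub>R (1::real))"
    by (intro integrable_scaleR_left) (simp add: integrable_indicator_iff emeasure_lborel_Icc_eq)
  then have "integrable lborel (\<lambda>x. indicator {0..T} x *\<^sub>R (\<phi> x)\<^sup>2 + indicator {0..T} x *\<^sub>R 1)"
    using i by (rule Bochner_Integration.integrable_add[rotated])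
  then show ?thesis
    unfolding set_integrable_def
  proof (rule Bochner_Integration.integrable_bound[OF _ m])
    have "\<bar>y\<bar> \<le> y\<^sup>2 + 1" for y :: real
    proof -
      have "2 * \<bar>y\<bar> * 1 \<le> \<bar>y\<bar>\<^sup>2 + 1\<^sup>2" by (rule sum_squares_bound)
      then show ?thesis by simp
    qed
    then show "AE x in lborel. norm (indicator {0..T} x *\<^sub>R \<phi> x) \<le> norm (indicator {0..T} x *\<^sub>R (\<phi> x)\<^sup>2 + indicator {0..T} x *\<^sub>R 1)"
      by (auto simp: indicator_def)
  qed
qed

lemma LBINT_eq_integral:
  fixes f :: "real \<Rightarrow> real"
  assumes "continuous_on {0..T} f"
  shows "(LBINT s:{0..T}. f s) = integral {0..T} f"
  by (rule set_borel_integral_eq_integral(2)[OF borel_integrable_atLeastAtMost'[OF assms]])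

context continuous_kernel begin

lemma L2_inner_eq_ip: "cont f \<Longrightarrow> cont g \<Longrightarrow> L2_inner T f g = ip f g"
  unfolding L2_inner_def ip_def by (rule LBINT_eq_integral) (intro continuous_intros)

lemma integral_operator_eq_op: "cont f \<Longrightarrow> t \<in> {0..T} \<Longrightarrow> integral_operator T K f t = op f t"
  unfolding integral_operator_def op_def by (rule LBINT_eq_integral) (intro continuous_intros cont_K1)

lemma L2_fun_cont:
  assumes "cont f"
  shows "L2_fun T f"
proof -
  have "set_borel_measurable borel {0..T} f" by (rule set_measurable_continuous_on) (use assms in auto)
  moreover have "set_integrable lborel {0..T} (\<lambda>t. (f t)\<^sup>2)"
    by (intro borel_integrable_atLeastAtMost' continuous_intros assms)
  ultimately show ?thesis by (simp add: L2_fun_def set_borel_measurable_def)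
qed

lemma cont_AE_eq:
  assumes "cont f" "cont h" "AE t in lborel. t \<in> {0..T} \<longrightarrow> f t = h t" "t \<in> {0..T}"
  shows "f t = h t"
proof -
  have c: "cont (\<lambda>t. f t - h t)" by (intro continuous_intros assms)
  have "ip (\<lambda>t. f t - h t) (\<lambda>t. f t - h t) = L2_inner T (\<lambda>t. f t - h t) (\<lambda>t. f t - h t)"
    by (rule L2_inner_eq_ip[OF c c, symmetric])
  also have "\<dots> = 0"
    unfolding L2_inner_def set_lebesgue_integral_def
    by (rule integral_eq_zero_AE) (use assms(3) in \<open>auto elim!: eventually_mono simp: indicator_def\<close>)
  finally show ?thesis using ip_self_eq_0[OF c _ assms(4)] by simp
qed

lemma normed_eigenfunction_cont:
  assumes f: "cont f" and ev: "\<And>t. t \<in> {0..T} \<Longrightarrow> op f t = \<mu> * f t" and norm1: "ip f f = 1"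
  shows "normed_eigenfunction T K \<mu> f"
proof -
  have "\<not> (AE t in lborel. t \<in> {0..T} \<longrightarrow> f t = 0)"
  proof
    assume "AE t in lborel. t \<in> {0..T} \<longrightarrow> f t = 0"
    then have "f t = 0" if "t \<in> {0..T}" for t using cont_AE_eq[OF f continuous_on_const _ that, of 0] by simp
    then have "ip f f = ip (\<lambda>_. 0) (\<lambda>_. 0)" by (intro ip_cong) auto
    then show False using norm1 by (simp add: ip_def)
  qed
  then show ?thesis
    using f norm1 integral_operator_eq_op[OF f] ev L2_fun_cont[OF f]
    by (auto simp: normed_eigenfunction_def eigenfunction_def L2_inner_eq_ip)
qed

text \<open>An eigenfunction is a priori only square integrable; the continuous kernel smooths it.
  Dominated convergence applies with a bound of the kernel times \<open>abs \<phi>\<close>,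
  integrable on a bounded interval.\<close>

lemma continuous_on_integral_operator:
  assumes \<phi>: "L2_fun T \<phi>"
  shows "cont (integral_operator T K \<phi>)"
  unfolding continuous_on_sequentially
proof (intro allI ballI impI)
  fix x t assume t: "t \<in> {0..T}" and x: "(\<forall>n. x n \<in> {0..T}) \<and> x \<longlonglongrightarrow> t"
  obtain C where C: "C > 0" "\<And>s t. s \<in> {0..T} \<Longrightarrow> t \<in> {0..T} \<Longrightarrow> \<bar>K s t\<bar> \<le> C" using K_bound by blast
  have i\<phi>: "integrable lborel (\<lambda>s. indicator {0..T} s *\<^sub>R \<phi> s)"
    using L2_fun_set_integrable[OF \<phi>] by (simp add: set_integrable_def)
  have m: "(\<lambda>s. indicator {0..T} s *\<^sub>R (K r s * \<phi> s)) \<in> borel_measurable lborel" if "r \<in> {0..T}" for r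
  proof -
    have "set_borel_measurable borel {0..T} (K r)"
      by (rule set_measurable_continuous_on) (use cont_K1[OF that] in auto)
    then have 1: "(\<lambda>s. indicator {0..T} s *\<^sub>R K r s) \<in> borel_measurable lborel"
      by (simp add: set_borel_measurable_def)
    have "(\<lambda>s. (indicator {0..T} s *\<^sub>R K r s) * (indicator {0..T} s *\<^sub>R \<phi> s)) \<in> borel_measurable lborel"
      by (intro borel_measurable_times 1 borel_measurable_integrable[OF i\<phi>])
    moreover have "(indicator {0..T} s *\<^sub>R K r s) * (indicator {0..T} s *\<^sub>R \<phi> s) = indicator {0..T} s *\<^sub>R (K r s * \<phi> s)" for s
      by (simp add: indicator_def)
    ultimately show ?thesis by (simp only:)
  qed
  have "(\<lambda>n. \<integral>s. indicator {0..T} s *\<^sub>R (K (x n) s * \<phi> s) \<partial>lborel) \<longlonglongrightarrow> (\<integral>s. indicator {0..T} s *\<^sub>R (K t s * \<phi> s) \<partial>lborel)"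
  proof (rule integral_dominated_convergence)
    show "integrable lborel (\<lambda>s. C * norm (indicator {0..T} s *\<^sub>R \<phi> s))"
      by (intro integrable_mult_right integrable_norm i\<phi>)
    show "AE s in lborel. norm (indicator {0..T} s *\<^sub>R (K (x n) s * \<phi> s)) \<le> C * norm (indicator {0..T} s *\<^sub>R \<phi> s)" for n
      using C(2) x by (intro AE_I2) (auto simp: indicator_def abs_mult intro!: mult_right_mono)
    show "AE s in lborel. (\<lambda>n. indicator {0..T} s *\<^sub>R (K (x n) s * \<phi> s)) \<longlonglongrightarrow> indicator {0..T} s *\<^sub>R (K t s * \<phi> s)"
    proof (intro AE_I2)
      fix s
      show "(\<lambda>n. indicator {0..T} s *\<^sub>R (K (x n) s * \<phi> s)) \<longlonglongrightarrow> indicator {0..T} s *\<^sub>R (K t s * \<phi> s)"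
      proof (cases "s \<in> {0..T}")
        case True
        have "(\<lambda>n. K s (x n)) \<longlonglongrightarrow> K s t"
          using continuous_on_tendsto_compose[OF cont_K1[OF True], of x t sequentially] x t by auto
        moreover have "K s (x n) = K (x n) s" "K s t = K t s" for n using K_sym True x t by auto
        ultimately have "(\<lambda>n. K (x n) s) \<longlonglongrightarrow> K t s" by simp
        then show ?thesis by (intro tendsto_scaleR tendsto_mult tendsto_const)
      qed simp
    qed
  qed (use m x t in auto)
  then show "((integral_operator T K \<phi>) \<circ> x) \<longlonglongrightarrow> integral_operator T K \<phi> t"
    by (simp add: o_def integral_operator_def[abs_def] set_lebesgue_integral_def)
qed

text \<open>The image divided by \<open>\<mu>\<close> is a continuous representative, and since the
  operator ignores null sets it satisfies the eigenvalue equation at every point. This makes the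
  classification for continuous functions cover all of \<open>L2\<close>.\<close>

lemma eigenfunction_regular:
  assumes ef: "eigenfunction T K \<mu> \<phi>" and \<mu>: "\<mu> \<noteq> 0"
  obtains \<psi> where "cont \<psi>" "AE t in lborel. t \<in> {0..T} \<longrightarrow> \<phi> t = \<psi> t" "\<exists>t\<in>{0..T}. \<psi> t \<noteq> 0"
    "\<And>t. t \<in> {0..T} \<Longrightarrow> op \<psi> t = \<mu> * \<psi> t"
proof -
  define \<psi> where "\<psi> t = integral_operator T K \<phi> t / \<mu>" for t
  have L2: "L2_fun T \<phi>" and nz: "\<not> (AE t in lborel. t \<in> {0..T} \<longrightarrow> \<phi> t = 0)"
    and ev: "AE t in lborel. t \<in> {0..T} \<longrightarrow> integral_operator T K \<phi> t = \<mu> * \<phi> t"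
    using ef by (auto simp: eigenfunction_def)
  have c: "cont \<psi>" unfolding \<psi>_def[abs_def] by (intro continuous_intros continuous_on_integral_operator L2) (use \<mu> in auto)
  have ae: "AE t in lborel. t \<in> {0..T} \<longrightarrow> \<phi> t = \<psi> t"
    using ev by eventually_elim (simp add: \<psi>_def \<mu>)
  have "\<exists>t\<in>{0..T}. \<psi> t \<noteq> 0"
  proof (rule ccontr)
    assume "\<not> (\<exists>t\<in>{0..T}. \<psi> t \<noteq> 0)"
    then have "AE t in lborel. t \<in> {0..T} \<longrightarrow> \<phi> t = 0" using ae by (auto elim: eventually_mono)
    with nz show False by simp
  qed
  moreover have "op \<psi> t = \<mu> * \<psi> t" if t: "t \<in> {0..T}" for t
  proof -
    have m\<phi>: "(\<lambda>s. indicator {0..T} s *\<^sub>R \<phi> s) \<in> borel_measurable lborel"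
      using L2 by (simp add: L2_fun_def set_borel_measurable_def)
    have "integral_operator T K \<psi> t = integral_operator T K \<phi> t"
    proof -
      have "(\<integral>s. indicator {0..T} s *\<^sub>R (K t s * \<psi> s) \<partial>lborel) = (\<integral>s. indicator {0..T} s *\<^sub>R (K t s * \<phi> s) \<partial>lborel)"
      proof (rule integral_cong_AE)
        have K1: "set_borel_measurable borel {0..T} (K t)" and P1: "set_borel_measurable borel {0..T} \<psi>"
          by (rule set_measurable_continuous_on; use cont_K1[OF t] c in simp)+
        have 1: "(\<lambda>s. indicator {0..T} s *\<^sub>R K t s) \<in> borel_measurable lborel"
          "(\<lambda>s. indicator {0..T} s *\<^sub>R \<psi> s) \<in> borel_measurable lborel"
          using K1 P1 by (simp_all add: set_borel_measurable_def)
        have eq: "(indicator {0..T} s *\<^sub>R K t s) * (indicator {0..T} s *\<^sub>R f s) = indicator {0..T} s *\<^sub>R (K t s * f s)"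
          for s and f :: "real \<Rightarrow> real" by (simp add: indicator_def)
        show "(\<lambda>s. indicator {0..T} s *\<^sub>R (K t s * \<psi> s)) \<in> borel_measurable lborel"
          unfolding eq[symmetric] by (intro borel_measurable_times 1)
        show "(\<lambda>s. indicator {0..T} s *\<^sub>R (K t s * \<phi> s)) \<in> borel_measurable lborel"
          unfolding eq[symmetric] by (intro borel_measurable_times 1 m\<phi>)
        show "AE s in lborel. indicator {0..T} s *\<^sub>R (K t s * \<psi> s) = indicator {0..T} s *\<^sub>R (K t s * \<phi> s)"
          using ae by eventually_elim (simp add: indicator_def)
      qed
      then show ?thesis by (simp add: integral_operator_def set_lebesgue_integral_def)
    qed
    then show ?thesis using integral_operator_eq_op[OF c t] \<mu> by (simp add: \<psi>_def)
  qed
  ultimately show ?thesis using that[OF c ae] by blast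
qed

end

lemma integral_operator_kernel_cong:
  assumes "\<And>s t. s \<in> {0..T} \<Longrightarrow> t \<in> {0..T} \<Longrightarrow> R s t = R' s t" "t \<in> {0..T}"
  shows "integral_operator T R \<phi> t = integral_operator T R' \<phi> t"
  unfolding integral_operator_def set_lebesgue_integral_def
  using assms by (intro Bochner_Integration.integral_cong) (auto simp: indicator_def)

lemma eigenfunction_kernel_cong:
  assumes "\<And>s t. s \<in> {0..T} \<Longrightarrow> t \<in> {0..T} \<Longrightarrow> R s t = R' s t"
  shows "eigenfunction T R \<mu> \<phi> \<longleftrightarrow> eigenfunction T R' \<mu> \<phi>"
  unfolding eigenfunction_def using integral_operator_kernel_cong[OF assms] by (simp cong: imp_cong)

section \<open>Eigenvalues and normed eigenfunctions indexed by Bessel zeros\<close>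

locale bessel_zeros = bridge_parameters +
  fixes z :: "nat \<Rightarrow> real"
  assumes z_mono: "strict_mono_on {1..} z"
    and z_zeros: "z ` {1..} = {x. 0 < x \<and> bessel_J (a - 1/2) x = 0}"
begin

sublocale K: continuous_kernel T R
  by unfold_locales (use T_pos continuous_on_R R_sym in auto)

definition q :: "nat \<Rightarrow> real" where "q k = (z k)\<^sup>2 / T\<^sup>2"
definition l :: "nat \<Rightarrow> real" where "l k = T\<^sup>2 / (z k)\<^sup>2"
text \<open>With \<open>x = 1 - t / T\<close>, \<open>w t\<close> is \<open>(T * x) powr a\<close>,
  and \<open>J_\<nu>(z x)\<close> is \<open>v\<close> times
  \<open>(z / 2) powr \<nu> * x powr \<nu>\<close>. The powers of \<open>T\<close> and of
  \<open>z k / 2\<close> translate between the two, so that \<open>c * w * v\<close> is the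
  eigenfunction in Bessel form.\<close>

definition c :: "nat \<Rightarrow> real"
  where "c k = sqrt (2 / T) * (z k / 2) powr (a - 1/2) / (T powr a * \<bar>bessel_J (a + 1/2) (z k)\<bar>)"
definition e :: "nat \<Rightarrow> real \<Rightarrow> real" where "e k t = c k * (w t * v (q k) t)"

lemma z_pos: "1 \<le> k \<Longrightarrow> 0 < z k" and z_zero: "1 \<le> k \<Longrightarrow> bessel_J (a - 1/2) (z k) = 0"
  using z_zeros by (auto simp: image_subset_iff set_eq_iff)

lemma z_inj: "1 \<le> j \<Longrightarrow> 1 \<le> k \<Longrightarrow> z j = z k \<Longrightarrow> j = k"
  using strict_mono_on_imp_inj_on[OF z_mono] by (auto simp: inj_on_def)

lemma q_pos: "1 \<le> k \<Longrightarrow> 0 < q k" and l_pos: "1 \<le> k \<Longrightarrow> 0 < l k"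
  using z_pos[of k] T_pos by (auto simp: q_def l_def)

lemma l_q: "l k = 1 / q k"
  by (simp add: q_def l_def)

lemma q_inj: "1 \<le> j \<Longrightarrow> 1 \<le> k \<Longrightarrow> q j = q k \<Longrightarrow> j = k"
  using z_inj[of j k] z_pos[of j] z_pos[of k] T_pos by (simp add: q_def power2_eq_iff_nonneg)

lemma qT: "q k * T\<^sup>2 = (z k)\<^sup>2"
  using T_pos by (simp add: q_def)

lemma v_q_0:
  assumes k: "1 \<le> k"
  shows "v (q k) 0 = 0"
proof -
  have "(z k / 2) powr (a - 1/2) * bessel_entire (a - 1/2) ((z k)\<^sup>2) = 0"
    using z_zero[OF k] bessel_J_eq_bessel_entire[OF z_pos[OF k]] by simp
  then show ?thesis using z_pos[OF k] by (simp add: v_def qT)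
qed

lemma bessel_entire_q_nz:
  assumes "1 \<le> k"
  shows "bessel_entire (a + 1/2) ((z k)\<^sup>2) \<noteq> 0"
  using v_P_not_both_0[of "q k"] v_q_0[OF assms] by (auto simp: P_def qT)

text \<open>The sign of \<open>r\<close> is not known beforehand. Positivity of the entire factor on
  the non-positive axis forces \<open>r > 0\<close>, and only then is \<open>sqrt r * T\<close> a
  positive zero of \<open>J_\<nu>\<close>.\<close>

lemma zero_is_q:
  assumes "v r 0 = 0"
  obtains k where "1 \<le> k" "r = q k"
proof -
  have 0: "bessel_entire (a - 1/2) (r * T\<^sup>2) = 0" using assms by (simp add: v_def)
  have pos: "0 < r * T\<^sup>2"
  proof (rule ccontr)
    assume "\<not> 0 < r * T\<^sup>2"
    then have "bessel_entire (a - 1/2) (r * T\<^sup>2) > 0" using a_pos by (intro bessel_entire_pos) auto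
    with 0 show False by simp
  qed
  then have "sqrt (r * T\<^sup>2) \<in> {x. 0 < x \<and> bessel_J (a - 1/2) x = 0}"
    using 0 by (simp add: bessel_J_eq_bessel_entire)
  then obtain k where k: "1 \<le> k" "sqrt (r * T\<^sup>2) = z k" unfolding z_zeros[symmetric] by auto
  then have "r * T\<^sup>2 = (z k)\<^sup>2" using pos by (metis less_imp_le real_sqrt_pow2)
  then have "r = q k" using T_pos by (simp add: q_def eq_divide_eq)
  with k that show ?thesis by blast
qed

lemma abs_bessel_J_pos:
  assumes k: "1 \<le> k"
  shows "\<bar>bessel_J (a + 1/2) (z k)\<bar> = (z k / 2) powr (a + 1/2) * \<bar>bessel_entire (a + 1/2) ((z k)\<^sup>2)\<bar>"
    "0 < \<bar>bessel_J (a + 1/2) (z k)\<bar>"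
  using bessel_J_eq_bessel_entire[OF z_pos[OF k]] bessel_entire_q_nz[OF k] z_pos[OF k] by (auto simp: abs_mult)

lemma c_pos: "1 \<le> k \<Longrightarrow> 0 < c k"
  using abs_bessel_J_pos(2)[of k] z_pos[of k] T_pos unfolding c_def
  by (intro divide_pos_pos mult_pos_pos) auto

lemma cont_wv: "K.cont (\<lambda>t. w t * v r t)"
  by (intro continuous_intros continuous_on_w continuous_on_v) auto

lemma cont_e: "K.cont (e k)"
  unfolding e_def[abs_def] by (intro continuous_on_mult_left cont_wv)

lemma op_e:
  assumes "1 \<le> k" "t \<in> {0..T}"
  shows "K.op (e k) t = l k * e k t"
proof -
  have "K.op (e k) t = c k * K.op (\<lambda>t. w t * v (q k) t) t"
    unfolding e_def[abs_def] by (rule K.op_scale)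
  also have "K.op (\<lambda>t. w t * v (q k) t) t = w t * v (q k) t / q k"
    unfolding K.op_def using assms q_pos[of k] by (intro eigenfunction_wv v_q_0) auto
  finally have op: "K.op (e k) t = c k * (w t * v (q k) t / q k)" .
  have "e k t = c k * (w t * v (q k) t)" by (rule e_def)
  then show ?thesis unfolding op l_q by simp
qed

lemma ip_e:
  assumes "1 \<le> j" "1 \<le> k"
  shows "K.ip (e j) (e k) = (if j = k then 1 else 0)"
proof (cases "j = k")
  case False
  then have "q j \<noteq> q k" using q_inj assms by blast
  then have "K.ip (\<lambda>t. w t * v (q j) t) (\<lambda>t. w t * v (q k) t) = 0"
    unfolding K.ip_def using assms q_pos[of j] q_pos[of k] by (intro wv_orthogonal v_q_0) auto
  then show ?thesis using False unfolding e_def[abs_def] K.ip_scale K.ip_scale_right by simp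
next
  case True
  define L where "L = bessel_entire (a + 1/2) ((z k)\<^sup>2)"
  define y where "y = z k / 2"
  have y: "0 < y" "z k = 2 * y" using z_pos[OF assms(2)] by (simp_all add: y_def)
  have L: "L \<noteq> 0" using bessel_entire_q_nz[OF assms(2)] by (simp add: L_def)
  have "y powr (a - 1/2 + 1) = y powr (a - 1/2) * y powr 1" by (rule powr_add)
  then have py: "y powr (a + 1/2) = y powr (a - 1/2) * y" using y by (simp add: add.commute)
  have c: "c k = sqrt (2 / T) / (T powr a * (y * \<bar>L\<bar>))"
    unfolding c_def abs_bessel_J_pos(1)[OF assms(2)] L_def[symmetric] y_def[symmetric] py
    using y by (simp add: field_simps)
  have T3: "T powr (2 * a + 3) = (T powr a)\<^sup>2 * T ^ 3"
  proof -
    have "T powr (2 * a + 3) = T powr a * T powr a * T powr 3" by (simp add: powr_add[symmetric])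
    then show ?thesis using T_pos by (simp add: power2_eq_square)
  qed
  have "K.ip (\<lambda>t. w t * v (q k) t) (\<lambda>t. w t * v (q k) t) = q k * T powr (2 * a + 3) * L\<^sup>2 / 8"
    using wv_norm[OF v_q_0[OF assms(2)]] by (simp add: K.ip_def power2_eq_square[symmetric] qT L_def)
  then have "K.ip (e k) (e k) = (c k)\<^sup>2 * (q k * ((T powr a)\<^sup>2 * T ^ 3) * L\<^sup>2 / 8)"
    unfolding e_def[abs_def] K.ip_scale K.ip_scale_right T3 by (simp add: power2_eq_square)
  also have "(c k)\<^sup>2 = 2 / T / ((T powr a)\<^sup>2 * (y\<^sup>2 * L\<^sup>2))"
    unfolding c using T_pos by (simp add: power_divide power_mult_distrib)
  also have "q k = 4 * y\<^sup>2 / T\<^sup>2" by (simp add: q_def y)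
  also have "2 / T / ((T powr a)\<^sup>2 * (y\<^sup>2 * L\<^sup>2)) * (4 * y\<^sup>2 / T\<^sup>2 * ((T powr a)\<^sup>2 * T ^ 3) * L\<^sup>2 / 8) = 1"
    using T_pos y L by (simp add: field_simps power2_eq_square power3_eq_cube)
  finally show ?thesis using True by simp
qed

lemma e_eq:
  assumes k: "1 \<le> k" and t: "t \<in> {0..T}"
  shows "e k t = (if a < 1/2 \<and> t = T then 0
    else sqrt (2 / T * (1 - t / T)) * bessel_J (a - 1/2) (z k * (1 - t / T)) / \<bar>bessel_J (a + 1/2) (z k)\<bar>)"
proof (cases "t = T")
  case True
  \<comment> \<open>At \<open>T\<close> the square-root factor is 0, whatever value
    \<open>bessel_J\<close> takes at 0, and \<open>w T = 0\<close> on the other side.\<close>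
  then show ?thesis using T_pos by (simp add: e_def)
next
  case False
  define x where "x = 1 - t / T"
  have x: "0 < x" "T - t = T * x" using t T_pos False by (auto simp: x_def field_simps)
  have "bessel_J (a - 1/2) (z k * x) = (z k * x / 2) powr (a - 1/2) * bessel_entire (a - 1/2) ((z k * x)\<^sup>2)"
    by (rule bessel_J_eq_bessel_entire) (use x z_pos[OF k] in simp)
  also have "(z k * x)\<^sup>2 = q k * (T - t)\<^sup>2" unfolding x(2) using T_pos by (simp add: q_def power_mult_distrib)
  also have "bessel_entire (a - 1/2) (q k * (T - t)\<^sup>2) = v (q k) t" by (simp add: v_def)
  also have "z k * x / 2 = (z k / 2) * x" by simp
  also have "((z k / 2) * x) powr (a - 1/2) = (z k / 2) powr (a - 1/2) * x powr (a - 1/2)"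
    by (rule powr_mult)
  finally have J: "bessel_J (a - 1/2) (z k * x) = (z k / 2) powr (a - 1/2) * x powr (a - 1/2) * v (q k) t" .
  \<comment> \<open>This is why the continuous extension at \<open>T\<close> is 0 also for
    \<open>a < 1/2\<close>, where \<open>J_\<nu>\<close> itself is unbounded near 0.\<close>
  have "sqrt x * x powr (a - 1/2) = x powr (1/2) * x powr (a - 1/2)"
    using x by (simp add: powr_half_sqrt)
  also have "\<dots> = x powr a" by (simp add: powr_add[symmetric])
  finally have px: "sqrt x * x powr (a - 1/2) = x powr a" .
  have w: "w t = T powr a * x powr a" unfolding w_def x(2) using T_pos x by (simp add: powr_mult)
  have "sqrt (2 / T * x) * bessel_J (a - 1/2) (z k * x) / \<bar>bessel_J (a + 1/2) (z k)\<bar>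
      = sqrt (2 / T) * (z k / 2) powr (a - 1/2) * (sqrt x * x powr (a - 1/2)) * v (q k) t / \<bar>bessel_J (a + 1/2) (z k)\<bar>"
    unfolding J real_sqrt_mult by (simp add: mult_ac)
  also have "\<dots> = e k t"
    unfolding px e_def c_def w using T_pos by simp
  finally show ?thesis using False by (simp add: x_def)
qed

lemma eigen_cont_classification:
  assumes \<psi>: "K.cont \<psi>" and \<mu>: "\<mu> \<noteq> 0" and nz: "\<exists>t\<in>{0..T}. \<psi> t \<noteq> 0"
    and ev: "\<And>t. t \<in> {0..T} \<Longrightarrow> K.op \<psi> t = \<mu> * \<psi> t"
  obtains k d where "1 \<le> k" "\<mu> = l k" "d \<noteq> 0" "\<And>t. t \<in> {0..T} \<Longrightarrow> \<psi> t = d * e k t"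
proof -
  obtain t0 where t0: "t0 \<in> {0..T}" "\<psi> t0 \<noteq> 0" using nz by blast
  have ev': "integral {0..T} (\<lambda>s. R t s * \<psi> s) = \<mu> * \<psi> t" if "t \<in> {0..T}" for t
    using ev[OF that] by (simp add: K.op_def)
  obtain b where b: "v (1 / \<mu>) 0 = 0" "b \<noteq> 0" "\<And>t. t \<in> {0..T} \<Longrightarrow> \<psi> t = b * (w t * v (1 / \<mu>) t)"
    using eigenfunction_classification[OF \<psi> \<mu> ev' t0] by blast
  obtain k where k: "1 \<le> k" "1 / \<mu> = q k" using zero_is_q[OF b(1)] by blast
  have "\<mu> = l k" using k(2) \<mu> by (simp add: l_q k(2)[symmetric])
  moreover have "b / c k \<noteq> 0" using b(2) c_pos[OF k(1)] by simp
  moreover have "\<psi> t = (b / c k) * e k t" if "t \<in> {0..T}" for t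
    using b(3)[OF that] c_pos[OF k(1)] by (simp add: e_def k(2))
  ultimately show ?thesis using that k(1) by blast
qed

lemma eigenfunction_classified:
  assumes "eigenfunction T R \<mu> \<phi>" "\<mu> \<noteq> 0"
  obtains k d where "1 \<le> k" "\<mu> = l k" "d \<noteq> 0" "AE t in lborel. t \<in> {0..T} \<longrightarrow> \<phi> t = d * e k t"
proof -
  show thesis
  proof (rule K.eigenfunction_regular[OF assms])
    fix \<psi>
    assume \<psi>: "K.cont \<psi>" "AE t in lborel. t \<in> {0..T} \<longrightarrow> \<phi> t = \<psi> t" "\<exists>t\<in>{0..T}. \<psi> t \<noteq> 0"
      "\<And>t. t \<in> {0..T} \<Longrightarrow> K.op \<psi> t = \<mu> * \<psi> t"
    show thesis
    proof (rule eigen_cont_classification[OF \<psi>(1) assms(2) \<psi>(3,4)])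
      fix k d assume k: "1 \<le> k" "\<mu> = l k" "d \<noteq> 0" "\<And>t. t \<in> {0..T} \<Longrightarrow> \<psi> t = d * e k t"
      have "AE t in lborel. t \<in> {0..T} \<longrightarrow> \<phi> t = d * e k t"
        using \<psi>(2) by eventually_elim (simp add: k(4))
      with k(1-3) show thesis by (rule that)
    qed
  qed
qed

lemma normed_eigenfunction_e: "1 \<le> k \<Longrightarrow> normed_eigenfunction T R (l k) (e k)"
  by (intro K.normed_eigenfunction_cont cont_e op_e) (auto simp: ip_e)

lemma eigenvalues: "{\<mu>. \<mu> \<noteq> 0 \<and> eigenvalue T R \<mu>} = l ` {1..}"
proof (intro equalityI subsetI)
  fix \<mu> assume "\<mu> \<in> {\<mu>. \<mu> \<noteq> 0 \<and> eigenvalue T R \<mu>}"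
  then obtain \<phi> where "\<mu> \<noteq> 0" "eigenfunction T R \<mu> \<phi>" by (auto simp: eigenvalue_def)
  then show "\<mu> \<in> l ` {1..}" by (elim eigenfunction_classified) auto
next
  fix \<mu> assume "\<mu> \<in> l ` {1..}"
  then obtain k where k: "1 \<le> k" "\<mu> = l k" by auto
  then show "\<mu> \<in> {\<mu>. \<mu> \<noteq> 0 \<and> eigenvalue T R \<mu>}"
    using normed_eigenfunction_e[OF k(1)] l_pos[OF k(1)]
    by (auto simp: eigenvalue_def normed_eigenfunction_def)
qed

text \<open>Eigenvalues are simple: distinct zeros give distinct \<open>l\<close>, so
  \<open>\<phi>\<close> is almost everywhere a multiple of this very \<open>e k\<close>. Continuity
  turns this into equality everywhere, and the norm makes the square of the factor 1.\<close>

lemma normed_eigenfunction_iff: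
  assumes k: "1 \<le> k"
  shows "normed_eigenfunction T R (l k) \<phi> \<longleftrightarrow> (\<forall>t\<in>{0..T}. \<phi> t = e k t) \<or> (\<forall>t\<in>{0..T}. \<phi> t = - e k t)"
proof
  assume "normed_eigenfunction T R (l k) \<phi>"
  then have \<phi>: "K.cont \<phi>" "eigenfunction T R (l k) \<phi>" "K.ip \<phi> \<phi> = 1"
    by (auto simp: normed_eigenfunction_def K.L2_inner_eq_ip)
  have "l k \<noteq> 0" using l_pos[OF k] by simp
  with \<phi>(2) obtain j d where j: "1 \<le> j" "l k = l j" "d \<noteq> 0" "AE t in lborel. t \<in> {0..T} \<longrightarrow> \<phi> t = d * e j t"
    by (rule eigenfunction_classified)
  have "q j = q k" using j(2) by (simp add: l_q)
  then have "j = k" using q_inj j(1) k by blast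
  then have eq: "\<phi> t = d * e k t" if "t \<in> {0..T}" for t
    using K.cont_AE_eq[OF \<phi>(1) _ _ that, of "\<lambda>t. d * e k t"] j(4) \<open>j = k\<close>
    by (simp add: continuous_on_mult_left cont_e)
  have "K.ip \<phi> \<phi> = K.ip (\<lambda>t. d * e k t) (\<lambda>t. d * e k t)" by (rule K.ip_cong) (auto simp: eq)
  then have "d * d = 1" using \<phi>(3) ip_e[OF k k] by (simp add: K.ip_scale K.ip_scale_right)
  then have "d = 1 \<or> d = - 1" by (metis power2_eq_1_iff power2_eq_square)
  then show "(\<forall>t\<in>{0..T}. \<phi> t = e k t) \<or> (\<forall>t\<in>{0..T}. \<phi> t = - e k t)" using eq by auto
next
  assume "(\<forall>t\<in>{0..T}. \<phi> t = e k t) \<or> (\<forall>t\<in>{0..T}. \<phi> t = - e k t)"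
  then obtain s :: real where s: "s * s = 1" "\<And>t. t \<in> {0..T} \<Longrightarrow> \<phi> t = s * e k t"
  proof
    assume "\<forall>t\<in>{0..T}. \<phi> t = e k t"
    then show thesis by (intro that[of 1]) auto
  next
    assume "\<forall>t\<in>{0..T}. \<phi> t = - e k t"
    then show thesis by (intro that[of "- 1"]) auto
  qed
  show "normed_eigenfunction T R (l k) \<phi>"
  proof (rule K.normed_eigenfunction_cont)
    show "K.cont \<phi>" by (subst continuous_on_cong[OF refl s(2)]) (auto intro!: continuous_intros cont_e)
    have "K.ip \<phi> \<phi> = K.ip (\<lambda>t. s * e k t) (\<lambda>t. s * e k t)" by (rule K.ip_cong) (auto simp: s)
    then show "K.ip \<phi> \<phi> = 1" using ip_e[OF k k] s(1) by (simp add: K.ip_scale K.ip_scale_right)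
    fix t assume t: "t \<in> {0..T}"
    have "K.op \<phi> t = K.op (\<lambda>t. s * e k t) t" by (rule K.op_cong) (simp add: s)
    then show "K.op \<phi> t = l k * \<phi> t" using op_e[OF k t] s(2)[OF t] by (simp add: K.op_scale)
  qed
qed

end

section \<open>The random coefficients and convergence of the expansion\<close>

locale bridge_KL = wiener_bridge M B T a X + bessel_zeros T a z
  for M :: "'a measure" and B :: "real \<Rightarrow> 'a \<Rightarrow> real" and T a X z
begin

text \<open>\<open>\<zeta>\<close> is the mean-square integral of \<open>X s * e k s\<close>. It is
  described by its inner products with a general \<open>Y\<close>, because two choices are needed:
  \<open>Y = X t\<close>, and \<open>Y\<close> another such coefficient.\<close>

lemma KL_coefficient_exists:
  assumes k: "1 \<le> k"
  obtains \<zeta> where "\<zeta> \<in> gauss_closure M B"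
    "\<And>Y. sq_int M Y \<Longrightarrow> K.cont (\<lambda>s. expectation (\<lambda>\<omega>. Y \<omega> * X s \<omega>)) \<Longrightarrow>
      expectation (\<lambda>\<omega>. Y \<omega> * \<zeta> \<omega>) = K.ip (\<lambda>s. expectation (\<lambda>\<omega>. Y \<omega> * X s \<omega>)) (e k)"
proof -
  define G where "G s \<omega> = e k s * X s \<omega>" for s \<omega>
  have T0: "0 \<le> T" using T_pos by simp
  have iG: "sq_int M (G s)" if "s \<in> {0..T}" for s
    unfolding G_def[abs_def] using that by (intro sq_int_scale sq_int_X)
  have eqG: "(\<integral>\<omega>. G s \<omega> * G t \<omega> \<partial>M) = e k s * e k t * R s t" if "s \<in> {0..T}" "t \<in> {0..T}" for s t
  proof -
    have "(\<integral>\<omega>. G s \<omega> * G t \<omega> \<partial>M) = (\<integral>\<omega>. (e k s * e k t) * (X s \<omega> * X t \<omega>) \<partial>M)"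
      unfolding G_def by (simp only: mult_ac)
    then show ?thesis using covariance_X[OF that] by simp
  qed
  have "continuous_on ({0..T} \<times> {0..T}) (\<lambda>p. e k (fst p) * e k (snd p) * (case p of (s, t) \<Rightarrow> R s t))"
    by (intro continuous_intros continuous_on_R continuous_on_compose2[OF cont_e]) auto
  then have "continuous_on ({0..T} \<times> {0..T}) (\<lambda>(s, t). e k s * e k t * R s t)"
    by (simp add: case_prod_beta)
  then have "continuous_on ({0..T} \<times> {0..T}) (\<lambda>(s, t). \<integral>\<omega>. G s \<omega> * G t \<omega> \<partial>M)"
    by (subst continuous_on_cong[OF refl, where g = "\<lambda>(s, t). e k s * e k t * R s t"]) (auto simp: eqG)
  then have "L2_Cauchy M (rsum 0 T G)" using rsum_L2_Cauchy[OF T0, of M G] iG by blast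
  then obtain \<zeta> where lim: "L2_lim M (rsum 0 T G) \<zeta>" by (rule L2_complete)
  show thesis
  proof (rule that)
    show "\<zeta> \<in> gauss_closure M B"
    proof (rule gauss_closure_lim[OF sq_int_B lim])
      show "rsum 0 T G n \<in> gauss_closure M B" for n
        unfolding rsum_def[abs_def] G_def using T0 node_in[OF T0, of _ n]
        by (intro gauss_closure_sum gauss_closure_scale X_gauss sq_int_B) (auto intro: less_imp_le)
    qed
    fix Y assume Y: "sq_int M Y" and c: "K.cont (\<lambda>s. expectation (\<lambda>\<omega>. Y \<omega> * X s \<omega>))"
    have eq: "expectation (\<lambda>\<omega>. Y \<omega> * G s \<omega>) = e k s * expectation (\<lambda>\<omega>. Y \<omega> * X s \<omega>)" for s
      unfolding G_def by (subst mult.left_commute) (rule integral_mult_right_zero)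
    have "expectation (\<lambda>\<omega>. Y \<omega> * \<zeta> \<omega>) = integral {0..T} (\<lambda>s. expectation (\<lambda>\<omega>. Y \<omega> * G s \<omega>))"
      by (rule L2_lim_rsum_expectation[OF T0 iG Y lim]) (simp_all add: eq continuous_on_mult cont_e c)
    then show "expectation (\<lambda>\<omega>. Y \<omega> * \<zeta> \<omega>) = K.ip (\<lambda>s. expectation (\<lambda>\<omega>. Y \<omega> * X s \<omega>)) (e k)"
      unfolding eq K.ip_def by (simp only: mult.commute)
  qed
qed

lemma KL_coefficients:
  obtains \<xi> where "\<And>k. 1 \<le> k \<Longrightarrow> \<xi> k \<in> gauss_closure M B"
    "\<And>k t. 1 \<le> k \<Longrightarrow> t \<in> {0..T} \<Longrightarrow> expectation (\<lambda>\<omega>. X t \<omega> * \<xi> k \<omega>) = sqrt (l k) * e k t"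
    "\<And>j k. 1 \<le> j \<Longrightarrow> 1 \<le> k \<Longrightarrow> expectation (\<lambda>\<omega>. \<xi> j \<omega> * \<xi> k \<omega>) = (if j = k then 1 else 0)"
proof -
  \<comment> \<open>Packs the existence statement into one predicate, so that a single choice per
    \<open>k\<close> fixes a sequence with all its properties.\<close>
  define good where "good k \<zeta> \<longleftrightarrow> \<zeta> \<in> gauss_closure M B \<and>
    (\<forall>Y. sq_int M Y \<longrightarrow> K.cont (\<lambda>s. expectation (\<lambda>\<omega>. Y \<omega> * X s \<omega>)) \<longrightarrow>
      expectation (\<lambda>\<omega>. Y \<omega> * \<zeta> \<omega>) = K.ip (\<lambda>s. expectation (\<lambda>\<omega>. Y \<omega> * X s \<omega>)) (e k))" for k \<zeta>
  define \<zeta> where "\<zeta> k = (SOME \<zeta>. good k \<zeta>)" for k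
  have good: "good k (\<zeta> k)" if k: "1 \<le> k" for k
  proof -
    have "\<exists>\<zeta>. good k \<zeta>"
      by (rule KL_coefficient_exists[OF k]) (auto simp: good_def)
    then show ?thesis unfolding \<zeta>_def by (rule someI_ex)
  qed
  have mem: "\<zeta> k \<in> gauss_closure M B" if "1 \<le> k" for k using good[OF that] by (simp add: good_def)
  have i\<zeta>: "sq_int M (\<zeta> k)" if "1 \<le> k" for k using gauss_closure_sq_int[OF sq_int_B mem[OF that]] .
  have E: "expectation (\<lambda>\<omega>. Y \<omega> * \<zeta> k \<omega>) = K.ip f (e k)"
    if "1 \<le> k" "sq_int M Y" "K.cont f" "\<And>s. s \<in> {0..T} \<Longrightarrow> expectation (\<lambda>\<omega>. Y \<omega> * X s \<omega>) = f s" for k Y f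
  proof -
    have "K.cont (\<lambda>s. expectation (\<lambda>\<omega>. Y \<omega> * X s \<omega>))"
      by (subst continuous_on_cong[OF refl that(4)]) (auto intro: that(3))
    then have "expectation (\<lambda>\<omega>. Y \<omega> * \<zeta> k \<omega>) = K.ip (\<lambda>s. expectation (\<lambda>\<omega>. Y \<omega> * X s \<omega>)) (e k)"
      using good[OF that(1)] that(2) by (simp add: good_def)
    also have "\<dots> = K.ip f (e k)" by (rule K.ip_cong) (simp_all add: that(4))
    finally show ?thesis .
  qed
  have EX: "expectation (\<lambda>\<omega>. X t \<omega> * \<zeta> k \<omega>) = l k * e k t" if k: "1 \<le> k" and t: "t \<in> {0..T}" for k t
  proof -
    have "expectation (\<lambda>\<omega>. X t \<omega> * \<zeta> k \<omega>) = K.ip (R t) (e k)"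
      by (rule E[OF k sq_int_X[OF t] K.cont_K1[OF t]]) (rule covariance_X[OF t])
    then show ?thesis using op_e[OF k t] by (simp add: K.op_eq_ip)
  qed
  \<comment> \<open>\<open>EX\<close> with the factors exchanged says that the covariance of
    \<open>\<zeta> j\<close> with \<open>X s\<close> is \<open>l j * e j s\<close>, a continuous
    function; integrating it against \<open>e k\<close> gives the second moments.\<close>
  have E\<zeta>: "expectation (\<lambda>\<omega>. \<zeta> j \<omega> * \<zeta> k \<omega>) = (if j = k then l k else 0)" if j: "1 \<le> j" and k: "1 \<le> k" for j k
  proof -
    have "expectation (\<lambda>\<omega>. \<zeta> j \<omega> * \<zeta> k \<omega>) = K.ip (\<lambda>s. l j * e j s) (e k)"
    proof (rule E[OF k i\<zeta>[OF j]])
      show "K.cont (\<lambda>s. l j * e j s)" by (intro continuous_on_mult_left cont_e)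
      show "expectation (\<lambda>\<omega>. \<zeta> j \<omega> * X s \<omega>) = l j * e j s" if "s \<in> {0..T}" for s
        using EX[OF j that] by (simp add: mult.commute)
    qed
    then show ?thesis using ip_e[OF j k] by (simp add: K.ip_scale)
  qed
  define \<xi> where "\<xi> k \<omega> = (1 / sqrt (l k)) * \<zeta> k \<omega>" for k \<omega>
  show thesis
  proof (rule that[of \<xi>])
    show "\<xi> k \<in> gauss_closure M B" if "1 \<le> k" for k
      unfolding \<xi>_def[abs_def] by (intro gauss_closure_scale sq_int_B mem that)
    show "expectation (\<lambda>\<omega>. X t \<omega> * \<xi> k \<omega>) = sqrt (l k) * e k t" if k: "1 \<le> k" and t: "t \<in> {0..T}" for k t
    proof -
      have "expectation (\<lambda>\<omega>. X t \<omega> * \<xi> k \<omega>) = (1 / sqrt (l k)) * expectation (\<lambda>\<omega>. X t \<omega> * \<zeta> k \<omega>)"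
        unfolding \<xi>_def by (subst mult.left_commute) (rule integral_mult_right_zero)
      also have "\<dots> = (l k / sqrt (l k)) * e k t" unfolding EX[OF k t] by simp
      also have "l k / sqrt (l k) = sqrt (l k)" using l_pos[OF k] by (simp add: real_div_sqrt)
      finally show ?thesis .
    qed
    show "expectation (\<lambda>\<omega>. \<xi> j \<omega> * \<xi> k \<omega>) = (if j = k then 1 else 0)" if j: "1 \<le> j" and k: "1 \<le> k" for j k
    proof -
      have "expectation (\<lambda>\<omega>. \<xi> j \<omega> * \<xi> k \<omega>)
          = expectation (\<lambda>\<omega>. (1 / sqrt (l j)) * (1 / sqrt (l k)) * (\<zeta> j \<omega> * \<zeta> k \<omega>))"
        unfolding \<xi>_def by (simp only: mult_ac)
      also have "\<dots> = (1 / sqrt (l j)) * (1 / sqrt (l k)) * (if j = k then l k else 0)"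
        unfolding integral_mult_right_zero E\<zeta>[OF j k] ..
      also have "\<dots> = (if j = k then 1 else 0)" using l_pos[OF k] by simp
      finally show ?thesis .
    qed
  qed
qed

lemma eigenfunction_covariance_kernel: "eigenfunction T (covariance_kernel M X) \<mu> \<phi> \<longleftrightarrow> eigenfunction T R \<mu> \<phi>"
  by (rule eigenfunction_kernel_cong) (rule covariance_kernel_X)

text \<open>The mean-square error is computed exactly before anything is known about convergence.
  Its non-negativity is the hypothesis \<open>bessel\<close> of \<open>Mercer_diagonal\<close>,
  whose conclusion then says that this same error tends to 0 uniformly.\<close>

lemma KL_expansion: "\<exists>\<xi>. karhunen_loeve_expansion M T X l \<xi> e"
proof -
  obtain \<xi> where \<xi>: "\<And>k. 1 \<le> k \<Longrightarrow> \<xi> k \<in> gauss_closure M B"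
    and EX: "\<And>k t. 1 \<le> k \<Longrightarrow> t \<in> {0..T} \<Longrightarrow> expectation (\<lambda>\<omega>. X t \<omega> * \<xi> k \<omega>) = sqrt (l k) * e k t"
    and E\<xi>: "\<And>j k. 1 \<le> j \<Longrightarrow> 1 \<le> k \<Longrightarrow> expectation (\<lambda>\<omega>. \<xi> j \<omega> * \<xi> k \<omega>) = (if j = k then 1 else 0)"
    using KL_coefficients by blast
  have i\<xi>: "sq_int M (\<xi> k)" if "1 \<le> k" for k using gauss_closure_sq_int[OF sq_int_B \<xi>[OF that]] .
  define S where "S n t \<omega> = (\<Sum>k=1..n. sqrt (l k) * \<xi> k \<omega> * e k t)" for n t \<omega>
  have S_eq: "S n t \<omega> = (\<Sum>k=1..n. (sqrt (l k) * e k t) * \<xi> k \<omega>)" for n t \<omega>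
    unfolding S_def by (simp only: mult_ac)
  have iS: "sq_int M (S n t)" for n t
    unfolding S_eq[abs_def] by (intro sq_int_sum sq_int_scale i\<xi>) auto
  have err: "expectation (\<lambda>\<omega>. (X t \<omega> - S n t \<omega>)\<^sup>2) = R t t - (\<Sum>k=1..n. l k * (e k t)\<^sup>2)"
    if t: "t \<in> {0..T}" for n t
  proof -
    note iX = sq_int_X[OF t]
    have sq: "(sqrt (l k) * e k t) * (sqrt (l k) * e k t) = l k * (e k t)\<^sup>2" if "k \<in> {1..n}" for k
    proof -
      have "sqrt (l k) * sqrt (l k) = l k" using that l_pos[of k] by simp
      then show ?thesis by (metis (no_types, opaque_lifting) mult.assoc mult.left_commute power2_eq_square)
    qed
    have "expectation (\<lambda>\<omega>. X t \<omega> * S n t \<omega>)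
        = expectation (\<lambda>\<omega>. \<Sum>k=1..n. (sqrt (l k) * e k t) * (X t \<omega> * \<xi> k \<omega>))"
      unfolding S_eq sum_distrib_left by (simp only: mult.left_commute)
    also have "\<dots> = (\<Sum>k=1..n. (sqrt (l k) * e k t) * expectation (\<lambda>\<omega>. X t \<omega> * \<xi> k \<omega>))"
      using sq_int_mult[OF iX i\<xi>] by (simp add: Bochner_Integration.integral_sum)
    also have "\<dots> = (\<Sum>k=1..n. l k * (e k t)\<^sup>2)"
      by (rule sum.cong) (use EX t sq in auto)
    finally have XS: "expectation (\<lambda>\<omega>. X t \<omega> * S n t \<omega>) = (\<Sum>k=1..n. l k * (e k t)\<^sup>2)" .
    have "expectation (\<lambda>\<omega>. (S n t \<omega>)\<^sup>2) = expectation (\<lambda>\<omega>. \<Sum>j=1..n. \<Sum>k=1..n.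
        ((sqrt (l j) * e j t) * (sqrt (l k) * e k t)) * (\<xi> j \<omega> * \<xi> k \<omega>))"
      unfolding S_eq power2_eq_square sum_product by (simp only: mult_ac)
    also have "\<dots> = (\<Sum>j=1..n. \<Sum>k=1..n. ((sqrt (l j) * e j t) * (sqrt (l k) * e k t)) * expectation (\<lambda>\<omega>. \<xi> j \<omega> * \<xi> k \<omega>))"
    proof -
      have int: "integrable M (\<lambda>\<omega>. ((sqrt (l j) * e j t) * (sqrt (l k) * e k t)) * (\<xi> j \<omega> * \<xi> k \<omega>))"
        if "j \<in> {1..n}" "k \<in> {1..n}" for j k
        using that by (intro integrable_mult_right sq_int_mult i\<xi>) auto
      have "expectation (\<lambda>\<omega>. \<Sum>j=1..n. \<Sum>k=1..n. ((sqrt (l j) * e j t) * (sqrt (l k) * e k t)) * (\<xi> j \<omega> * \<xi> k \<omega>))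
          = (\<Sum>j=1..n. expectation (\<lambda>\<omega>. \<Sum>k=1..n. ((sqrt (l j) * e j t) * (sqrt (l k) * e k t)) * (\<xi> j \<omega> * \<xi> k \<omega>)))"
        using int by (intro Bochner_Integration.integral_sum Bochner_Integration.integrable_sum)
      also have "\<dots> = (\<Sum>j=1..n. \<Sum>k=1..n. expectation (\<lambda>\<omega>. ((sqrt (l j) * e j t) * (sqrt (l k) * e k t)) * (\<xi> j \<omega> * \<xi> k \<omega>)))"
        using int by (intro sum.cong refl Bochner_Integration.integral_sum)
      finally show ?thesis unfolding integral_mult_right_zero .
    qed
    also have "\<dots> = (\<Sum>j=1..n. \<Sum>k=1..n. if j = k then l j * (e j t)\<^sup>2 else 0)"
    proof (intro sum.cong refl)
      fix j k assume jk: "j \<in> {1..n}" "k \<in> {1..n}"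
      show "((sqrt (l j) * e j t) * (sqrt (l k) * e k t)) * expectation (\<lambda>\<omega>. \<xi> j \<omega> * \<xi> k \<omega>) = (if j = k then l j * (e j t)\<^sup>2 else 0)"
        using E\<xi>[of j k] jk sq[OF jk(1)] by auto
    qed
    also have "\<dots> = (\<Sum>k=1..n. l k * (e k t)\<^sup>2)" by simp
    finally have SS: "expectation (\<lambda>\<omega>. (S n t \<omega>)\<^sup>2) = (\<Sum>k=1..n. l k * (e k t)\<^sup>2)" .
    have XX: "expectation (\<lambda>\<omega>. (X t \<omega>)\<^sup>2) = R t t" using covariance_X[OF t t] by (simp add: power2_eq_square)
    show ?thesis unfolding expectation_sq_diff[OF iX iS] XS SS XX by simp
  qed
  have unif: "uniform_limit {0..T} (\<lambda>n t. R t t - (\<Sum>k=1..n. l k * (e k t)\<^sup>2)) (\<lambda>_. 0) sequentially"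
  proof (rule K.Mercer_diagonal)
    show "(\<Sum>k=1..n. l k * (e k t)\<^sup>2) \<le> R t t" if "t \<in> {0..T}" for n t
    proof -
      have "0 \<le> expectation (\<lambda>\<omega>. (X t \<omega> - S n t \<omega>)\<^sup>2)" by simp
      then show ?thesis unfolding err[OF that] by simp
    qed
    fix \<psi> \<mu>
    assume \<psi>: "K.cont \<psi>" "\<mu> \<noteq> 0" "\<exists>t\<in>{0..T}. \<psi> t \<noteq> 0" "\<And>t. t \<in> {0..T} \<Longrightarrow> K.op \<psi> t = \<mu> * \<psi> t"
    show "\<exists>k\<ge>1. K.ip \<psi> (e k) \<noteq> 0"
    proof (rule eigen_cont_classification[OF \<psi>])
      fix k d assume k: "1 \<le> k" "d \<noteq> 0" "\<And>t. t \<in> {0..T} \<Longrightarrow> \<psi> t = d * e k t"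
      have "K.ip \<psi> (e k) = K.ip (\<lambda>t. d * e k t) (e k)" by (rule K.ip_cong) (simp_all add: k(3))
      also have "\<dots> = d" using ip_e[OF k(1) k(1)] by (simp add: K.ip_scale)
      finally show ?thesis using k by auto
    qed
  qed (simp_all add: cont_e op_e l_pos ip_e)
  have indep: "indep_vars (\<lambda>_. borel) \<xi> {1..}"
    and distr: "\<And>k. 1 \<le> k \<Longrightarrow> distributed M lborel (\<xi> k) std_normal_density"
    using orthonormal_gauss_indep[of "{1..}" \<xi>] \<xi> E\<xi> by auto
  \<comment> \<open>The definition of the expansion quantifies over all square-integrable
    eigenfunctions, so the equality almost everywhere has to be carried through the Lebesgue inner
    product.\<close>
  have complete: "\<exists>k\<ge>1. L2_inner T \<phi> (e k) \<noteq> 0" if "\<mu> \<noteq> 0" "eigenfunction T R \<mu> \<phi>" for \<mu> \<phi>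
  proof (rule eigenfunction_classified[OF that(2,1)])
    fix k d assume k: "1 \<le> k" "d \<noteq> 0" "AE t in lborel. t \<in> {0..T} \<longrightarrow> \<phi> t = d * e k t"
    have L2: "L2_fun T \<phi>" using that(2) by (simp add: eigenfunction_def)
    have m: "(\<lambda>s. indicator {0..T} s *\<^sub>R (e k s)) \<in> borel_measurable lborel"
      using K.L2_fun_cont[OF cont_e] by (simp add: L2_fun_def set_borel_measurable_def)
    have m\<phi>: "(\<lambda>s. indicator {0..T} s *\<^sub>R \<phi> s) \<in> borel_measurable lborel"
      using L2 by (simp add: L2_fun_def set_borel_measurable_def)
    have eq: "(indicator {0..T} s *\<^sub>R f s) * (indicator {0..T} s *\<^sub>R h s) = indicator {0..T} s *\<^sub>R (f s * h s)"
      for s and f h :: "real \<Rightarrow> real" by (simp add: indicator_def)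
    have "L2_inner T \<phi> (e k) = L2_inner T (\<lambda>t. d * e k t) (e k)"
      unfolding L2_inner_def set_lebesgue_integral_def
    proof (rule integral_cong_AE)
      show "(\<lambda>s. indicator {0..T} s *\<^sub>R (\<phi> s * e k s)) \<in> borel_measurable lborel"
        unfolding eq[symmetric] by (intro borel_measurable_times m m\<phi>)
      have "(\<lambda>s. d * ((indicator {0..T} s *\<^sub>R e k s) * (indicator {0..T} s *\<^sub>R e k s))) \<in> borel_measurable lborel"
        by (intro borel_measurable_times borel_measurable_const m)
      then show "(\<lambda>s. indicator {0..T} s *\<^sub>R (d * e k s * e k s)) \<in> borel_measurable lborel"
        unfolding eq by (simp add: mult_ac)
      show "AE s in lborel. indicator {0..T} s *\<^sub>R (\<phi> s * e k s) = indicator {0..T} s *\<^sub>R (d * e k s * e k s)"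
        using k(3) by eventually_elim (simp add: indicator_def)
    qed
    also have "\<dots> = K.ip (\<lambda>t. d * e k t) (e k)"
      by (intro K.L2_inner_eq_ip continuous_on_mult_left cont_e)
    also have "\<dots> = d" using ip_e[OF k(1) k(1)] by (simp add: K.ip_scale)
    finally show "\<exists>k\<ge>1. L2_inner T \<phi> (e k) \<noteq> 0" using k by auto
  qed
  have "karhunen_loeve_expansion M T X l \<xi> e"
    unfolding karhunen_loeve_expansion_def normed_eigenfunction_def eigenfunction_covariance_kernel
  proof (intro conjI allI impI ballI)
    show "l k \<noteq> 0" if "1 \<le> k" for k using l_pos[OF that] by simp
    show "continuous_on {0..T} (e k)" for k by (rule cont_e)
    show "eigenfunction T R (l k) (e k)" if "1 \<le> k" for k
      using normed_eigenfunction_e[OF that] by (simp add: normed_eigenfunction_def)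
    show "L2_inner T (e k) (e k) = 1" if "1 \<le> k" for k
      using ip_e[OF that that] by (simp add: K.L2_inner_eq_ip cont_e)
    show "L2_inner T (e j) (e k) = 0" if "1 \<le> j" "1 \<le> k" "j \<noteq> k" for j k
      using ip_e[OF that(1,2)] that(3) by (simp add: K.L2_inner_eq_ip cont_e)
    show "\<exists>k\<ge>1. L2_inner T \<phi> (e k) \<noteq> 0" if "\<mu> \<noteq> 0 \<and> eigenfunction T R \<mu> \<phi>" for \<mu> \<phi>
      using complete that by blast
    show "integrable M (\<lambda>\<omega>. (X t \<omega> - (\<Sum>k=1..n. sqrt (l k) * \<xi> k \<omega> * e k t))\<^sup>2)" if "t \<in> {0..T}" for n t
      using sq_int_sq[OF sq_int_diff[OF sq_int_X[OF that] iS]] by (simp only: S_def)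
    show "uniform_limit {0..T} (\<lambda>n t. \<integral>\<omega>. (X t \<omega> - (\<Sum>k=1..n. sqrt (l k) * \<xi> k \<omega> * e k t))\<^sup>2 \<partial>M) (\<lambda>t. 0) sequentially"
      using unif err unfolding S_def by (subst uniform_limit_cong') auto
  qed (use indep distr in auto)
  note KLE = this
  show ?thesis by (rule exI, rule KLE)
qed

end

text \<open>The explicit Bessel formula agrees with the \<open>e\<close> of the locale only for
  \<open>k \<ge> 1\<close> and \<open>t\<close> in \<open>[0,T]\<close>, not as a function; the
  expansion depends on these values only.\<close>

lemma karhunen_loeve_expansion_cong:
  assumes KL: "karhunen_loeve_expansion M T X l \<xi> e"
    and eq: "\<And>k t. 1 \<le> k \<Longrightarrow> t \<in> {0..T} \<Longrightarrow> e' k t = e k t"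
    and normed: "\<And>k. 1 \<le> k \<Longrightarrow> normed_eigenfunction T (covariance_kernel M X) (l k) (e' k)"
  shows "karhunen_loeve_expansion M T X l \<xi> e'"
proof -
  have inner: "L2_inner T \<phi> (e' k) = L2_inner T \<phi> (e k)" if "1 \<le> k" for \<phi> k
    unfolding L2_inner_def set_lebesgue_integral_def
    using eq[OF that] by (intro Bochner_Integration.integral_cong) (auto simp: indicator_def)
  have inner': "L2_inner T (e' j) \<phi> = L2_inner T (e j) \<phi>" if "1 \<le> j" for \<phi> j
    using inner[OF that] by (simp add: L2_inner_def mult.commute)
  have sum: "(\<Sum>k=1..n. sqrt (l k) * \<xi> k \<omega> * e' k t) = (\<Sum>k=1..n. sqrt (l k) * \<xi> k \<omega> * e k t)"
    if "t \<in> {0..T}" for n t \<omega>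
    using eq that by (intro sum.cong) auto
  have unif: "uniform_limit {0..T}
      (\<lambda>n t. \<integral>\<omega>. (X t \<omega> - (\<Sum>k=1..n. sqrt (l k) * \<xi> k \<omega> * e k t))\<^sup>2 \<partial>M) (\<lambda>t. 0) sequentially"
    using KL by (simp add: karhunen_loeve_expansion_def)
  have unif': "uniform_limit {0..T}
      (\<lambda>n t. \<integral>\<omega>. (X t \<omega> - (\<Sum>k=1..n. sqrt (l k) * \<xi> k \<omega> * e' k t))\<^sup>2 \<partial>M) (\<lambda>t. 0) sequentially"
    by (subst uniform_limit_cong'[OF _ refl, where g = "\<lambda>n t. \<integral>\<omega>. (X t \<omega> - (\<Sum>k=1..n. sqrt (l k) * \<xi> k \<omega> * e k t))\<^sup>2 \<partial>M"])
      (simp_all only: sum unif)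
  note KLs = KL[unfolded karhunen_loeve_expansion_def]
  show ?thesis
    unfolding karhunen_loeve_expansion_def
  proof (intro conjI allI impI ballI)
    show "l k \<noteq> 0" "normed_eigenfunction T (covariance_kernel M X) (l k) (e' k)" if "1 \<le> k" for k
      using KLs that normed by blast+
    show "L2_inner T (e' j) (e' k) = 0" if "1 \<le> j" "1 \<le> k" "j \<noteq> k" for j k
      using KLs that inner[OF that(2)] inner'[OF that(1)] by simp
    show "\<exists>k\<ge>1. L2_inner T \<phi> (e' k) \<noteq> 0" if "\<mu> \<noteq> 0 \<and> eigenfunction T (covariance_kernel M X) \<mu> \<phi>" for \<mu> \<phi>
    proof -
      have "\<exists>k\<ge>1. L2_inner T \<phi> (e k) \<noteq> 0" using KLs that by blast
      then show ?thesis using inner by auto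
    qed
    show "integrable M (\<lambda>\<omega>. (X t \<omega> - (\<Sum>k=1..n. sqrt (l k) * \<xi> k \<omega> * e' k t))\<^sup>2)" if "t \<in> {0..T}" for n t
      unfolding sum[OF that] using KLs that by blast
  qed (use KLs unif' in blast)+
qed

theorem theorem2p1:
  fixes M :: "'a measure" and B X :: "real \<Rightarrow> 'a \<Rightarrow> real"
    and T \<alpha> \<nu> :: real and z l :: "nat \<Rightarrow> real" and e :: "nat \<Rightarrow> real \<Rightarrow> real"
  assumes "0 < T" and "0 < \<alpha>" and "\<nu> = \<alpha> - 1 / 2"
    and "strict_mono_on {1..} z"
    and "z ` {1..} = {x. 0 < x \<and> bessel_J \<nu> x = 0}"
    and "wiener_process M B"
    and "alpha_wiener_bridge M B T \<alpha> X"
  defines "l \<equiv> \<lambda>k. T\<^sup>2 / (z k)\<^sup>2"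
    and "e \<equiv> \<lambda>k t. if \<alpha> < 1 / 2 \<and> t = T then 0
           else sqrt (2 / T * (1 - t / T)) * bessel_J \<nu> (z k * (1 - t / T)) / \<bar>bessel_J (\<nu> + 1) (z k)\<bar>"
  shows "(\<exists>\<xi>. karhunen_loeve_expansion M T X l \<xi> e) \<and>
    {\<mu>. \<mu> \<noteq> 0 \<and> eigenvalue T (covariance_kernel M X) \<mu>} = l ` {1..} \<and>
    (\<forall>k\<ge>1. \<forall>\<phi>. normed_eigenfunction T (covariance_kernel M X) (l k) \<phi> \<longleftrightarrow>
       (\<forall>t\<in>{0..T}. \<phi> t = e k t) \<or> (\<forall>t\<in>{0..T}. \<phi> t = - e k t)) \<and>
    (\<forall>k\<ge>1. \<forall>t\<in>{0..T}. e k t = (if \<alpha> < 1 / 2 \<and> t = T then 0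
       else sqrt (2 / T * (1 - t / T)) * bessel_J \<nu> (z k * (1 - t / T)) / \<bar>bessel_J (\<nu> - 1) (z k)\<bar>))"
proof -
  interpret KL: bridge_KL M B T \<alpha> X z
    by unfold_locales (use assms(1-7) in auto)
  have l: "l = KL.l" by (rule ext) (simp add: l_def KL.l_def)
  have e: "e k t = KL.e k t" if "1 \<le> k" "t \<in> {0..T}" for k t
    by (simp add: KL.e_eq[OF that] e_def assms(3) add.commute[of \<alpha> "1 / 2"])
  have kernel: "normed_eigenfunction T (covariance_kernel M X) \<mu> \<phi> \<longleftrightarrow> normed_eigenfunction T KL.R \<mu> \<phi>" for \<mu> \<phi>
    by (simp add: normed_eigenfunction_def KL.eigenfunction_covariance_kernel)
  have normed: "normed_eigenfunction T (covariance_kernel M X) (l k) \<phi> \<longleftrightarrow>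
      (\<forall>t\<in>{0..T}. \<phi> t = e k t) \<or> (\<forall>t\<in>{0..T}. \<phi> t = - e k t)" if k: "1 \<le> k" for k \<phi>
    unfolding kernel l KL.normed_eigenfunction_iff[OF k] using e[OF k] by auto
  have "\<exists>\<xi>. karhunen_loeve_expansion M T X l \<xi> e"
  proof -
    obtain \<xi> where "karhunen_loeve_expansion M T X l \<xi> KL.e"
      using KL.KL_expansion unfolding l by (rule exE)
    then have "karhunen_loeve_expansion M T X l \<xi> e"
    proof (rule karhunen_loeve_expansion_cong)
      show "e k t = KL.e k t" if "1 \<le> k" "t \<in> {0..T}" for k t by (rule e[OF that])
      show "normed_eigenfunction T (covariance_kernel M X) (l k) (e k)" if "1 \<le> k" for k
        \<comment> \<open>Inserting \<open>e k\<close> itself into the characterisation shows that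
          the explicit formula is a normed eigenfunction, including its continuity at
          \<open>T\<close>.\<close>
        using normed[OF that, of "e k"] by simp
    qed
    note KLe = this
    show ?thesis by (rule exI, rule KLe)
  qed
  moreover have "{\<mu>. \<mu> \<noteq> 0 \<and> eigenvalue T (covariance_kernel M X) \<mu>} = l ` {1..}"
    using KL.eigenvalues unfolding l by (simp add: eigenvalue_def KL.eigenfunction_covariance_kernel)
  moreover have "e k t = (if \<alpha> < 1 / 2 \<and> t = T then 0
       else sqrt (2 / T * (1 - t / T)) * bessel_J \<nu> (z k * (1 - t / T)) / \<bar>bessel_J (\<nu> - 1) (z k)\<bar>)"
    if k: "1 \<le> k" for k t
  proof -
    have "bessel_J \<nu> (z k) = 0" using KL.z_zero[OF k] assms(3) by simp
    then have "\<bar>bessel_J (\<nu> - 1) (z k)\<bar> = \<bar>bessel_J (\<nu> + 1) (z k)\<bar>"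
      using bessel_J_neighbours_at_zero[OF KL.z_pos[OF k]] by simp
    then show ?thesis by (simp add: e_def)
  qed
  ultimately show ?thesis using normed by blast
qed

end
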